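(* Let $A_n=[a_{i,j}^{(n)}]_{i,j=1}^n\in M_n(\mathbb{C})$, $n\in\mathbb{N}$, be a sequence of selfadjoint matrices such that $\sup_{i,j,n}|a_{i,j}^{(n)}|<\infty$ and such that the matrices $\frac1nA_n$ have limit distribution $\mu$ with respect to the nonnormalized trace. Let $X_1,X_2,\dots$ be free copies of a centered self-adjoint random variable $X$ of variance $1$ in a tracial noncommutative probability space $(\mathcal{A},\tau)$. Then the sequence of quadratic forms $$Q_n=\frac1n\sum_{i,j=1}^na_{i,j}^{(n)}X_iX_j$$ converges in distribution, as $n\to\infty$, to a random variable $Y$ whose free cumulants are $$K_r(Y)=\int t^r\,d\mu(t),\qquad r\ge1.$$
   Context: A sequence of $n\times n$ deterministic matrices $B_n$ has limit distribution $\mu$ with respect to the nonnormalized trace, where $\mu$ is a (not necessarily probability) measure on $\mathbb{R}$ with all moments of order $m\ge1$ finite, if $\lim_{n\to\infty}\operatorname{Tr}(B_n^m)=\int t^m\,d\mu(t)$ for every $m\in\mathbb{N}=\{1,2,\dots\}$, where $\operatorname{Tr}$ is the usual (unnormalized) trace. A tracial noncommutative probability space $(\mathcal{A},\tau)$ is a von Neumann algebra with a normal faithful tracial state. Free cumulants $K_n:\mathcal{A}^n\to\mathbb{C}$ are defined implicitly by $\tau(X_1\cdots X_n)=\sum_{\pi\in NC(n)}\prod_{B\in\pi}K_{|B|}(X_i: i\in B)$, where $NC(n)$ is the set of noncrossing partitions of $\{1,\dots,n\}$; $K_n(X)=K_n(X,\dots,X)$. Convergence in distribution $X_n\to X$ means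 $\tau(X_n^m)\to\tau(X^m)$ for all $m\in\mathbb{N}$, equivalently $K_m(X_n)\to K_m(X)$ for all $m$. Centered means $\tau(X)=0$; variance is $\tau(X^2)-\tau(X)^2$. *)

theory Defs
  imports "HOL-Analysis.Analysis" "Jordan_Normal_Form.Schur_Decomposition"
begin

section \<open>Complex Hilbert spaces\<close>

text \<open>The inner product is linear in the first argument; its real part is the inner product
  of the underlying real Hilbert space, which therefore carries the norm and the topology.\<close>

class complex_hilbert = real_inner + complete_space +
  fixes scaleC :: "complex \<Rightarrow> 'a \<Rightarrow> 'a"
    and cinner :: "'a \<Rightarrow> 'a \<Rightarrow> complex"
  assumes scaleC_add_right: "scaleC c (x + y) = scaleC c x + scaleC c y"
    and scaleC_add_left: "scaleC (c + d) x = scaleC c x + scaleC d x"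
    and scaleC_scaleC: "scaleC c (scaleC d x) = scaleC (c * d) x"
    and scaleC_of_real: "scaleC (complex_of_real r) x = scaleR r x"
    and cinner_commute: "cinner x y = cnj (cinner y x)"
    and cinner_add_left: "cinner (x + y) z = cinner x z + cinner y z"
    and cinner_scaleC_left: "cinner (scaleC c x) y = c * cinner x y"
    and inner_eq_Re_cinner: "inner x y = Re (cinner x y)"
begin

lemma cinner_scaleC_right: "cinner x (scaleC c y) = cnj c * cinner x y"
  by (metis cinner_commute cinner_scaleC_left complex_cnj_mult)

end

lemma cinner_self: "cinner x x = complex_of_real ((norm (x::'a::complex_hilbert))\<^sup>2)"
proof -
  have "Im (cinner x x) = 0"
    using cinner_commute[of x x] by (metis Reals_cnj_iff complex_is_Real_iff)
  then show ?thesis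
    by (simp add: complex_eq_iff power2_norm_eq_inner inner_eq_Re_cinner)
qed

lemma norm_scaleC: "norm (scaleC c (x::'a::complex_hilbert)) = cmod c * norm x"
proof -
  have "complex_of_real ((norm (scaleC c x))\<^sup>2) = c * cnj c * cinner x x"
    by (simp only: cinner_self[symmetric] cinner_scaleC_left cinner_scaleC_right ac_simps)
  also have "\<dots> = complex_of_real ((cmod c * norm x)\<^sup>2)"
    by (simp only: cinner_self complex_norm_square[symmetric] of_real_mult of_real_power power_mult_distrib)
  finally have "(norm (scaleC c x))\<^sup>2 = (cmod c * norm x)\<^sup>2"
    by (simp only: of_real_eq_iff)
  then show ?thesis
    by (simp add: power2_eq_iff_nonneg)
qed

subsection \<open>The Hilbert space of square-summable complex sequences\<close>

typedef ell2 = "{f :: nat \<Rightarrow> complex. summable (\<lambda>k. (cmod (f k))\<^sup>2)}"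
  morphisms ell2_nth Abs_ell2
  by (rule exI[of _ "\<lambda>_. 0"]) simp

lemma ell2_summable: "summable (\<lambda>k. (cmod (ell2_nth x k))\<^sup>2)"
  using ell2_nth by blast

lemma ell2_nth_Abs: "summable (\<lambda>k. (cmod (f k))\<^sup>2) \<Longrightarrow> ell2_nth (Abs_ell2 f) = f"
  by (rule Abs_ell2_inverse) simp

lemma ell2_eqI: "(\<And>k. ell2_nth x k = ell2_nth y k) \<Longrightarrow> x = y"
  by (metis ell2_nth_inject ext)

lemma ell2_add_summable:
  assumes "summable (\<lambda>k. (cmod (f k))\<^sup>2)" "summable (\<lambda>k. (cmod (g k))\<^sup>2)"
  shows "summable (\<lambda>k. (cmod (f k + g k))\<^sup>2)"
proof (rule summable_comparison_test')
  show "summable (\<lambda>k. 2 * (cmod (f k))\<^sup>2 + 2 * (cmod (g k))\<^sup>2)"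
    using assms by (intro summable_add summable_mult)
  show "norm ((cmod (f k + g k))\<^sup>2) \<le> 2 * (cmod (f k))\<^sup>2 + 2 * (cmod (g k))\<^sup>2" if "k \<ge> 0" for k
  proof -
    have "(cmod (f k + g k))\<^sup>2 \<le> (cmod (f k) + cmod (g k))\<^sup>2"
      by (intro power_mono norm_triangle_ineq norm_ge_zero)
    also have "\<dots> \<le> 2 * (cmod (f k))\<^sup>2 + 2 * (cmod (g k))\<^sup>2"
      using sum_squares_bound[of "cmod (f k)" "cmod (g k)"] by (simp add: power2_sum)
    finally show ?thesis by simp
  qed
qed

lemma ell2_mult_summable:
  assumes "summable (\<lambda>k. (cmod (f k))\<^sup>2)" "summable (\<lambda>k. (cmod (g k))\<^sup>2)"
  shows "summable (\<lambda>k. f k * cnj (g k))"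
proof (rule summable_comparison_test')
  show "summable (\<lambda>k. (cmod (f k))\<^sup>2 + (cmod (g k))\<^sup>2)"
    using assms by (intro summable_add)
  show "norm (f k * cnj (g k)) \<le> (cmod (f k))\<^sup>2 + (cmod (g k))\<^sup>2" if "k \<ge> 0" for k
  proof -
    have a: "2 * cmod (f k) * cmod (g k) \<le> (cmod (f k))\<^sup>2 + (cmod (g k))\<^sup>2"
      by (rule sum_squares_bound)
    have "0 \<le> cmod (f k) * cmod (g k)" by simp
    then have "cmod (f k) * cmod (g k) \<le> (cmod (f k))\<^sup>2 + (cmod (g k))\<^sup>2"
      using a by linarith
    then show ?thesis by (simp add: norm_mult)
  qed
qed

lemma ell2_scale_summable:
  "summable (\<lambda>k. (cmod (f k))\<^sup>2) \<Longrightarrow> summable (\<lambda>k. (cmod (c * f k))\<^sup>2)"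
  by (simp add: norm_mult power_mult_distrib summable_mult)

instantiation ell2 :: real_vector
begin
definition "0 = Abs_ell2 (\<lambda>_. 0)"
definition "x + y = Abs_ell2 (\<lambda>k. ell2_nth x k + ell2_nth y k)"
definition "- x = Abs_ell2 (\<lambda>k. - ell2_nth x k)"
definition "x - y = Abs_ell2 (\<lambda>k. ell2_nth x k - ell2_nth y k)"
definition "scaleR r x = Abs_ell2 (\<lambda>k. complex_of_real r * ell2_nth x k)"

lemma ell2_nth_0 [simp]: "ell2_nth 0 k = 0"
  by (simp add: zero_ell2_def ell2_nth_Abs)

lemma ell2_nth_add [simp]: "ell2_nth (x + y) k = ell2_nth x k + ell2_nth y k"
  by (simp add: plus_ell2_def ell2_nth_Abs ell2_add_summable ell2_summable)

lemma ell2_nth_uminus [simp]: "ell2_nth (- x) k = - ell2_nth x k"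
  by (simp add: uminus_ell2_def ell2_nth_Abs ell2_summable)

lemma ell2_nth_diff [simp]: "ell2_nth (x - y) k = ell2_nth x k - ell2_nth y k"
proof -
  have "summable (\<lambda>k. (cmod (ell2_nth x k + - ell2_nth y k))\<^sup>2)"
    by (rule ell2_add_summable) (simp_all add: ell2_summable)
  then show ?thesis by (simp add: minus_ell2_def ell2_nth_Abs)
qed

lemma ell2_nth_scaleR [simp]: "ell2_nth (scaleR r x) k = complex_of_real r * ell2_nth x k"
  by (simp only: scaleR_ell2_def ell2_nth_Abs ell2_scale_summable ell2_summable)

instance
  by standard (auto intro!: ell2_eqI simp: algebra_simps)
end

instantiation ell2 :: real_inner
begin
definition "inner x y = Re (\<Sum>k. ell2_nth x k * cnj (ell2_nth y k))"
definition norm_ell2 :: "ell2 \<Rightarrow> real" where "norm_ell2 x = sqrt (inner x x)"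
definition dist_ell2 :: "ell2 \<Rightarrow> ell2 \<Rightarrow> real" where "dist_ell2 x y = norm (x - y)"
definition sgn_ell2 :: "ell2 \<Rightarrow> ell2" where "sgn_ell2 x = scaleR (inverse (norm x)) x"
definition [code del]:
  "(uniformity :: (ell2 \<times> ell2) filter) = (INF e\<in>{0 <..}. principal {(x, y). dist x y < e})"
definition [code del]:
  "open (S :: ell2 set) = (\<forall>x\<in>S. \<forall>\<^sub>F (x', y) in uniformity. x' = x \<longrightarrow> y \<in> S)"

lemma ell2_inner_self: "inner x x = (\<Sum>k. (cmod (ell2_nth x k))\<^sup>2)"
proof -
  have "(\<Sum>k. ell2_nth x k * cnj (ell2_nth x k)) = (\<Sum>k. complex_of_real ((cmod (ell2_nth x k))\<^sup>2))"
    by (simp only: complex_norm_square)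
  also have "\<dots> = complex_of_real (\<Sum>k. (cmod (ell2_nth x k))\<^sup>2)"
    by (intro suminf_of_real[symmetric] ell2_summable)
  finally show ?thesis by (simp add: inner_ell2_def)
qed

lemma ell2_inner_summable: "summable (\<lambda>k. ell2_nth x k * cnj (ell2_nth y k))"
  by (intro ell2_mult_summable ell2_summable)

instance
proof
  fix x y z :: ell2 and r :: real
  have c: "ell2_nth x k * cnj (ell2_nth y k) = cnj (ell2_nth y k * cnj (ell2_nth x k))" for k
    by simp
  have "(\<Sum>k. ell2_nth x k * cnj (ell2_nth y k)) = cnj (\<Sum>k. ell2_nth y k * cnj (ell2_nth x k))"
    unfolding c
    by (rule sums_unique[symmetric]) (simp only: sums_cnj summable_sums ell2_inner_summable)
  then show "inner x y = inner y x" by (simp add: inner_ell2_def)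
  show "inner (x + y) z = inner x z + inner y z"
    by (simp add: inner_ell2_def distrib_right suminf_add[symmetric] ell2_inner_summable)
  have "(\<Sum>k. complex_of_real r * (ell2_nth x k * cnj (ell2_nth y k)))
      = complex_of_real r * (\<Sum>k. ell2_nth x k * cnj (ell2_nth y k))"
    by (intro suminf_mult ell2_inner_summable)
  then show "inner (scaleR r x) y = r * inner x y"
    by (simp add: inner_ell2_def mult.assoc)
  show "0 \<le> inner x x" by (simp add: ell2_inner_self suminf_nonneg ell2_summable)
  show "inner x x = 0 \<longleftrightarrow> x = 0"
  proof
    assume "inner x x = 0"
    then have "\<forall>k. (cmod (ell2_nth x k))\<^sup>2 = 0"
      using suminf_eq_zero_iff[OF ell2_summable[of x]] by (simp add: ell2_inner_self)
    then show "x = 0" by (intro ell2_eqI) simp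
  qed (simp add: ell2_inner_self)
qed (simp_all add: norm_ell2_def dist_ell2_def sgn_ell2_def uniformity_ell2_def open_ell2_def)
end

lemma ell2_norm_sq: "(norm (x::ell2))\<^sup>2 = (\<Sum>k. (cmod (ell2_nth x k))\<^sup>2)"
  by (simp add: power2_norm_eq_inner ell2_inner_self)

lemma ell2_sum_le_norm_sq: "(\<Sum>k<N. (cmod (ell2_nth x k))\<^sup>2) \<le> (norm x)\<^sup>2"
  unfolding ell2_norm_sq by (intro sum_le_suminf ell2_summable) auto

lemma ell2_nth_le_norm: "cmod (ell2_nth x k) \<le> norm x"
proof -
  have "(cmod (ell2_nth x k))\<^sup>2 \<le> (\<Sum>j<Suc k. (cmod (ell2_nth x j))\<^sup>2)"
    by (rule member_le_sum) auto
  also have "\<dots> \<le> (norm x)\<^sup>2" by (rule ell2_sum_le_norm_sq)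
  finally show ?thesis by (rule power2_le_imp_le) simp
qed

instance ell2 :: complete_space
proof
  fix X :: "nat \<Rightarrow> ell2"
  assume X: "Cauchy X"
  have "\<exists>l. (\<lambda>m. ell2_nth (X m) k) \<longlonglongrightarrow> l" for k
  proof -
    have "Cauchy (\<lambda>m. ell2_nth (X m) k)"
      unfolding Cauchy_def
    proof (intro allI impI)
      fix e :: real assume "e > 0"
      then obtain M where M: "\<forall>m\<ge>M. \<forall>n\<ge>M. dist (X m) (X n) < e"
        using X unfolding Cauchy_def by blast
      have "dist (ell2_nth (X m) k) (ell2_nth (X n) k) \<le> dist (X m) (X n)" for m n
        using ell2_nth_le_norm[of "X m - X n" k] by (simp add: dist_norm)
      then show "\<exists>M. \<forall>m\<ge>M. \<forall>n\<ge>M. dist (ell2_nth (X m) k) (ell2_nth (X n) k) < e"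
        using M by (meson le_less_trans)
    qed
    then show ?thesis by (simp add: Cauchy_convergent_iff convergent_def)
  qed
  then obtain L where L: "\<And>k. (\<lambda>m. ell2_nth (X m) k) \<longlonglongrightarrow> L k" by metis
  have tail: "\<exists>M. \<forall>m\<ge>M. \<forall>N. (\<Sum>k<N. (cmod (ell2_nth (X m) k - L k))\<^sup>2) \<le> e\<^sup>2"
    if e: "e > 0" for e :: real
  proof -
    obtain M where M: "\<forall>m\<ge>M. \<forall>n\<ge>M. dist (X m) (X n) < e"
      using X e unfolding Cauchy_def by blast
    have "(\<Sum>k<N. (cmod (ell2_nth (X m) k - L k))\<^sup>2) \<le> e\<^sup>2" if m: "m \<ge> M" for m N
    proof (rule tendsto_upperbound)
      show "(\<lambda>n. \<Sum>k<N. (cmod (ell2_nth (X m) k - ell2_nth (X n) k))\<^sup>2)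
          \<longlonglongrightarrow> (\<Sum>k<N. (cmod (ell2_nth (X m) k - L k))\<^sup>2)"
        by (intro tendsto_intros L)
      show "\<forall>\<^sub>F n in sequentially. (\<Sum>k<N. (cmod (ell2_nth (X m) k - ell2_nth (X n) k))\<^sup>2) \<le> e\<^sup>2"
      proof (rule eventually_sequentiallyI)
        fix n assume "M \<le> n"
        then have "norm (X m - X n) \<le> e" using M m by (simp add: dist_norm less_imp_le)
        then have "(norm (X m - X n))\<^sup>2 \<le> e\<^sup>2" by (intro power_mono) auto
        then show "(\<Sum>k<N. (cmod (ell2_nth (X m) k - ell2_nth (X n) k))\<^sup>2) \<le> e\<^sup>2"
          using ell2_sum_le_norm_sq[where x="X m - X n" and N=N] by simp
      qed
    qed simp
    then show ?thesis by blast
  qed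
  have diff: "summable (\<lambda>k. (cmod (ell2_nth (X m) k - L k))\<^sup>2)"
    if "\<forall>N. (\<Sum>k<N. (cmod (ell2_nth (X m) k - L k))\<^sup>2) \<le> c" for m c
    using that by (intro summableI_nonneg_bounded[where x=c]) auto
  obtain M1 where M1: "\<forall>N. (\<Sum>k<N. (cmod (ell2_nth (X M1) k - L k))\<^sup>2) \<le> 1\<^sup>2"
    using tail[of 1] by auto
  have "cmod (- ell2_nth (X M1) k + L k) = cmod (ell2_nth (X M1) k - L k)" for k
    using norm_minus_commute[of "L k" "ell2_nth (X M1) k"] by simp
  then have "summable (\<lambda>k. (cmod (- ell2_nth (X M1) k + L k))\<^sup>2)"
    using diff[OF M1] by simp
  from ell2_add_summable[OF ell2_summable[of "X M1"] this]
  have sL: "summable (\<lambda>k. (cmod (L k))\<^sup>2)" by simp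
  define l where "l = Abs_ell2 L"
  have l: "ell2_nth l = L" unfolding l_def by (rule ell2_nth_Abs[OF sL])
  have "X \<longlonglongrightarrow> l"
  proof (rule metric_LIMSEQ_I)
    fix r :: real assume r: "r > 0"
    then obtain M where M: "\<forall>m\<ge>M. \<forall>N. (\<Sum>k<N. (cmod (ell2_nth (X m) k - L k))\<^sup>2) \<le> (r/2)\<^sup>2"
      using tail[of "r/2"] by (meson half_gt_zero)
    have "dist (X m) l < r" if "m \<ge> M" for m
    proof -
      have "(norm (X m - l))\<^sup>2 \<le> (r/2)\<^sup>2"
        unfolding ell2_norm_sq
      proof (rule suminf_le_const[OF ell2_summable])
        show "(\<Sum>k<N. (cmod (ell2_nth (X m - l) k))\<^sup>2) \<le> (r/2)\<^sup>2" for N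
          using M[rule_format, OF that, of N] by (simp only: ell2_nth_diff l)
      qed
      then have "norm (X m - l) \<le> r/2" by (rule power2_le_imp_le) (use r in simp)
      then show ?thesis using r by (simp add: dist_norm)
    qed
    then show "\<exists>no. \<forall>n\<ge>no. dist (X n) l < r" by blast
  qed
  then show "convergent X" by (rule convergentI)
qed

instantiation ell2 :: complex_hilbert
begin
definition "scaleC c x = Abs_ell2 (\<lambda>k. c * ell2_nth x k)"
definition "cinner x y = (\<Sum>k. ell2_nth x k * cnj (ell2_nth y k))"

lemma ell2_nth_scaleC [simp]: "ell2_nth (scaleC c x) k = c * ell2_nth x k"
  by (simp only: scaleC_ell2_def ell2_nth_Abs ell2_scale_summable ell2_summable)

instance
proof
  fix x y z :: ell2 and c d :: complex and r :: real
  show "scaleC c (x + y) = scaleC c x + scaleC c y" by (auto intro!: ell2_eqI simp: algebra_simps)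
  show "scaleC (c + d) x = scaleC c x + scaleC d x" by (auto intro!: ell2_eqI simp: algebra_simps)
  show "scaleC c (scaleC d x) = scaleC (c * d) x" by (auto intro!: ell2_eqI simp: algebra_simps)
  show "scaleC (complex_of_real r) x = scaleR r x" by (auto intro!: ell2_eqI)
  have e: "ell2_nth x k * cnj (ell2_nth y k) = cnj (ell2_nth y k * cnj (ell2_nth x k))" for k
    by simp
  show "cinner x y = cnj (cinner y x)"
    unfolding cinner_ell2_def e
    by (rule sums_unique[symmetric]) (simp only: sums_cnj summable_sums ell2_inner_summable)
  show "cinner (x + y) z = cinner x z + cinner y z"
    by (simp add: cinner_ell2_def distrib_right suminf_add[symmetric] ell2_inner_summable)
  have "(\<Sum>k. c * (ell2_nth x k * cnj (ell2_nth y k)))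
      = c * (\<Sum>k. ell2_nth x k * cnj (ell2_nth y k))"
    by (intro suminf_mult ell2_inner_summable)
  then show "cinner (scaleC c x) y = c * cinner x y"
    by (simp add: cinner_ell2_def mult.assoc)
  show "inner x y = Re (cinner x y)" by (simp add: inner_ell2_def cinner_ell2_def)
qed
end

section \<open>Von Neumann algebras\<close>

text \<open>Elements of the library type \<^typ>\<open>'h \<Rightarrow>\<^sub>L 'h\<close> are only real-linear, so
  complex linearity is imposed separately.\<close>

definition clinear_op :: "('h::complex_hilbert \<Rightarrow>\<^sub>L 'h) \<Rightarrow> bool" where
  "clinear_op T \<longleftrightarrow> (\<forall>c x. blinfun_apply T (scaleC c x) = scaleC c (blinfun_apply T x))"

lift_definition scaleC_op :: "complex \<Rightarrow> ('h::complex_hilbert \<Rightarrow>\<^sub>L 'h) \<Rightarrow> ('h \<Rightarrow>\<^sub>L 'h)"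
  is "\<lambda>c T x. scaleC c (T x)"
proof -
  fix c :: complex and T :: "'h \<Rightarrow> 'h"
  assume T: "bounded_linear T"
  have "bounded_linear (\<lambda>x::'h. scaleC c x)"
  proof (rule bounded_linear_intro)
    show "scaleC c (scaleR r x) = scaleR r (scaleC c x)" for r and x :: 'h
      by (simp add: scaleC_of_real[symmetric] scaleC_scaleC mult.commute)
    show "norm (scaleC c x) \<le> norm x * cmod c" for x :: 'h
      by (simp add: norm_scaleC mult.commute)
  qed (rule scaleC_add_right)
  then show "bounded_linear (\<lambda>x. scaleC c (T x))"
    using T by (rule bounded_linear_compose)
qed

definition is_adjoint :: "('h::complex_hilbert \<Rightarrow>\<^sub>L 'h) \<Rightarrow> ('h \<Rightarrow>\<^sub>L 'h) \<Rightarrow> bool" where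
  "is_adjoint T S \<longleftrightarrow>
    (\<forall>x y. cinner (blinfun_apply T x) y = cinner x (blinfun_apply S y))"

definition selfadjoint :: "('h::complex_hilbert \<Rightarrow>\<^sub>L 'h) \<Rightarrow> bool" where
  "selfadjoint T \<longleftrightarrow> is_adjoint T T"

definition positive_op :: "('h::complex_hilbert \<Rightarrow>\<^sub>L 'h) \<Rightarrow> bool" where
  "positive_op T \<longleftrightarrow> (\<forall>x. cinner (blinfun_apply T x) x \<in> \<real>\<^sub>\<ge>\<^sub>0)"

definition commutant :: "('h::complex_hilbert \<Rightarrow>\<^sub>L 'h) set \<Rightarrow> ('h \<Rightarrow>\<^sub>L 'h) set" where
  "commutant M = {S. clinear_op S \<and> (\<forall>T\<in>M. S o\<^sub>L T = T o\<^sub>L S)}"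

definition von_neumann_algebra :: "('h::complex_hilbert \<Rightarrow>\<^sub>L 'h) set \<Rightarrow> bool" where
  "von_neumann_algebra M \<longleftrightarrow>
    (\<forall>T\<in>M. clinear_op T) \<and> (\<forall>T\<in>M. \<exists>S\<in>M. is_adjoint T S) \<and> commutant (commutant M) = M"

text \<open>Normality: the trace preserves suprema of bounded upward directed families of positive
  elements. By Vigier's theorem such a supremum is the strong operator limit of the family, so
  it is the operator \<open>T\<close> whose quadratic form is the pointwise supremum.\<close>

definition is_directed_sup :: "('h::complex_hilbert \<Rightarrow>\<^sub>L 'h) set \<Rightarrow> ('h \<Rightarrow>\<^sub>L 'h) \<Rightarrow> bool" where
  "is_directed_sup D T \<longleftrightarrow>
    D \<noteq> {} \<and>
    (\<forall>R\<in>D. \<forall>S\<in>D. \<exists>U\<in>D. positive_op (U - R) \<and> positive_op (U - S)) \<and>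
    (\<forall>S\<in>D. positive_op (T - S)) \<and>
    (\<forall>x. Re (cinner (blinfun_apply T x) x) = (SUP S\<in>D. Re (cinner (blinfun_apply S x) x)))"

definition normal_on ::
  "('h::complex_hilbert \<Rightarrow>\<^sub>L 'h) set \<Rightarrow> (('h \<Rightarrow>\<^sub>L 'h) \<Rightarrow> complex) \<Rightarrow> bool" where
  "normal_on M \<tau> \<longleftrightarrow>
    (\<forall>D T. D \<subseteq> M \<longrightarrow> T \<in> M \<longrightarrow> (\<forall>S\<in>D. positive_op S) \<longrightarrow> is_directed_sup D T \<longrightarrow>
      Re (\<tau> T) = (SUP S\<in>D. Re (\<tau> S)))"

text \<open>Only the values of \<open>\<tau>\<close> on \<open>M\<close> are meaningful.\<close>

locale tracial_ncps =
  fixes M :: "('h::complex_hilbert \<Rightarrow>\<^sub>L 'h) set"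
    and \<tau> :: "('h \<Rightarrow>\<^sub>L 'h) \<Rightarrow> complex"
  assumes von_neumann: "von_neumann_algebra M"
    and trace_add: "S \<in> M \<Longrightarrow> T \<in> M \<Longrightarrow> \<tau> (S + T) = \<tau> S + \<tau> T"
    and trace_scaleC: "T \<in> M \<Longrightarrow> \<tau> (scaleC_op c T) = c * \<tau> T"
    and trace_unit: "\<tau> id_blinfun = 1"
    and trace_positive: "S \<in> M \<Longrightarrow> T \<in> M \<Longrightarrow> is_adjoint T S \<Longrightarrow> \<tau> (S o\<^sub>L T) \<in> \<real>\<^sub>\<ge>\<^sub>0"
    and trace_faithful:
      "S \<in> M \<Longrightarrow> T \<in> M \<Longrightarrow> is_adjoint T S \<Longrightarrow> \<tau> (S o\<^sub>L T) = 0 \<Longrightarrow> T = 0"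
    and trace_commute: "S \<in> M \<Longrightarrow> T \<in> M \<Longrightarrow> \<tau> (S o\<^sub>L T) = \<tau> (T o\<^sub>L S)"
    and trace_normal: "normal_on M \<tau>"

section \<open>Moments, free cumulants and freeness\<close>

definition op_prod :: "('h::real_normed_vector \<Rightarrow>\<^sub>L 'h) list \<Rightarrow> ('h \<Rightarrow>\<^sub>L 'h)" where
  "op_prod Ts = foldr (o\<^sub>L) Ts id_blinfun"

definition moment ::
  "(('h::real_normed_vector \<Rightarrow>\<^sub>L 'h) \<Rightarrow> complex) \<Rightarrow> nat \<Rightarrow> ('h \<Rightarrow>\<^sub>L 'h) \<Rightarrow> complex" where
  "moment \<tau> m T = \<tau> (op_prod (replicate m T))"

definition noncrossing :: "nat set set \<Rightarrow> bool" where
  "noncrossing \<pi> \<longleftrightarrow>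
    (\<forall>B\<in>\<pi>. \<forall>C\<in>\<pi>. \<forall>a\<in>B. \<forall>b\<in>C. \<forall>c\<in>B. \<forall>d\<in>C. a < b \<and> b < c \<and> c < d \<longrightarrow> B = C)"

definition NC :: "nat \<Rightarrow> nat set set set" where
  "NC n = {\<pi>. partition_on {..<n} \<pi> \<and> noncrossing \<pi>}"

lemma finite_NC: "finite (NC n)"
  unfolding NC_def by (rule finite_subset[OF _ finitely_many_partition_on[of "{..<n}"]]) auto

lemma NC_top: "n > 0 \<Longrightarrow> {{..<n}} \<in> NC n"
  by (auto simp: NC_def noncrossing_def partition_on_def)

lemma NC_block_less:
  assumes "\<pi> \<in> NC (length xs) - {{{..<length xs}}}" "B \<in> \<pi>"
  shows "length (nths xs B) < length xs"
proof -
  have p: "partition_on {..<length xs} \<pi>" using assms by (simp add: NC_def)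
  have sub: "B \<subseteq> {..<length xs}" using p assms(2) by (auto simp: partition_on_def)
  have "B \<noteq> {..<length xs}"
  proof
    assume B: "B = {..<length xs}"
    have "C = B" if C: "C \<in> \<pi>" for C
    proof (rule ccontr)
      assume "C \<noteq> B"
      then have "C \<inter> B = {}" using p C assms(2) by (auto simp: partition_on_def disjoint_def)
      moreover have "C \<subseteq> B" "C \<noteq> {}" using p C B by (auto simp: partition_on_def)
      ultimately show False by blast
    qed
    then have "\<pi> = {{..<length xs}}" using assms(2) B by blast
    then show False using assms(1) by blast
  qed
  then have "card B < card {..<length xs}" using sub by (intro psubset_card_mono) auto
  moreover have "{i. i < length xs \<and> i \<in> B} = B" using sub by auto
  ultimately show ?thesis by (simp add: length_nths)
qed

text \<open>The moment-cumulant formula solved for the term of the one-block partition;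
  \<^term>\<open>nths Ts B\<close> lists the arguments at the positions in \<open>B\<close> in increasing order.
  The implicit form is the lemma \<open>moment_cumulant_formula\<close>.\<close>

function free_cumulant ::
  "(('h::real_normed_vector \<Rightarrow>\<^sub>L 'h) \<Rightarrow> complex) \<Rightarrow> ('h \<Rightarrow>\<^sub>L 'h) list \<Rightarrow> complex" where
  "free_cumulant \<tau> Ts = \<tau> (op_prod Ts) -
    (\<Sum>\<pi> \<in> NC (length Ts) - {{{..<length Ts}}}. \<Prod>B\<in>\<pi>. free_cumulant \<tau> (nths Ts B))"
  by pat_completeness auto
termination
  by (relation "Wellfounded.measure (\<lambda>(\<tau>, Ts). length Ts)") (auto intro: NC_block_less)

declare free_cumulant.simps [simp del]

lemma moment_cumulant_formula:
  assumes "Ts \<noteq> []"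
  shows "\<tau> (op_prod Ts) = (\<Sum>\<pi> \<in> NC (length Ts). \<Prod>B\<in>\<pi>. free_cumulant \<tau> (nths Ts B))"
proof -
  have "{{..<length Ts}} \<in> NC (length Ts)" using assms by (intro NC_top) simp
  then have "(\<Sum>\<pi> \<in> NC (length Ts). \<Prod>B\<in>\<pi>. free_cumulant \<tau> (nths Ts B)) =
    free_cumulant \<tau> Ts +
    (\<Sum>\<pi> \<in> NC (length Ts) - {{{..<length Ts}}}. \<Prod>B\<in>\<pi>. free_cumulant \<tau> (nths Ts B))"
    by (subst sum.remove[OF finite_NC]) (auto simp: nths_all)
  then show ?thesis by (simp add: free_cumulant.simps[of \<tau> Ts])
qed

inductive_set generated_algebra :: "('h::complex_hilbert \<Rightarrow>\<^sub>L 'h) \<Rightarrow> ('h \<Rightarrow>\<^sub>L 'h) set"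
  for X :: "'h \<Rightarrow>\<^sub>L 'h" where
  unit: "id_blinfun \<in> generated_algebra X"
| gen: "X \<in> generated_algebra X"
| add: "S \<in> generated_algebra X \<Longrightarrow> T \<in> generated_algebra X \<Longrightarrow> S + T \<in> generated_algebra X"
| scale: "T \<in> generated_algebra X \<Longrightarrow> scaleC_op c T \<in> generated_algebra X"
| mult: "S \<in> generated_algebra X \<Longrightarrow> T \<in> generated_algebra X \<Longrightarrow> S o\<^sub>L T \<in> generated_algebra X"

text \<open>Freeness of a family of selfadjoint variables, i.e. of the unital (*-)algebras they
  generate: alternating products of centered elements are centered.\<close>

definition free_family ::
  "(('h::complex_hilbert \<Rightarrow>\<^sub>L 'h) \<Rightarrow> complex) \<Rightarrow> ('i \<Rightarrow> 'h \<Rightarrow>\<^sub>L 'h) \<Rightarrow> bool" where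
  "free_family \<tau> X \<longleftrightarrow>
    (\<forall>is Ts. Ts \<noteq> [] \<longrightarrow> length is = length Ts \<longrightarrow> distinct_adj is \<longrightarrow>
      (\<forall>k<length Ts. Ts ! k \<in> generated_algebra (X (is ! k)) \<and> \<tau> (Ts ! k) = 0) \<longrightarrow>
      \<tau> (op_prod Ts) = 0)"

definition identically_distributed ::
  "(('h::real_normed_vector \<Rightarrow>\<^sub>L 'h) \<Rightarrow> complex) \<Rightarrow> ('h \<Rightarrow>\<^sub>L 'h) \<Rightarrow> ('h \<Rightarrow>\<^sub>L 'h) \<Rightarrow> bool" where
  "identically_distributed \<tau> S T \<longleftrightarrow> (\<forall>m\<ge>1. moment \<tau> m S = moment \<tau> m T)"

definition variance ::
  "(('h::real_normed_vector \<Rightarrow>\<^sub>L 'h) \<Rightarrow> complex) \<Rightarrow> ('h \<Rightarrow>\<^sub>L 'h) \<Rightarrow> complex" where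
  "variance \<tau> T = \<tau> (T o\<^sub>L T) - (\<tau> T)\<^sup>2"

definition converges_in_distribution ::
  "(('h::real_normed_vector \<Rightarrow>\<^sub>L 'h) \<Rightarrow> complex) \<Rightarrow> (nat \<Rightarrow> 'h \<Rightarrow>\<^sub>L 'h) \<Rightarrow>
   (('k::real_normed_vector \<Rightarrow>\<^sub>L 'k) \<Rightarrow> complex) \<Rightarrow> ('k \<Rightarrow>\<^sub>L 'k) \<Rightarrow> bool" where
  "converges_in_distribution \<tau> Q \<sigma> Y \<longleftrightarrow>
    (\<forall>m\<ge>1. (\<lambda>n. moment \<tau> m (Q n)) \<longlonglongrightarrow> moment \<sigma> m Y)"

section \<open>Limit distributions and quadratic forms\<close>

definition mat_trace :: "complex mat \<Rightarrow> complex" where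
  "mat_trace A = (\<Sum>i<dim_row A. A $$ (i, i))"

definition limit_distribution :: "(nat \<Rightarrow> complex mat) \<Rightarrow> real measure \<Rightarrow> bool" where
  "limit_distribution B \<mu> \<longleftrightarrow>
    sets \<mu> = sets borel \<and> (\<forall>m\<ge>1. integrable \<mu> (\<lambda>t. t ^ m)) \<and>
    (\<forall>m\<ge>1. (\<lambda>n. mat_trace (B n ^\<^sub>m m)) \<longlonglongrightarrow> complex_of_real (\<integral>t. t ^ m \<partial>\<mu>))"

text \<open>Matrix indices, and with them the variables \<open>X 0, X 1, \<dots>\<close>, start at 0.\<close>

definition quadratic_form ::
  "complex mat \<Rightarrow> (nat \<Rightarrow> 'h::complex_hilbert \<Rightarrow>\<^sub>L 'h) \<Rightarrow> nat \<Rightarrow> ('h \<Rightarrow>\<^sub>L 'h)" where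
  "quadratic_form A X n =
    scaleC_op (1 / of_nat n) (\<Sum>i<n. \<Sum>j<n. scaleC_op (A $$ (i, j)) (X i o\<^sub>L X j))"

end

theory Submission
  imports Defs
begin

text \<open>Expand the moments of \<open>Q\<^sub>n\<close> over index words of length \<open>2 m\<close>. Freeness kills every word in which
  some index occurs exactly once, words with fewer than \<open>m\<close> distinct indices contribute
  \<open>O(1/n)\<close>, and a word in which each index occurs twice contributes 1 or 0 according to whether the
  induced pairing is noncrossing. The resulting weighted sums over noncrossing pairings satisfy, with
  the traces of the powers of \<open>A\<^sub>n / n\<close> as parameters, the recursion that the sums over noncrossing
  partitions satisfy with the cumulants as parameters; so the limit moments \<open>m\<^sub>k\<close> are the ones
  whose free cumulants are the moments of \<open>\<mu>\<close>.

  To realise the limit, note that \<open>m\<^sub>k\<close> is a positive sequence, as a limit of moments of selfadjoint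
  elements, and grows at most exponentially, since there are at most \<open>2 \<cdot> 4\<^sup>k\<close> noncrossing
  partitions. Orthogonal polynomials turn it into a bounded Jacobi operator \<open>Y\<close> on the sequence space,
  and the vector state at the first basis vector is a faithful normal trace on the abelian von
  Neumann algebra generated by \<open>Y\<close>.\<close>

section \<open>Weighted sums over noncrossing partitions\<close>

text \<open>Neither recursion closes on ordinary sums: splitting at the second element of the root
  block leaves a sum whose root block has lost an element. On the partition side a separate weight
  \<open>f\<close> for the block of the minimum absorbs this, shifted by one at each split. On the
  pairing side the counterpart is a matrix joining the two ends of a word; each split multiplies it
  by one more factor \<open>A n / n\<close>, and its trace converges to the weight of the grown
  block. Hence two families of sums are carried to the limit together. The realisation has to be
  faithful, not only to have the right moments. If the orthogonal polynomials stop after finitely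
  many steps, filling up the Jacobi matrix with zeros may create elements of the algebra that the
  vector state does not see. Repeating the finite block periodically avoids this: a shift then
  commutes with \<open>Y\<close> and, together with polynomials in \<open>Y\<close>, carries the
  first basis vector to all others.\<close>

definition NC_on :: "nat set \<Rightarrow> nat set set set" where
  "NC_on S = {\<pi>. partition_on S \<pi> \<and> noncrossing \<pi>}"

text \<open>The moment belonging to the cumulants \<open>c\<close> is the case \<open>f = c\<close>.
  For empty \<open>S\<close> the unspecified minimum is harmless, since the only partition has no
  blocks.\<close>

definition nc_sum :: "(nat \<Rightarrow> real) \<Rightarrow> (nat \<Rightarrow> real) \<Rightarrow> nat set \<Rightarrow> real" where
  "nc_sum f c S = (\<Sum>\<pi>\<in>NC_on S. \<Prod>B\<in>\<pi>. (if Min S \<in> B then f else c) (card B))"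

lemma noncrossingD:
  "noncrossing \<pi> \<Longrightarrow> B \<in> \<pi> \<Longrightarrow> C \<in> \<pi> \<Longrightarrow> a \<in> B \<Longrightarrow> b \<in> C \<Longrightarrow> c \<in> B \<Longrightarrow> d \<in> C \<Longrightarrow>
    a < b \<Longrightarrow> b < c \<Longrightarrow> c < d \<Longrightarrow> B = C"
  unfolding noncrossing_def by blast

lemma noncrossingI:
  "(\<And>B C a b c d. B \<in> \<pi> \<Longrightarrow> C \<in> \<pi> \<Longrightarrow> a \<in> B \<Longrightarrow> b \<in> C \<Longrightarrow> c \<in> B \<Longrightarrow> d \<in> C \<Longrightarrow>
    a < b \<Longrightarrow> b < c \<Longrightarrow> c < d \<Longrightarrow> B = C) \<Longrightarrow> noncrossing \<pi>"
  unfolding noncrossing_def by blast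

lemma finite_NC_on: "finite S \<Longrightarrow> finite (NC_on S)"
  unfolding NC_on_def by (rule finite_subset[OF _ finitely_many_partition_on[of S]]) auto

lemma NC_on_D:
  assumes "\<pi> \<in> NC_on S"
  shows "partition_on S \<pi>" "noncrossing \<pi>" "\<Union>\<pi> = S" "{} \<notin> \<pi>"
    "\<And>B C x. B \<in> \<pi> \<Longrightarrow> C \<in> \<pi> \<Longrightarrow> x \<in> B \<Longrightarrow> x \<in> C \<Longrightarrow> B = C"
    "\<And>B. B \<in> \<pi> \<Longrightarrow> B \<subseteq> S"
proof -
  show p: "partition_on S \<pi>" and "noncrossing \<pi>" using assms by (auto simp: NC_on_def)
  show "\<Union>\<pi> = S" "{} \<notin> \<pi>" using p by (auto simp: partition_on_def)
  show "B \<subseteq> S" if "B \<in> \<pi>" for B using that p by (auto simp: partition_on_def)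
  show "B = C" if "B \<in> \<pi>" "C \<in> \<pi>" "x \<in> B" "x \<in> C" for B C x
    using disjointD[OF partition_onD2[OF p] that(1,2)] that(3,4) by auto
qed

lemma NC_on_I:
  assumes "\<Union>\<pi> = S" "{} \<notin> \<pi>" "\<And>B C x. B \<in> \<pi> \<Longrightarrow> C \<in> \<pi> \<Longrightarrow> x \<in> B \<Longrightarrow> x \<in> C \<Longrightarrow> B = C"
    "noncrossing \<pi>"
  shows "\<pi> \<in> NC_on S"
proof -
  have "disjoint \<pi>" by (rule disjointI) (use assms(3) in auto)
  then show ?thesis using assms by (simp add: NC_on_def partition_on_def)
qed

lemma NC_on_block_finite:
  assumes "finite S" "\<pi> \<in> NC_on S"
  shows "finite \<pi> \<and> (\<forall>B\<in>\<pi>. finite B)"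
  using finite_elements[OF assms(1) NC_on_D(1)[OF assms(2)]] NC_on_D(6)[OF assms(2)]
    finite_subset[OF _ assms(1)] by simp

lemma NC_on_empty: "NC_on {} = {{}}"
  by (auto simp: NC_on_def partition_on_def noncrossing_def disjoint_def)

lemma nc_sum_empty [simp]: "nc_sum f c {} = 1"
  by (simp add: nc_sum_def NC_on_empty)

lemma NC_on_image:
  assumes h: "strict_mono_on S h" and \<pi>: "\<pi> \<in> NC_on S"
  shows "(`) h ` \<pi> \<in> NC_on (h ` S)"
proof (rule NC_on_I)
  note D = NC_on_D[OF \<pi>]
  have inj: "inj_on h S" using h by (rule strict_mono_on_imp_inj_on)
  have less: "x < y" if "h x < h y" "x \<in> S" "y \<in> S" for x y
    using h that by (metis strict_mono_on_less)
  show "\<Union> ((`) h ` \<pi>) = h ` S" using D(3) by blast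
  show "{} \<notin> (`) h ` \<pi>" using D(4) by auto
  show "B = C" if BC: "B \<in> (`) h ` \<pi>" "C \<in> (`) h ` \<pi>" "x \<in> B" "x \<in> C" for B C x
  proof -
    obtain B' C' y z where "B' \<in> \<pi>" "C' \<in> \<pi>" "B = h ` B'" "C = h ` C'"
      "y \<in> B'" "z \<in> C'" "x = h y" "x = h z"
      using BC by blast
    then show ?thesis using D(5,6) inj by (metis inj_on_def subsetD)
  qed
  show "noncrossing ((`) h ` \<pi>)"
  proof (rule noncrossingI)
    fix B C a b c d
    assume as: "B \<in> (`) h ` \<pi>" "C \<in> (`) h ` \<pi>" "a \<in> B" "b \<in> C" "c \<in> B" "d \<in> C"
      "a < b" "b < c" "c < d"
    obtain B' C' where BC: "B' \<in> \<pi>" "C' \<in> \<pi>" "B = h ` B'" "C = h ` C'" using as by blast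
    obtain a' where a': "a = h a'" "a' \<in> B'" using as(3) BC(3) by blast
    obtain b' where b': "b = h b'" "b' \<in> C'" using as(4) BC(4) by blast
    obtain c' where c': "c = h c'" "c' \<in> B'" using as(5) BC(3) by blast
    obtain d' where d': "d = h d'" "d' \<in> C'" using as(6) BC(4) by blast
    note * = a' b' c' d'
    have "a' \<in> S" "b' \<in> S" "c' \<in> S" "d' \<in> S" using * D(6)[OF BC(1)] D(6)[OF BC(2)] by auto
    then have "a' < b'" "b' < c'" "c' < d'" using less as(7,8,9) * by auto
    then have "B' = C'" using noncrossingD[OF D(2)] BC * by metis
    then show "B = C" using BC by simp
  qed
qed

text \<open>Crossings and the choice of the root block depend only on the order of the elements, so
  an order isomorphism transports the sum term by term.\<close>

lemma nc_sum_image: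
  assumes h: "strict_mono_on S h" and fin: "finite S"
  shows "nc_sum f c (h ` S) = nc_sum f c S"
proof (cases "S = {}")
  case False
  have inj: "inj_on h S" using h by (rule strict_mono_on_imp_inj_on)
  define k where "k = inv_into S h"
  have kh: "k (h x) = x" if "x \<in> S" for x unfolding k_def using inj that by simp
  have kS: "k ` h ` S = S" using kh by force
  have k: "strict_mono_on (h ` S) k"
    by (rule strict_mono_onI) (metis h imageE kh strict_mono_on_less)
  have Min: "Min (h ` S) = h (Min S)"
    using fin False
    by (intro Min_eqI) (auto intro!: strict_mono_on_leD[OF h] Min_in)
  have khB: "k ` h ` B = B" if "B \<subseteq> S" for B using kh that by force
  have hkB: "h ` k ` B = B" if "B \<subseteq> h ` S" for B using kh that by (force simp: image_image)
  have "nc_sum f c S = nc_sum f c (h ` S)"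
    unfolding nc_sum_def
  proof (rule sum.reindex_bij_witness[where i="\<lambda>\<pi>. (`) k ` \<pi>" and j="\<lambda>\<pi>. (`) h ` \<pi>"])
    fix \<pi> assume \<pi>: "\<pi> \<in> NC_on S"
    note D = NC_on_D[OF \<pi>]
    show "(`) k ` (`) h ` \<pi> = \<pi>" using khB D(6) by (force simp: image_image)
    show "(`) h ` \<pi> \<in> NC_on (h ` S)" by (rule NC_on_image[OF h \<pi>])
    have "inj_on ((`) h) \<pi>" using D(6) khB by (metis inj_onI)
    then show "(\<Prod>B\<in>(`) h ` \<pi>. (if Min (h ` S) \<in> B then f else c) (card B)) =
        (\<Prod>B\<in>\<pi>. (if Min S \<in> B then f else c) (card B))"
    proof (simp add: prod.reindex, intro prod.cong refl)
      fix B assume B: "B \<in> \<pi>"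
      have "card (h ` B) = card B" using inj D(6)[OF B] by (meson card_image inj_on_subset)
      moreover have "Min (h ` S) \<in> h ` B \<longleftrightarrow> Min S \<in> B"
        unfolding Min using inj D(6)[OF B] False fin by (simp add: inj_on_image_mem_iff)
      ultimately show "(if Min (h ` S) \<in> h ` B then f else c) (card (h ` B)) =
          (if Min S \<in> B then f else c) (card B)" by simp
    qed
  next
    fix \<pi> assume \<pi>: "\<pi> \<in> NC_on (h ` S)"
    show "(`) h ` (`) k ` \<pi> = \<pi>" using hkB NC_on_D(6)[OF \<pi>] by (force simp: image_image)
    show "(`) k ` \<pi> \<in> NC_on S" using NC_on_image[OF k \<pi>] kS by simp
  qed
  then show ?thesis by simp
qed simp

lemma nc_sum_card:
  assumes "finite S"
  shows "nc_sum f c S = nc_sum f c {..<card S}"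
proof -
  obtain h where h: "bij_betw h {..<card S} S" "strict_mono_on {..<card S} h"
    by (rule ex_bij_betw_strict_mono_card[OF assms])
  then have "S = h ` {..<card S}" by (auto simp: bij_betw_def)
  then show ?thesis using nc_sum_image[OF h(2), of f c] by simp
qed

text \<open>An isolated minimum can be removed or added freely. In what remains no block is
  distinguished any more, hence both weights become \<open>c\<close>.\<close>

lemma nc_sum_singleton_root:
  assumes fin: "finite S" and ne: "S \<noteq> {}"
  defines "m \<equiv> Min S"
  shows "(\<Sum>\<pi>\<in>{\<pi>\<in>NC_on S. {m} \<in> \<pi>}. \<Prod>B\<in>\<pi>. (if m \<in> B then f else c) (card B)) =
    f 1 * nc_sum c c (S - {m})"
proof -
  have mS: "m \<in> S" unfolding m_def using fin ne by simp
  have mle: "m \<le> x" if "x \<in> S" for x unfolding m_def using fin that by simp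
  have "(\<Sum>\<sigma>\<in>NC_on (S - {m}). f 1 * (\<Prod>B\<in>\<sigma>. c (card B))) =
    (\<Sum>\<pi>\<in>{\<pi>\<in>NC_on S. {m} \<in> \<pi>}. \<Prod>B\<in>\<pi>. (if m \<in> B then f else c) (card B))"
  proof (rule sum.reindex_bij_witness[where i="\<lambda>\<pi>. \<pi> - {{m}}" and j="insert {m}"])
    fix \<sigma> assume \<sigma>: "\<sigma> \<in> NC_on (S - {m})"
    note D = NC_on_D[OF \<sigma>]
    have mB: "m \<notin> B" if "B \<in> \<sigma>" for B using D(6) that by blast
    then have notin: "{m} \<notin> \<sigma>" by blast
    show "insert {m} \<sigma> - {{m}} = \<sigma>" using notin by simp
    have "insert {m} \<sigma> \<in> NC_on S"
    proof (rule NC_on_I)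
      show "\<Union> (insert {m} \<sigma>) = S" using D(3) mS by auto
      show "{} \<notin> insert {m} \<sigma>" using D(4) by auto
      show "B = C" if "B \<in> insert {m} \<sigma>" "C \<in> insert {m} \<sigma>" "x \<in> B" "x \<in> C" for B C x
        using that D(5) mB by blast
      show "noncrossing (insert {m} \<sigma>)"
      proof (rule noncrossingI)
        fix B C a b c d
        assume as: "B \<in> insert {m} \<sigma>" "C \<in> insert {m} \<sigma>" "a \<in> B" "b \<in> C" "c \<in> B" "d \<in> C"
          "a < b" "b < c" "c < d"
        \<comment> \<open>A crossing takes two distinct points from each of its blocks, so neither
          block is the singleton.\<close>
        then have "B \<in> \<sigma>" "C \<in> \<sigma>" by auto
        then show "B = C" using noncrossingD[OF D(2)] as by metis
      qed
    qed
    then show "insert {m} \<sigma> \<in> {\<pi> \<in> NC_on S. {m} \<in> \<pi>}" by simp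
    have "finite \<sigma>" using NC_on_block_finite[OF _ \<sigma>] fin by simp
    then show "(\<Prod>B\<in>insert {m} \<sigma>. (if m \<in> B then f else c) (card B)) =
        f 1 * (\<Prod>B\<in>\<sigma>. c (card B))"
      using notin mB by (simp cong: prod.cong)
  next
    fix \<pi> assume "\<pi> \<in> {\<pi> \<in> NC_on S. {m} \<in> \<pi>}"
    then have \<pi>: "\<pi> \<in> NC_on S" "{m} \<in> \<pi>" by auto
    note D = NC_on_D[OF \<pi>(1)]
    show "insert {m} (\<pi> - {{m}}) = \<pi>" using \<pi> by blast
    have mB: "m \<notin> B" if "B \<in> \<pi> - {{m}}" for B using D(5)[OF _ \<pi>(2)] that by blast
    show "\<pi> - {{m}} \<in> NC_on (S - {m})"
    proof (rule NC_on_I)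
      have "\<Union> (insert {m} (\<pi> - {{m}})) = S" using D(3) \<pi>(2) by blast
      then show "\<Union> (\<pi> - {{m}}) = S - {m}" using mB by blast
      show "noncrossing (\<pi> - {{m}})" using D(2) unfolding noncrossing_def by blast
    qed (use D in blast)+
  qed
  moreover have "nc_sum c c (S - {m}) = (\<Sum>\<sigma>\<in>NC_on (S - {m}). \<Prod>B\<in>\<sigma>. c (card B))"
    by (simp add: nc_sum_def)
  ultimately show ?thesis by (simp add: sum_distrib_left)
qed

definition NC_second :: "nat set \<Rightarrow> nat \<Rightarrow> nat set set set" where
  "NC_second S p = {\<pi>\<in>NC_on S. \<exists>B\<in>\<pi>. Min S \<in> B \<and> p \<in> B \<and> (\<forall>x\<in>B. x = Min S \<or> p \<le> x)}"

text \<open>If the root block continues from \<open>m\<close> directly to \<open>p\<close>, a block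
  with one point strictly between them and another point elsewhere would cross it. So the gap and
  the points from \<open>p\<close> on are partitioned independently. After deletion of
  \<open>m\<close> the root block contains \<open>p\<close>, the minimum of \<open>S2\<close>, and
  is again the root block there; \<open>f (Suc j)\<close> restores its original size.\<close>

lemma nc_sum_second:
  assumes fin: "finite S" and p: "p \<in> S" "p \<noteq> Min S"
  defines "m \<equiv> Min S"
  defines "S1 \<equiv> {x\<in>S. m < x \<and> x < p}" and "S2 \<equiv> {x\<in>S. p \<le> x}"
  shows "(\<Sum>\<pi>\<in>NC_second S p. \<Prod>B\<in>\<pi>. (if m \<in> B then f else c) (card B)) =
    nc_sum c c S1 * nc_sum (\<lambda>j. f (Suc j)) c S2"
proof -
  have mS: "m \<in> S" unfolding m_def using fin p(1) by (intro Min_in) auto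
  have mle: "m \<le> x" if "x \<in> S" for x unfolding m_def using fin that by simp
  have mp: "m < p" using mle[OF p(1)] p(2) m_def by simp
  have S: "S = insert m (S1 \<union> S2)" "m \<notin> S1" "m \<notin> S2" "S1 \<inter> S2 = {}" "p \<in> S2"
    using mS mle mp p unfolding S1_def S2_def by (auto simp: le_less)
  have fin12: "finite S1" "finite S2" using fin unfolding S1_def S2_def by auto
  have MinS2: "Min S2 = p" using fin12 p by (intro Min_eqI) (auto simp: S2_def)
  \<comment> \<open>\<open>g\<close> puts \<open>m\<close> back into the block of \<open>p\<close>.
    In the other direction \<open>i\<close> sorts the blocks by whether they lie in the gap and
    deletes \<open>m\<close>.\<close>
  define g where "g B = (if p \<in> B then insert m B else B)" for B
  define i where "i \<pi> = ({B\<in>\<pi>. B \<subseteq> S1}, (\<lambda>B. B - {m}) ` {B\<in>\<pi>. \<not> B \<subseteq> S1})" for \<pi>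
  have g_m: "g B - {m} = B" if "m \<notin> B" for B using that unfolding g_def by auto
  have "(\<Sum>(\<rho>,\<sigma>)\<in>NC_on S1 \<times> NC_on S2. (\<Prod>B\<in>\<rho>. c (card B)) *
      (\<Prod>B\<in>\<sigma>. (if Min S2 \<in> B then \<lambda>j. f (Suc j) else c) (card B))) =
    (\<Sum>\<pi>\<in>NC_second S p. \<Prod>B\<in>\<pi>. (if m \<in> B then f else c) (card B))"
  proof (rule sum.reindex_bij_witness[where i=i and j="\<lambda>z. fst z \<union> g ` snd z"])
    fix z assume z: "z \<in> NC_on S1 \<times> NC_on S2"
    define \<rho> \<sigma> where "\<rho> = fst z" and "\<sigma> = snd z"
    have \<rho>: "\<rho> \<in> NC_on S1" and \<sigma>: "\<sigma> \<in> NC_on S2" and z_eq: "z = (\<rho>, \<sigma>)"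
      using z unfolding \<rho>_def \<sigma>_def by auto
    note R = NC_on_D[OF \<rho>] and T = NC_on_D[OF \<sigma>]
    have mR: "m \<notin> B" if "B \<in> \<rho>" for B using R(6) that S by blast
    have mT: "m \<notin> B" if "B \<in> \<sigma>" for B using T(6) that S by blast
    have gsub: "B \<subseteq> g B" "g B \<subseteq> insert m S2" if "B \<in> \<sigma>" for B
      using T(6) that unfolding g_def by auto
    have gnS1: "\<not> g B \<subseteq> S1" if "B \<in> \<sigma>" for B
      using gsub[OF that] T(4,6) that S(4) by (metis disjoint_iff equals0I subsetD)
    have "{B \<in> \<rho> \<union> g ` \<sigma>. B \<subseteq> S1} = \<rho>" using R(6) gnS1 by auto
    moreover have "{B \<in> \<rho> \<union> g ` \<sigma>. \<not> B \<subseteq> S1} = g ` \<sigma>" using R(6) gnS1 by auto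
    moreover have "(\<lambda>B. B - {m}) ` g ` \<sigma> = \<sigma>" using g_m mT by (force simp: image_image)
    ultimately show "i (fst z \<union> g ` snd z) = z" unfolding i_def z_eq by simp
    have gp: "B = C" if "B \<in> \<sigma>" "C \<in> \<sigma>" "x \<in> g B" "x \<in> g C" for B C x
      using that T(5) mT unfolding g_def by (auto split: if_splits)
    have disj: "x \<notin> g C" if "B \<in> \<rho>" "C \<in> \<sigma>" "x \<in> B" for B C x
      using gsub[OF that(2)] R(6)[OF that(1)] that(3) S by blast
    have "\<rho> \<union> g ` \<sigma> \<in> NC_on S"
    proof (rule NC_on_I)
      have "\<Union> (g ` \<sigma>) \<subseteq> insert m S2" using gsub by blast
      moreover have "S2 \<subseteq> \<Union> (g ` \<sigma>)"
      proof
        fix x assume "x \<in> S2"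
        then obtain B where "B \<in> \<sigma>" "x \<in> B" using T(3) by blast
        then show "x \<in> \<Union> (g ` \<sigma>)" using gsub(1)[of B] by blast
      qed
      moreover have "m \<in> \<Union> (g ` \<sigma>)"
      proof -
        obtain B where "B \<in> \<sigma>" "p \<in> B" using T(3) S(5) by blast
        moreover from this have "m \<in> g B" by (simp add: g_def)
        ultimately show ?thesis by (intro UnionI[of "g B"]) auto
      qed
      ultimately have "\<Union> (g ` \<sigma>) = insert m S2" by (intro equalityI) auto
      then show "\<Union> (\<rho> \<union> g ` \<sigma>) = S" using R(3) S(1) by auto
      have "g B \<noteq> {}" if "B \<in> \<sigma>" for B using gsub(1)[OF that] T(4) that by auto
      then show "{} \<notin> \<rho> \<union> g ` \<sigma>" using R(4) by auto
      show "B = C" if BC: "B \<in> \<rho> \<union> g ` \<sigma>" "C \<in> \<rho> \<union> g ` \<sigma>" "x \<in> B" "x \<in> C" for B C x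
      proof -
        consider "B \<in> \<rho>" "C \<in> \<rho>" | C' where "B \<in> \<rho>" "C' \<in> \<sigma>" "C = g C'"
          | B' where "B' \<in> \<sigma>" "B = g B'" "C \<in> \<rho>"
          | B' C' where "B' \<in> \<sigma>" "B = g B'" "C' \<in> \<sigma>" "C = g C'"
          using BC(1,2) by (elim UnE imageE) blast+
        then show ?thesis
        proof cases
          case 1 then show ?thesis using R(5) BC(3,4) by blast
        next
          case 2 then show ?thesis using disj[of B C' x] BC(3,4) by simp
        next
          case 3 then show ?thesis using disj[of C B' x] BC(3,4) by simp
        next
          case 4 then show ?thesis using gp[of B' C' x] BC(3,4) by simp
        qed
      qed
      show "noncrossing (\<rho> \<union> g ` \<sigma>)"
      proof (rule noncrossingI)
        fix B C x y z w
        assume as: "B \<in> \<rho> \<union> g ` \<sigma>" "C \<in> \<rho> \<union> g ` \<sigma>" "x \<in> B" "y \<in> C" "z \<in> B" "w \<in> C"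
          "x < y" "y < z" "z < w"
        have S1D: "m < v \<and> v < p" if "D \<in> \<rho>" "v \<in> D" for D v
          using R(6)[OF that(1)] that(2) unfolding S1_def by auto
        have S2D: "v = m \<or> p \<le> v" if "D \<in> \<sigma>" "v \<in> g D" for D v
          using gsub(2)[OF that(1)] that(2) unfolding S2_def by auto
        consider "B \<in> \<rho>" "C \<in> \<rho>" | C' where "B \<in> \<rho>" "C' \<in> \<sigma>" "C = g C'"
          | B' where "B' \<in> \<sigma>" "B = g B'" "C \<in> \<rho>"
          | B' C' where "B' \<in> \<sigma>" "B = g B'" "C' \<in> \<sigma>" "C = g C'"
          using as(1,2) by (elim UnE imageE) blast+
        then show "B = C"
        proof cases
          case 1 then show ?thesis using noncrossingD[OF R(2) 1 as(3-9)] by simp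
        next
          case 2
          then show ?thesis using S1D[of B x] S1D[of B z] S2D[of C' y] as(3-9) by fastforce
        next
          case 3
          then show ?thesis using S1D[of C y] S1D[of C w] S2D[of B' z] as(3-9) by fastforce
        next
          case 4
          have ge: "v \<in> S2" if "v \<in> g D" "D \<in> \<sigma>" "x < v" for v D
          proof -
            have "x \<in> S" using 4(2) as(3) gsub(2)[OF 4(1)] S(1) by blast
            then have "v \<noteq> m" using that mle[of x] by auto
            then show ?thesis using that(1) gsub(2)[OF that(2)] by blast
          qed
          have yzw: "y \<in> S2" "z \<in> S2" "w \<in> S2" using ge 4 as by auto
          have gD: "v \<in> D" if "v \<in> g D" "v \<in> S2" for v D
            using that S unfolding g_def by (auto split: if_splits)
          show ?thesis
          proof (cases "x = m")
            case False
            then have "x \<in> B'" using 4 as unfolding g_def by (auto split: if_splits)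
            then have "B' = C'"
              using noncrossingD[OF T(2) 4(1) 4(3), of x y z w] gD yzw as 4 by auto
            then show ?thesis using 4 by simp
          next
            case True
            \<comment> \<open>A crossing that starts at \<open>m\<close> can be restarted at
              \<open>p\<close> in the same block: either \<open>y = p\<close> and the two blocks
              share a point, or \<open>p < y < z < w\<close> already cross in
              \<open>\<sigma>\<close>.\<close>
            then have pB: "p \<in> B'" using 4 as mT unfolding g_def by (auto split: if_splits)
            have "p \<le> y" using yzw unfolding S2_def by auto
            show ?thesis
            proof (cases "y = p")
              case True
              then have "B' = C'" using T(5)[OF 4(1) 4(3) pB] gD yzw as 4 by auto
              then show ?thesis using 4 by simp
            next
              case False
              then have "p < y" using \<open>p \<le> y\<close> by simp
              then have "B' = C'"
                using noncrossingD[OF T(2) 4(1) 4(3) pB, of y z w] gD yzw as 4 by auto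
              then show ?thesis using 4 by simp
            qed
          qed
        qed
      qed
    qed
    moreover have "\<exists>B\<in>\<rho> \<union> g ` \<sigma>. Min S \<in> B \<and> p \<in> B \<and> (\<forall>x\<in>B. x = Min S \<or> p \<le> x)"
    proof -
      obtain B where B: "B \<in> \<sigma>" "p \<in> B" using T(3) S(5) by blast
      have "\<forall>x\<in>g B. x = m \<or> p \<le> x" using gsub(2)[OF B(1)] unfolding S2_def by auto
      moreover have "m \<in> g B" "p \<in> g B" using B unfolding g_def by auto
      ultimately show ?thesis using B unfolding m_def by blast
    qed
    ultimately show "fst z \<union> g ` snd z \<in> NC_second S p" unfolding NC_second_def z_eq by simp
    have inj: "inj_on g \<sigma>" using g_m mT by (metis inj_onI)
    have fins: "finite \<rho>" "finite \<sigma>" "\<And>B. B \<in> \<sigma> \<Longrightarrow> finite B"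
      using NC_on_block_finite fin12 \<rho> \<sigma> by blast+
    have dj: "\<rho> \<inter> g ` \<sigma> = {}" using R(6) gnS1 by blast
    have wg: "(if m \<in> g B then f else c) (card (g B)) =
        (if Min S2 \<in> B then \<lambda>j. f (Suc j) else c) (card B)" if "B \<in> \<sigma>" for B
      using mT[OF that] fins(3)[OF that] unfolding MinS2 g_def by auto
    show "(\<Prod>B\<in>fst z \<union> g ` snd z. (if m \<in> B then f else c) (card B)) =
        (case z of (\<rho>, \<sigma>) \<Rightarrow> (\<Prod>B\<in>\<rho>. c (card B)) *
          (\<Prod>B\<in>\<sigma>. (if Min S2 \<in> B then \<lambda>j. f (Suc j) else c) (card B)))"
      unfolding z_eq using fins dj inj mR wg by (simp add: prod.union_disjoint prod.reindex cong: prod.cong)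
  next
    fix \<pi> assume "\<pi> \<in> NC_second S p"
    then obtain B0 where \<pi>: "\<pi> \<in> NC_on S" and B0: "B0 \<in> \<pi>" "m \<in> B0" "p \<in> B0"
      "\<And>x. x \<in> B0 \<Longrightarrow> x = m \<or> p \<le> x"
      unfolding NC_second_def m_def by blast
    note D = NC_on_D[OF \<pi>]
    have B0m: "C = B0" if "C \<in> \<pi>" "m \<in> C \<or> p \<in> C" for C using D(5) B0 that by blast
    have dich: "C \<inter> S1 = {}" if C: "C \<in> \<pi>" "\<not> C \<subseteq> S1" for C
    proof (rule ccontr)
      assume "C \<inter> S1 \<noteq> {}"
      then obtain x y where xy: "x \<in> C" "x \<in> S1" "y \<in> C" "y \<notin> S1" using C by blast
      show False
      proof (cases "C = B0")
        case True then show ?thesis using xy B0(4)[of x] unfolding S1_def by auto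
      next
        case False
        then have "y \<noteq> m" "y \<noteq> p" using B0m C xy by blast+
        moreover have "y \<in> S" using D(6) C xy by blast
        ultimately have "p < y" using xy mle[of y] unfolding S1_def by auto
        moreover have "m < x" "x < p" using xy unfolding S1_def by auto
        ultimately have "B0 = C" using noncrossingD[OF D(2) B0(1) C(1) B0(2) xy(1) B0(3) xy(3)] by simp
        then show False using False by simp
      qed
    qed
    have gm: "g (C - {m}) = C" if C: "C \<in> \<pi>" for C
      using B0m[OF C] B0 mp unfolding g_def by auto
    have "g ` (\<lambda>B. B - {m}) ` {B\<in>\<pi>. \<not> B \<subseteq> S1} = {B\<in>\<pi>. \<not> B \<subseteq> S1}"
      using gm by (force simp: image_image)
    then show "fst (i \<pi>) \<union> g ` snd (i \<pi>) = \<pi>" unfolding i_def by auto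
    define \<rho> \<sigma> where \<rho>: "\<rho> = {B\<in>\<pi>. B \<subseteq> S1}"
      and \<sigma>: "\<sigma> = (\<lambda>B. B - {m}) ` {B\<in>\<pi>. \<not> B \<subseteq> S1}"
    have "\<rho> \<in> NC_on S1"
    proof (rule NC_on_I)
      show "\<Union> \<rho> = S1"
      proof
        show "S1 \<subseteq> \<Union> \<rho>"
        proof
          fix x assume x: "x \<in> S1"
          then obtain C where C: "C \<in> \<pi>" "x \<in> C" using D(3) S(1) by blast
          then have "C \<subseteq> S1" using dich x by blast
          then show "x \<in> \<Union> \<rho>" using C \<rho> by blast
        qed
        show "\<Union> \<rho> \<subseteq> S1" unfolding \<rho> by auto
      qed
      show "noncrossing \<rho>" using D(2) unfolding \<rho> noncrossing_def by simp
      show "{} \<notin> \<rho>" using D(4) \<rho> by simp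
      show "B = C" if "B \<in> \<rho>" "C \<in> \<rho>" "x \<in> B" "x \<in> C" for B C x
        using D(5)[of B C x] that unfolding \<rho> by simp
    qed
    moreover have "\<sigma> \<in> NC_on S2"
    proof (rule NC_on_I)
      show "\<Union> \<sigma> = S2"
      proof
        show "S2 \<subseteq> \<Union> \<sigma>"
        proof
          fix x assume x: "x \<in> S2"
          then obtain C where C: "C \<in> \<pi>" "x \<in> C" using D(3) S(1) by blast
          then have "\<not> C \<subseteq> S1" "x \<noteq> m" using x S by blast+
          then show "x \<in> \<Union> \<sigma>" using C \<sigma> by blast
        qed
        show "\<Union> \<sigma> \<subseteq> S2"
        proof
          fix x assume "x \<in> \<Union> \<sigma>"
          then obtain C where C: "C \<in> \<pi>" "\<not> C \<subseteq> S1" "x \<in> C" "x \<noteq> m" unfolding \<sigma> by auto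
          then have "x \<in> S" "x \<notin> S1" using dich[OF C(1,2)] D(6)[OF C(1)] by auto
          then show "x \<in> S2" using S(1) C(4) by auto
        qed
      qed
      show "{} \<notin> \<sigma>"
      proof
        assume "{} \<in> \<sigma>"
        then obtain C where "C \<in> \<pi>" "C \<subseteq> {m}" "\<not> C \<subseteq> S1" unfolding \<sigma> by auto
        then have "C = {m}" using D(4) subset_singletonD[of C m] by auto
        then show False using B0m[of C] \<open>C \<in> \<pi>\<close> B0(3) mp by auto
      qed
      show "B = C" if *: "B \<in> \<sigma>" "C \<in> \<sigma>" "x \<in> B" "x \<in> C" for B C x
      proof -
        obtain B' C' where BC: "B' \<in> \<pi>" "C' \<in> \<pi>" "B = B' - {m}" "C = C' - {m}"
          using *(1,2) unfolding \<sigma> by auto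
        then show ?thesis using D(5)[OF BC(1,2), of x] *(3,4) by simp
      qed
      show "noncrossing \<sigma>"
      proof (rule noncrossingI)
        fix B C a b c d
        assume as: "B \<in> \<sigma>" "C \<in> \<sigma>" "a \<in> B" "b \<in> C" "c \<in> B" "d \<in> C" "a < b" "b < c" "c < d"
        obtain B' C' where BC: "B' \<in> \<pi>" "C' \<in> \<pi>" "B = B' - {m}" "C = C' - {m}"
          using as(1,2) unfolding \<sigma> by auto
        then have "B' = C'" using noncrossingD[OF D(2) BC(1) BC(2), of a b c d] as by auto
        then show "B = C" using BC by simp
      qed
    qed
    ultimately show "i \<pi> \<in> NC_on S1 \<times> NC_on S2" unfolding i_def \<rho> \<sigma> by simp
  qed
  moreover have "nc_sum c c S1 * nc_sum (\<lambda>j. f (Suc j)) c S2 =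
    (\<Sum>(\<rho>,\<sigma>)\<in>NC_on S1 \<times> NC_on S2. (\<Prod>B\<in>\<rho>. c (card B)) *
      (\<Prod>B\<in>\<sigma>. (if Min S2 \<in> B then \<lambda>j. f (Suc j) else c) (card B)))"
    by (simp add: nc_sum_def sum_product sum.cartesian_product)
  ultimately show ?thesis by simp
qed

text \<open>The block of 0 is a singleton or has a second smallest element \<open>Suc t\<close>; in
  the latter case \<open>t\<close> elements are skipped and \<open>k - t\<close> remain from
  \<open>Suc t\<close> on.\<close>

lemma nc_sum_recursion:
  "nc_sum f c {..<Suc k} = f 1 * nc_sum c c {..<k} +
    (\<Sum>t<k. nc_sum c c {..<t} * nc_sum (\<lambda>j. f (Suc j)) c {..<k - t})"
proof -
  let ?S = "{..<Suc k}"
  let ?w = "\<lambda>\<pi>. \<Prod>B\<in>\<pi>. (if 0 \<in> B then f else c) (card B)"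
  have Min: "Min ?S = 0" by (intro Min_eqI) auto
  have split: "NC_on ?S = {\<pi>\<in>NC_on ?S. {0} \<in> \<pi>} \<union> (\<Union>t\<in>{..<k}. NC_second ?S (Suc t))"
  proof -
    have "{0} \<in> \<pi> \<or> (\<exists>t<k. \<pi> \<in> NC_second ?S (Suc t))" if \<pi>: "\<pi> \<in> NC_on ?S" for \<pi>
    proof -
      note D = NC_on_D[OF \<pi>]
      obtain B where B: "B \<in> \<pi>" "0 \<in> B" using D(3) by blast
      have fB: "finite B" using D(6)[OF B(1)] finite_subset by blast
      show ?thesis
      proof (cases "B = {0}")
        case False
        define p where "p = Min (B - {0})"
        have p: "p \<in> B - {0}" unfolding p_def using fB B False by (intro Min_in) auto
        have "x = 0 \<or> p \<le> x" if "x \<in> B" for x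
          using that fB Min_le[of "B - {0}" x] unfolding p_def by blast
        moreover have "p < Suc k" using p D(6)[OF B(1)] by auto
        ultimately have "\<pi> \<in> NC_second ?S (Suc (p - 1)) \<and> p - 1 < k"
          unfolding NC_second_def Min using p B \<pi> by (auto intro!: bexI[of _ B])
        then show ?thesis by blast
      qed (use B in simp)
    qed
    then show ?thesis by (auto simp: NC_second_def)
  qed
  have d1: "{\<pi>\<in>NC_on ?S. {0} \<in> \<pi>} \<inter> (\<Union>t\<in>{..<k}. NC_second ?S (Suc t)) = {}"
  proof (rule ccontr)
    assume "\<not> ?thesis"
    then obtain \<pi> t where \<pi>: "\<pi> \<in> NC_on ?S" "{0} \<in> \<pi>" "\<pi> \<in> NC_second ?S (Suc t)" by auto
    then obtain B where B: "B \<in> \<pi>" "0 \<in> B" "Suc t \<in> B" unfolding NC_second_def Min by auto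
    show False using NC_on_D(5)[OF \<pi>(1,2) B(1), of 0] B by auto
  qed
  have d2: "NC_second ?S (Suc s) \<inter> NC_second ?S (Suc t) = {}" if st: "s \<noteq> t" for s t
  proof (rule ccontr)
    assume "\<not> ?thesis"
    then obtain \<pi> where \<pi>: "\<pi> \<in> NC_second ?S (Suc s)" "\<pi> \<in> NC_second ?S (Suc t)" by auto
    then have \<pi>S: "\<pi> \<in> NC_on ?S" by (simp add: NC_second_def)
    obtain B where B: "B \<in> \<pi>" "0 \<in> B" "Suc s \<in> B" "\<forall>x\<in>B. x = 0 \<or> Suc s \<le> x"
      using \<pi>(1) unfolding NC_second_def Min by auto
    obtain C where C: "C \<in> \<pi>" "0 \<in> C" "Suc t \<in> C" "\<forall>x\<in>C. x = 0 \<or> Suc t \<le> x"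
      using \<pi>(2) unfolding NC_second_def Min by auto
    have "B = C" using NC_on_D(5)[OF \<pi>S B(1) C(1) B(2) C(2)] .
    then show False using B C st by force
  qed
  have fin: "finite (NC_on ?S)" by (simp add: finite_NC_on)
  have fin2: "finite (NC_second ?S p)" for p using fin unfolding NC_second_def by simp
  have "nc_sum f c ?S = sum ?w (NC_on ?S)" unfolding nc_sum_def Min ..
  also have "\<dots> = sum ?w {\<pi>\<in>NC_on ?S. {0} \<in> \<pi>} + sum ?w (\<Union>t\<in>{..<k}. NC_second ?S (Suc t))"
    by (subst (1) split, rule sum.union_disjoint) (use fin fin2 d1 in simp_all)
  also have "sum ?w {\<pi>\<in>NC_on ?S. {0} \<in> \<pi>} = f 1 * nc_sum c c (?S - {0})"
    by (rule nc_sum_singleton_root[of ?S f c, unfolded Min]) (simp, blast)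
  also have "nc_sum c c (?S - {0}) = nc_sum c c {..<k}"
    using nc_sum_card[of "?S - {0}" c c] by (simp add: card_Diff_singleton)
  also have "sum ?w (\<Union>t\<in>{..<k}. NC_second ?S (Suc t)) = (\<Sum>t<k. sum ?w (NC_second ?S (Suc t)))"
    by (rule sum.UNION_disjoint) (use fin2 d2 in simp_all)
  also have "\<dots> = (\<Sum>t<k. nc_sum c c {..<t} * nc_sum (\<lambda>j. f (Suc j)) c {..<k - t})"
  proof (rule sum.cong[OF refl])
    fix t assume t: "t \<in> {..<k}"
    have "sum ?w (NC_second ?S (Suc t)) = nc_sum c c {x\<in>?S. 0 < x \<and> x < Suc t} *
        nc_sum (\<lambda>j. f (Suc j)) c {x\<in>?S. Suc t \<le> x}"
      using nc_sum_second[of ?S "Suc t" f c] t unfolding Min by simp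
    also have "{x\<in>?S. 0 < x \<and> x < Suc t} = {1..t}" using t by auto
    also have "{x\<in>?S. Suc t \<le> x} = {Suc t..k}" using t by auto
    finally show "sum ?w (NC_second ?S (Suc t)) =
        nc_sum c c {..<t} * nc_sum (\<lambda>j. f (Suc j)) c {..<k - t}"
      using nc_sum_card[of "{1..t}" c c] nc_sum_card[of "{Suc t..k}" "\<lambda>j. f (Suc j)" c] by simp
  qed
  finally show ?thesis .
qed

section \<open>Exponential bounds and inversion of the moment-cumulant formula\<close>

lemma NC_eq_NC_on: "NC n = NC_on {..<n}"
  by (simp add: NC_def NC_on_def)

lemma sum_card_NC_on:
  assumes "finite S" "\<pi> \<in> NC_on S"
  shows "(\<Sum>B\<in>\<pi>. card B) = card S"
proof -
  have "card (\<Union>\<pi>) = (\<Sum>B\<in>\<pi>. card B)"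
  proof (rule card_Union_disjoint)
    show "pairwise disjnt \<pi>"
      using partition_onD2[OF NC_on_D(1)[OF assms(2)]] by (simp add: disjoint_def pairwise_def disjnt_def)
    show "\<And>B. B \<in> \<pi> \<Longrightarrow> finite B" using NC_on_block_finite[OF assms] by simp
  qed
  then show ?thesis using NC_on_D(3)[OF assms(2)] by simp
qed

text \<open>With both weights 1 the recursion is that of the Catalan numbers. After division by
  \<open>4 ^ k\<close> the partial sums satisfy
  \<open>U (N + 1) \<le> 1 + (U N)\<^sup>2 / 4\<close>, and 2 is the fixed point of this map; both
  constants come from here.\<close>

lemma card_NC_le: "real (card (NC k)) \<le> 2 * 4 ^ k"
proof -
  define u where "u k = nc_sum (\<lambda>_. 1) (\<lambda>_. 1) {..<k}" for k
  have u_card: "u k = real (card (NC k))" for k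
    by (simp add: u_def nc_sum_def NC_eq_NC_on)
  have u0: "u 0 = 1" by (simp add: u_def)
  have u_Suc: "u (Suc k) = (\<Sum>t\<le>k. u t * u (k - t))" for k
  proof -
    have "u (Suc k) = u k + (\<Sum>t<k. u t * u (k - t))"
      unfolding u_def by (subst nc_sum_recursion) simp
    also have "\<dots> = (\<Sum>t\<le>k. u t * u (k - t))"
      by (simp add: lessThan_Suc_atMost[symmetric] u0)
    finally show ?thesis .
  qed
  define v where "v k = u k / 4 ^ k" for k
  have v_pos: "v k \<ge> 0" for k by (simp add: v_def u_card)
  have U: "(\<Sum>m\<le>N. v m) \<le> 2" for N
  proof (induction N)
    case 0 show ?case by (simp add: v_def u0)
  next
    case (Suc N)
    have v_Suc: "v (Suc k) = (\<Sum>t\<le>k. v t * v (k - t)) / 4" for k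
    proof -
      have "(\<Sum>t\<le>k. u t * u (k - t)) = (\<Sum>t\<le>k. v t * v (k - t) * 4 ^ k)"
        by (intro sum.cong refl) (simp add: v_def power_add[symmetric])
      then show ?thesis
        unfolding v_def[of "Suc k"] u_Suc by (simp add: sum_distrib_right[symmetric])
    qed
    have "(\<Sum>m\<le>Suc N. v m) = 1 + (\<Sum>k\<le>N. \<Sum>t\<le>k. v t * v (k - t)) / 4"
      by (subst sum.atMost_Suc_shift) (simp add: v_Suc v_def[of 0] u0 sum_divide_distrib)
    also have "(\<Sum>k\<le>N. \<Sum>t\<le>k. v t * v (k - t)) = (\<Sum>(i, j)\<in>{(i, j). i + j \<le> N}. v i * v j)"
      by (rule sum.triangle_reindex_eq[symmetric])
    \<comment> \<open>Enlarging the triangle to the square turns the convolution into a product of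
      partial sums.\<close>
    also have "\<dots> \<le> (\<Sum>(i, j)\<in>{..N} \<times> {..N}. v i * v j)"
      by (rule sum_mono2) (auto simp: v_pos)
    also have "\<dots> = (\<Sum>m\<le>N. v m) * (\<Sum>m\<le>N. v m)"
      by (simp add: sum_product sum.cartesian_product)
    also have "\<dots> \<le> 2 * 2"
      using Suc.IH by (intro mult_mono sum_nonneg) (auto simp: v_pos)
    finally show ?case by simp
  qed
  have "v k \<le> (\<Sum>m\<le>k. v m)" by (rule member_le_sum) (auto simp: v_pos)
  then have "v k \<le> 2" using U[of k] by simp
  then show ?thesis by (simp add: v_def u_card field_simps)
qed

text \<open>The block sizes add up to \<open>k\<close>, so every partition contributes at most
  \<open>R ^ k\<close>, whatever its shape.\<close>

lemma nc_sum_bound: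
  assumes c: "\<And>r. r \<ge> 1 \<Longrightarrow> \<bar>c r\<bar> \<le> R ^ r" and R: "R \<ge> 0"
  shows "\<bar>nc_sum c c {..<k}\<bar> \<le> 2 * (4 * R) ^ k"
proof -
  have "\<bar>\<Prod>B\<in>\<pi>. c (card B)\<bar> \<le> R ^ k" if \<pi>: "\<pi> \<in> NC_on {..<k}" for \<pi>
  proof -
    have "\<bar>c (card B)\<bar> \<le> R ^ card B" if B: "B \<in> \<pi>" for B
    proof (rule c)
      have "finite B" using NC_on_block_finite[OF _ \<pi>] B by simp
      moreover have "B \<noteq> {}" using NC_on_D(4)[OF \<pi>] B by auto
      ultimately show "card B \<ge> 1" by (simp add: Suc_le_eq card_gt_0_iff)
    qed
    then have "(\<Prod>B\<in>\<pi>. \<bar>c (card B)\<bar>) \<le> (\<Prod>B\<in>\<pi>. R ^ card B)"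
      by (intro prod_mono) simp
    also have "\<dots> = R ^ k" using sum_card_NC_on[OF _ \<pi>] by (simp add: power_sum[symmetric])
    finally show ?thesis by (simp add: abs_prod)
  qed
  then have "(\<Sum>\<pi>\<in>NC_on {..<k}. \<bar>\<Prod>B\<in>\<pi>. c (card B)\<bar>) \<le> real (card (NC_on {..<k})) * R ^ k"
    by (rule sum_bounded_above)
  moreover have "\<bar>nc_sum c c {..<k}\<bar> \<le> (\<Sum>\<pi>\<in>NC_on {..<k}. \<bar>\<Prod>B\<in>\<pi>. c (card B)\<bar>)"
    unfolding nc_sum_def by (simp add: sum_abs)
  ultimately have "\<bar>nc_sum c c {..<k}\<bar> \<le> real (card (NC k)) * R ^ k"
    by (simp add: NC_eq_NC_on)
  also have "\<dots> \<le> (2 * 4 ^ k) * R ^ k" using card_NC_le[of k] R by (intro mult_right_mono) auto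
  finally show ?thesis by (simp add: power_mult_distrib)
qed

lemma nths_replicate_subset:
  assumes "B \<subseteq> {..<r}"
  shows "nths (replicate r x) B = replicate (card B) x"
proof -
  have "{i. i < r \<and> i \<in> B} = B" using assms by auto
  then have "length (nths (replicate r x) B) = card B" by (simp add: length_nths)
  moreover have "\<forall>y\<in>set (nths (replicate r x) B). y = x"
    using set_nths_subset[of "replicate r x" B] by (auto split: if_splits)
  ultimately show ?thesis by (metis replicate_eqI)
qed

text \<open>The moment-cumulant formula is triangular: the one-block partition contributes the
  cumulant of order \<open>r\<close> and every other partition only cumulants of lower
  order.\<close>

lemma free_cumulant_replicate_unique:
  assumes mom: "\<And>k. moment \<tau> k T = complex_of_real (nc_sum c c {..<k})"
  shows "r \<ge> 1 \<Longrightarrow> free_cumulant \<tau> (replicate r T) = complex_of_real (c r)"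
proof (induction r rule: less_induct)
  case (less r)
  let ?top = "{{..<r}}"
  have "free_cumulant \<tau> (replicate r T) = \<tau> (op_prod (replicate r T)) -
      (\<Sum>\<pi>\<in>NC r - {?top}. \<Prod>B\<in>\<pi>. free_cumulant \<tau> (nths (replicate r T) B))"
    by (subst free_cumulant.simps) simp
  also have "(\<Sum>\<pi>\<in>NC r - {?top}. \<Prod>B\<in>\<pi>. free_cumulant \<tau> (nths (replicate r T) B)) =
      (\<Sum>\<pi>\<in>NC r - {?top}. \<Prod>B\<in>\<pi>. complex_of_real (c (card B)))"
  proof (intro sum.cong prod.cong refl)
    fix \<pi> B assume \<pi>: "\<pi> \<in> NC r - {?top}" and B: "B \<in> \<pi>"
    have \<pi>': "\<pi> \<in> NC_on {..<r}" using \<pi> by (simp add: NC_eq_NC_on)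
    have sub: "B \<subseteq> {..<r}" using NC_on_D(6)[OF \<pi>' B] .
    have nths: "nths (replicate r T) B = replicate (card B) T" by (rule nths_replicate_subset[OF sub])
    have "B \<noteq> {}" using NC_on_D(4)[OF \<pi>'] B by auto
    then have "1 \<le> card B" using sub finite_subset by (fastforce simp: Suc_le_eq card_gt_0_iff)
    moreover have "card B < r" using NC_block_less[of \<pi> "replicate r T" B] \<pi> B nths by simp
    ultimately show "free_cumulant \<tau> (nths (replicate r T) B) = complex_of_real (c (card B))"
      unfolding nths by (intro less.IH)
  qed
  also have "\<tau> (op_prod (replicate r T)) = complex_of_real (\<Sum>\<pi>\<in>NC r. \<Prod>B\<in>\<pi>. c (card B))"
    using mom[of r] by (simp add: moment_def nc_sum_def NC_eq_NC_on)
  also have "(\<Sum>\<pi>\<in>NC r. \<Prod>B\<in>\<pi>. c (card B)) =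
      c r + (\<Sum>\<pi>\<in>NC r - {?top}. \<Prod>B\<in>\<pi>. c (card B))"
    using NC_top[of r] less.prems by (subst sum.remove[OF finite_NC, of ?top]) auto
  finally show ?case by simp
qed

section \<open>Counting noncrossing pairings of a word\<close>

text \<open>This is the number of noncrossing pairings of the positions of a word that join equal
  letters only. The partner of the first letter separates the enclosed letters from the later ones.
  Complex values allow direct comparison with traces.\<close>

function ncp :: "nat list \<Rightarrow> complex" where
  "ncp [] = 1"
| "ncp (i # w) =
    (\<Sum>k<length w. if w ! k = i then ncp (take k w) * ncp (drop (Suc k) w) else 0)"
  by pat_completeness auto
termination by (relation "Wellfounded.measure length") auto

lemma ncp_odd: "odd (length w) \<Longrightarrow> ncp w = 0"
proof (induction w rule: ncp.induct)
  case (2 i w)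
  have "(if w ! k = i then ncp (take k w) * ncp (drop (Suc k) w) else 0) = 0"
    if k: "k \<in> {..<length w}" for k
  proof (cases "w ! k = i")
    case True
    have "odd (length (take k w)) \<or> odd (length (drop (Suc k) w))" using 2(3) k by simp
    then show ?thesis using 2(1)[OF k True] 2(2)[OF k True] by auto
  qed simp
  then show ?case by simp
qed simp

text \<open>An innermost pair of a noncrossing pairing joins two neighbours. In the induction, the
  partner of the first letter is not its neighbour, so the enclosed word is nonempty and again has
  distinct neighbours.\<close>

lemma ncp_distinct_adj: "w \<noteq> [] \<Longrightarrow> distinct_adj w \<Longrightarrow> ncp w = 0"
proof (induction w rule: ncp.induct)
  case (2 i w)
  have "(if w ! k = i then ncp (take k w) * ncp (drop (Suc k) w) else 0) = 0"
    if k: "k \<in> {..<length w}" for k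
  proof (cases "w ! k = i")
    case True
    have "w \<noteq> []" using k by auto
    then have "w ! 0 \<noteq> i" using 2(4) by (simp add: distinct_adj_Cons hd_conv_nth)
    then have "k \<noteq> 0" using True by (cases k) auto
    then have "take k w \<noteq> []" using k by auto
    moreover have "distinct_adj (take k w @ drop k w)"
      using 2(4) by (cases "w = []") (simp_all add: distinct_adj_Cons)
    then have "distinct_adj (take k w)" by (subst (asm) distinct_adj_append_iff) simp
    ultimately show ?thesis using 2(1)[OF k True] by simp
  qed simp
  then show ?case by simp
qed simp

text \<open>A letter that occurs once has no partner.\<close>

lemma ncp_count_1: "count_list w j = 1 \<Longrightarrow> ncp w = 0"
proof (induction w rule: ncp.induct)
  case (2 i w)
  have "(if w ! k = i then ncp (take k w) * ncp (drop (Suc k) w) else 0) = 0"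
    if k: "k \<in> {..<length w}" for k
  proof (cases "w ! k = i")
    case True
    have w: "w = take k w @ i # drop (Suc k) w" using k True by (metis id_take_nth_drop lessThan_iff)
    show ?thesis
    proof (cases "i = j")
      case ij: True
      then have "count_list w j = 0" using 2(3) by simp
      moreover have "count_list w j > 0" by (subst w) (simp add: ij)
      ultimately show ?thesis by simp
    next
      case False
      have "count_list w j = count_list (take k w) j + count_list (drop (Suc k) w) j"
        by (subst w) (use False in simp)
      moreover have "count_list w j = 1" using 2(3) False by simp
      ultimately have "count_list (take k w) j = 1 \<or> count_list (drop (Suc k) w) j = 1" by linarith
      then show ?thesis using 2(1)[OF k True] 2(2)[OF k True] by auto
    qed
  qed simp
  then show ?case by simp
qed simp

lemma sum_lessThan_add_split:
  fixes f :: "nat \<Rightarrow> 'a::comm_monoid_add"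
  shows "(\<Sum>k<a + b. f k) = (\<Sum>k<a. f k) + (\<Sum>l<b. f (a + l))"
  by (induction b) (simp_all add: add.assoc)

text \<open>Two neighbouring letters with no further occurrence can only be joined to each other,
  and such a pair never obstructs another one. The induction follows the partner of the first letter
  of \<open>u\<close>, which lies in \<open>u\<close> or in \<open>v\<close>.\<close>

lemma ncp_cancel: "i \<notin> set u \<Longrightarrow> i \<notin> set v \<Longrightarrow> ncp (u @ i # i # v) = ncp (u @ v)"
proof (induction "length u" arbitrary: u v rule: less_induct)
  case less
  show ?case
  proof (cases u)
    case Nil
    have "v ! k \<noteq> i" if "k < length v" for k using less.prems that by auto
    then show ?thesis using Nil by (simp add: sum.lessThan_Suc_shift del: sum.lessThan_Suc)
  next
    case (Cons j u')
    have ij: "i \<noteq> j" using less.prems Cons by auto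
    let ?w = "u' @ i # i # v"
    let ?f = "\<lambda>k. if ?w ! k = j then ncp (take k ?w) * ncp (drop (Suc k) ?w) else 0"
    let ?w' = "u' @ v"
    let ?f' = "\<lambda>k. if ?w' ! k = j then ncp (take k ?w') * ncp (drop (Suc k) ?w') else 0"
    have "ncp (u @ i # i # v) = (\<Sum>k<length u' + (2 + length v). ?f k)"
      using Cons by (simp add: add.commute)
    also have "\<dots> = (\<Sum>k<length u'. ?f k) + (\<Sum>l<2. ?f (length u' + l))
        + (\<Sum>l<length v. ?f (length u' + (2 + l)))"
      unfolding sum_lessThan_add_split by (simp add: add.assoc)
    also have "(\<Sum>l<2. ?f (length u' + l)) = 0"
      using ij by (simp add: numeral_2_eq_2 nth_append)
    also have "(\<Sum>k<length u'. ?f k) = (\<Sum>k<length u'. ?f' k)"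
    proof (rule sum.cong[OF refl])
      fix k assume k: "k \<in> {..<length u'}"
      have "ncp (drop (Suc k) u' @ i # i # v) = ncp (drop (Suc k) u' @ v)"
        using less.prems Cons by (intro less.hyps) (auto dest: in_set_dropD)
      then show "?f k = ?f' k" using k by (simp add: nth_append)
    qed
    also have "(\<Sum>l<length v. ?f (length u' + (2 + l))) = (\<Sum>l<length v. ?f' (length u' + l))"
    proof (rule sum.cong[OF refl])
      fix l assume l: "l \<in> {..<length v}"
      have "ncp (u' @ i # i # take l v) = ncp (u' @ take l v)"
        using less.prems Cons by (intro less.hyps) (auto dest: in_set_takeD)
      then show "?f (length u' + (2 + l)) = ?f' (length u' + l)" using l by (simp add: nth_append eval_nat_numeral)
    qed
    also have "(\<Sum>k<length u'. ?f' k) + 0 + (\<Sum>l<length v. ?f' (length u' + l)) =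
        (\<Sum>k<length u' + length v. ?f' k)"
      unfolding sum_lessThan_add_split by simp
    also have "\<dots> = ncp (u @ v)" using Cons by simp
    finally show ?thesis .
  qed
qed

text \<open>A crude bound suffices, because it only enters the constant in front of
  \<open>1 / n\<close>.\<close>

lemma norm_ncp_le: "cmod (ncp w) \<le> fact (length w)"
proof (induction w rule: ncp.induct)
  case (2 i w)
  have "cmod (ncp (i # w)) \<le> (\<Sum>k<length w. fact (length w))"
    unfolding ncp.simps
  proof (rule sum_norm_le)
    fix k assume k: "k \<in> {..<length w}"
    show "cmod (if w ! k = i then ncp (take k w) * ncp (drop (Suc k) w) else 0) \<le> fact (length w)"
    proof (cases "w ! k = i")
      case True
      have "cmod (ncp (take k w) * ncp (drop (Suc k) w)) \<le> fact k * fact (length w - Suc k)"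
        using 2(1)[OF k True] 2(2)[OF k True] k
        by (simp add: norm_mult mult_mono min_def del: fact_Suc)
      also have "\<dots> \<le> fact (k + (length w - Suc k))"
        using fact_fact_dvd_fact[of k "length w - Suc k", where ?'a=nat]
        by (metis dvd_imp_le fact_gt_zero of_nat_fact of_nat_le_iff of_nat_mult)
      also have "\<dots> \<le> fact (length w)" using k by (intro fact_mono) auto
      finally show ?thesis using True by simp
    qed simp
  qed
  also have "\<dots> \<le> fact (Suc (length w))" by (simp add: mult_right_mono)
  finally show ?case by simp
qed simp

section \<open>Weighted sums over lists of index pairs\<close>

text \<open>The recursive form, in place of a sum over a set of lists, lets an induction peel off
  one factor of the quadratic form together with its weight.\<close>

primrec psum :: "nat \<Rightarrow> (nat \<Rightarrow> nat \<Rightarrow> complex) \<Rightarrow> nat \<Rightarrow> ((nat \<times> nat) list \<Rightarrow> complex) \<Rightarrow> complex"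
  where
  "psum n b 0 F = F []"
| "psum n b (Suc k) F = (\<Sum>l<n. \<Sum>r<n. b l r * psum n b k (\<lambda>p. F ((l, r) # p)))"

lemma psum_cong: "(\<And>p. length p = k \<Longrightarrow> F p = G p) \<Longrightarrow> psum n b k F = psum n b k G"
proof (induction k arbitrary: F G)
  case (Suc k)
  have "psum n b k (\<lambda>p. F ((l, r) # p)) = psum n b k (\<lambda>p. G ((l, r) # p))" for l r
    by (rule Suc.IH) (simp add: Suc.prems)
  then show ?case by simp
qed simp

lemma psum_add: "psum n b k (\<lambda>p. F p + G p) = psum n b k F + psum n b k G"
  by (induction k arbitrary: F G) (simp_all add: algebra_simps sum.distrib)

lemma psum_diff: "psum n b k (\<lambda>p. F p - G p) = psum n b k F - psum n b k G"
  by (induction k arbitrary: F G) (simp_all add: right_diff_distrib sum_subtractf)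

lemma psum_mult: "psum n b k (\<lambda>p. c * F p) = c * psum n b k F"
  by (induction k arbitrary: F) (simp_all add: sum_distrib_left mult_ac)

lemma psum_mult_right: "psum n b k (\<lambda>p. F p * c) = psum n b k F * c"
  using psum_mult[of n b k c F] by (simp add: mult.commute)

lemma psum_zero: "psum n b k (\<lambda>p. 0) = 0"
  by (induction k) simp_all

lemma psum_sum: "psum n b k (\<lambda>p. \<Sum>i\<in>I. F i p) = (\<Sum>i\<in>I. psum n b k (F i))"
  by (induction I rule: infinite_finite_induct) (simp_all add: psum_zero psum_add)

lemma psum_append: "psum n b (a + k) F = psum n b a (\<lambda>p. psum n b k (\<lambda>q. F (p @ q)))"
  by (induction a arbitrary: F) simp_all

lemma psum_split:
  assumes "t < k"
  shows "psum n b k F =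
    psum n b t (\<lambda>p. \<Sum>l<n. \<Sum>r<n. b l r * psum n b (k - Suc t) (\<lambda>q. F (p @ (l, r) # q)))"
proof -
  have "k = t + Suc (k - Suc t)" using assms by simp
  then have "psum n b k F = psum n b (t + Suc (k - Suc t)) F" by simp
  also have "\<dots> = psum n b t (\<lambda>p. psum n b (Suc (k - Suc t)) (\<lambda>q. F (p @ q)))"
    by (rule psum_append)
  finally show ?thesis by simp
qed

definition word :: "(nat \<times> nat) list \<Rightarrow> nat list" where
  "word p = concat (map (\<lambda>(l, r). [l, r]) p)"

lemma word_simps [simp]:
  "word [] = []" "word ((l, r) # p) = l # r # word p" "word (p @ q) = word p @ word q"
  by (simp_all add: word_def)

lemma length_word [simp]: "length (word p) = 2 * length p"
  by (induction p) (auto simp: word_def)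

lemma sum_lessThan_double_Suc:
  fixes f :: "nat \<Rightarrow> 'a::comm_monoid_add"
  shows "(\<Sum>i<Suc (2 * k). f i) = f (2 * k) + (\<Sum>t<k. f (2 * t) + f (Suc (2 * t)))"
  by (induction k) (simp_all add: ac_simps)

text \<open>The partner of \<open>j\<close> encloses an even number of letters, so it is the left
  index of some pair or the final letter. After a left index the rest of the word starts with the
  matching right index and ends with \<open>l\<close>, so the bordered shape reproduces
  itself.\<close>

lemma ncp_word_bordered:
  "ncp (j # word p @ [l]) = (if l = j then ncp (word p) else 0) +
    (\<Sum>t<length p. if fst (p ! t) = j
      then ncp (word (take t p)) * ncp (snd (p ! t) # word (drop (Suc t) p) @ [l]) else 0)"
proof -
  let ?w = "word p @ [l]"
  let ?f = "\<lambda>k. if ?w ! k = j then ncp (take k ?w) * ncp (drop (Suc k) ?w) else 0"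
  have even: "?f (2 * t) = (if fst (p ! t) = j
      then ncp (word (take t p)) * ncp (snd (p ! t) # word (drop (Suc t) p) @ [l]) else 0)"
    if t: "t < length p" for t
  proof -
    have p: "p = take t p @ (fst (p ! t), snd (p ! t)) # drop (Suc t) p"
      using id_take_nth_drop[OF t] by simp
    have w: "?w = word (take t p) @ fst (p ! t) # snd (p ! t) # word (drop (Suc t) p) @ [l]"
      by (subst p) (simp del: append_take_drop_id prod.collapse)
    have len: "length (word (take t p)) = 2 * t" using t by simp
    show ?thesis unfolding w using len by (simp add: nth_append del: length_word)
  qed
  have odd: "?f (Suc (2 * t)) = 0" if "t < length p" for t
    using that by (simp add: ncp_odd)
  have "ncp (j # ?w) = (\<Sum>k<Suc (2 * length p). ?f k)" by simp
  also have "\<dots> = ?f (2 * length p) + (\<Sum>t<length p. ?f (2 * t) + ?f (Suc (2 * t)))"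
    by (rule sum_lessThan_double_Suc)
  also have "(\<Sum>t<length p. ?f (2 * t) + ?f (Suc (2 * t))) = (\<Sum>t<length p. if fst (p ! t) = j
      then ncp (word (take t p)) * ncp (snd (p ! t) # word (drop (Suc t) p) @ [l]) else 0)"
    using even odd by (intro sum.cong refl) simp
  also have "?f (2 * length p) = (if l = j then ncp (word p) else 0)"
    by (simp add: nth_append)
  finally show ?thesis .
qed

lemma sum_lessThan_double_Suc':
  fixes f :: "nat \<Rightarrow> 'a::comm_monoid_add"
  shows "(\<Sum>i<Suc (2 * k). f i) = f 0 + (\<Sum>t<k. f (Suc (2 * t)) + f (Suc (Suc (2 * t))))"
  by (induction k) (simp_all add: ac_simps)

text \<open>By the same parity argument the partner of \<open>i\<close> is \<open>j\<close> or the
  right index of some pair; in the second case the enclosed letters form a bordered word.\<close>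

lemma ncp_word_Cons:
  "ncp (i # j # word p) = (if j = i then ncp (word p) else 0) +
    (\<Sum>t<length p. if snd (p ! t) = i
      then ncp (j # word (take t p) @ [fst (p ! t)]) * ncp (word (drop (Suc t) p)) else 0)"
proof -
  let ?w = "j # word p"
  let ?f = "\<lambda>k. if ?w ! k = i then ncp (take k ?w) * ncp (drop (Suc k) ?w) else 0"
  have even: "?f (Suc (Suc (2 * t))) = (if snd (p ! t) = i
      then ncp (j # word (take t p) @ [fst (p ! t)]) * ncp (word (drop (Suc t) p)) else 0)"
    if t: "t < length p" for t
  proof -
    have p: "p = take t p @ (fst (p ! t), snd (p ! t)) # drop (Suc t) p"
      using id_take_nth_drop[OF t] by simp
    have w: "?w = (j # word (take t p) @ [fst (p ! t)]) @ snd (p ! t) # word (drop (Suc t) p)"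
      by (subst p) (simp del: append_take_drop_id prod.collapse)
    have len: "length (j # word (take t p) @ [fst (p ! t)]) = Suc (Suc (2 * t))" using t by simp
    show ?thesis unfolding w using len
      by (simp add: nth_append del: length_word append_Cons append_assoc)
  qed
  have odd: "?f (Suc (2 * t)) = 0" if "t < length p" for t
    using that by (simp add: ncp_odd del: take_Suc_Cons)
  have "ncp (i # ?w) = (\<Sum>k<Suc (2 * length p). ?f k)" by simp
  also have "\<dots> = ?f 0 + (\<Sum>t<length p. ?f (Suc (2 * t)) + ?f (Suc (Suc (2 * t))))"
    by (rule sum_lessThan_double_Suc')
  also have "(\<Sum>t<length p. ?f (Suc (2 * t)) + ?f (Suc (Suc (2 * t)))) =
    (\<Sum>t<length p. if snd (p ! t) = i
      then ncp (j # word (take t p) @ [fst (p ! t)]) * ncp (word (drop (Suc t) p)) else 0)"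
    using even odd by (intro sum.cong refl) simp
  finally show ?thesis by simp
qed


declare ncp.simps(2) [simp del]

section \<open>Recursions for sums over noncrossing pairings\<close>

definition pairing_sum :: "nat \<Rightarrow> (nat \<Rightarrow> nat \<Rightarrow> complex) \<Rightarrow> nat \<Rightarrow> complex" where
  "pairing_sum n b k = psum n b k (\<lambda>p. ncp (word p))"

text \<open>Read cyclically, the last letter \<open>l\<close> and the first letter \<open>j\<close>
  form one more index pair, weighted by the matrix \<open>c\<close>.\<close>

definition bordered_sum ::
  "nat \<Rightarrow> (nat \<Rightarrow> nat \<Rightarrow> complex) \<Rightarrow> (nat \<Rightarrow> nat \<Rightarrow> complex) \<Rightarrow> nat \<Rightarrow> complex" where
  "bordered_sum n b c k = (\<Sum>j<n. \<Sum>l<n. c l j * psum n b k (\<lambda>p. ncp (j # word p @ [l])))"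

lemma pairing_sum_0 [simp]: "pairing_sum n b 0 = 1"
  by (simp add: pairing_sum_def)

lemma sum_delta_Kronecker:
  fixes f :: "nat \<Rightarrow> complex"
  shows "i < n \<Longrightarrow> (\<Sum>j<n. f j * (if j = i then x else 0)) = f i * x"
  by (subst sum.mono_neutral_cong_right[of "{..<n}" "{i}" _ "\<lambda>j. f j * x"]) auto

text \<open>Joining \<open>j\<close> to the last letter closes up the trace of \<open>c\<close>.
  Joining it to a left index identifies that index with \<open>j\<close>, so that
  \<open>c l j * b j r\<close> sums to an entry of the matrix product, while the enclosed letters
  split off as a factor.\<close>

lemma bordered_sum_rec:
  "bordered_sum n b c k = (\<Sum>i<n. c i i) * pairing_sum n b k +
    (\<Sum>t<k. pairing_sum n b t *
      bordered_sum n b (\<lambda>l r. \<Sum>j<n. c l j * b j r) (k - Suc t))"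
proof -
  have inner: "psum n b k (\<lambda>p. ncp (j # word p @ [l])) =
      (if l = j then pairing_sum n b k else 0) + (\<Sum>t<k. pairing_sum n b t *
        (\<Sum>r<n. b j r * psum n b (k - Suc t) (\<lambda>q. ncp (r # word q @ [l]))))"
    if j: "j < n" for j l
  proof -
    define G where "G t p = (if fst (p ! t) = j
      then ncp (word (take t p)) * ncp (snd (p ! t) # word (drop (Suc t) p) @ [l]) else 0)"
      for t and p :: "(nat \<times> nat) list"
    have "psum n b k (\<lambda>p. ncp (j # word p @ [l])) =
        psum n b k (\<lambda>p. (if l = j then ncp (word p) else 0) + (\<Sum>t<k. G t p))"
      by (rule psum_cong) (subst ncp_word_bordered, simp add: G_def)
    also have "\<dots> = psum n b k (\<lambda>p. if l = j then ncp (word p) else 0) + (\<Sum>t<k. psum n b k (G t))"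
      by (simp add: psum_add psum_sum)
    also have "psum n b k (\<lambda>p. if l = j then ncp (word p) else 0) =
        (if l = j then pairing_sum n b k else 0)"
      by (simp add: pairing_sum_def psum_zero)
    also have "(\<Sum>t<k. psum n b k (G t)) = (\<Sum>t<k. pairing_sum n b t *
        (\<Sum>r<n. b j r * psum n b (k - Suc t) (\<lambda>q. ncp (r # word q @ [l]))))"
    proof (rule sum.cong[OF refl])
      fix t assume t: "t \<in> {..<k}"
      define W where "W = (\<Sum>r<n. b j r * psum n b (k - Suc t) (\<lambda>q. ncp (r # word q @ [l])))"
      have "psum n b k (G t) = psum n b t (\<lambda>p. \<Sum>l'<n. \<Sum>r<n. b l' r *
          psum n b (k - Suc t) (\<lambda>q. G t (p @ (l', r) # q)))"
        using t by (intro psum_split) simp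
      also have "\<dots> = psum n b t (\<lambda>p. ncp (word p) * W)"
      proof (rule psum_cong)
        fix p :: "(nat \<times> nat) list" assume p: "length p = t"
        have "(\<Sum>r<n. b l' r * psum n b (k - Suc t) (\<lambda>q. G t (p @ (l', r) # q))) =
            (if l' = j then ncp (word p) * W else 0)" for l'
          using p by (simp add: G_def nth_append psum_mult psum_zero W_def sum_distrib_left mult_ac)
        then show "(\<Sum>l'<n. \<Sum>r<n. b l' r * psum n b (k - Suc t) (\<lambda>q. G t (p @ (l', r) # q))) =
            ncp (word p) * W"
          using j by (simp add: sum.delta')
      qed
      also have "\<dots> = pairing_sum n b t * W"
        by (simp add: psum_mult_right pairing_sum_def)
      finally show "psum n b k (G t) = pairing_sum n b t *
          (\<Sum>r<n. b j r * psum n b (k - Suc t) (\<lambda>q. ncp (r # word q @ [l])))"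
        unfolding W_def .
    qed
    finally show ?thesis .
  qed
  have "bordered_sum n b c k = (\<Sum>j<n. \<Sum>l<n. c l j * (if l = j then pairing_sum n b k else 0)) +
    (\<Sum>j<n. \<Sum>l<n. c l j * (\<Sum>t<k. pairing_sum n b t *
        (\<Sum>r<n. b j r * psum n b (k - Suc t) (\<lambda>q. ncp (r # word q @ [l])))))"
    unfolding bordered_sum_def sum.distrib[symmetric]
    by (intro sum.cong refl) (simp add: inner distrib_left)
  also have "(\<Sum>j<n. \<Sum>l<n. c l j * (if l = j then pairing_sum n b k else 0)) =
      (\<Sum>i<n. c i i) * pairing_sum n b k"
    unfolding sum_distrib_right by (intro sum.cong refl sum_delta_Kronecker) simp
  also have "(\<Sum>j<n. \<Sum>l<n. c l j * (\<Sum>t<k. pairing_sum n b t *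
        (\<Sum>r<n. b j r * psum n b (k - Suc t) (\<lambda>q. ncp (r # word q @ [l]))))) =
      (\<Sum>j<n. \<Sum>l<n. \<Sum>t<k. \<Sum>r<n. pairing_sum n b t *
        ((c l j * b j r) * psum n b (k - Suc t) (\<lambda>q. ncp (r # word q @ [l]))))"
    by (simp add: sum_distrib_left mult_ac)
  also have "\<dots> = (\<Sum>j<n. \<Sum>t<k. \<Sum>l<n. \<Sum>r<n. pairing_sum n b t *
        ((c l j * b j r) * psum n b (k - Suc t) (\<lambda>q. ncp (r # word q @ [l]))))"
    by (intro sum.cong refl sum.swap)
  also have "\<dots> = (\<Sum>t<k. \<Sum>j<n. \<Sum>l<n. \<Sum>r<n. pairing_sum n b t *
        ((c l j * b j r) * psum n b (k - Suc t) (\<lambda>q. ncp (r # word q @ [l]))))"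
    by (rule sum.swap)
  also have "\<dots> = (\<Sum>t<k. pairing_sum n b t *
      bordered_sum n b (\<lambda>l r. \<Sum>j<n. c l j * b j r) (k - Suc t))"
  proof (rule sum.cong[OF refl])
    fix t
    let ?H = "\<lambda>j l r. (c l j * b j r) * psum n b (k - Suc t) (\<lambda>q. ncp (r # word q @ [l]))"
    \<comment> \<open>The contracted index \<open>j\<close> is moved innermost, where it forms the
      matrix product.\<close>
    have "(\<Sum>j<n. \<Sum>l<n. \<Sum>r<n. ?H j l r) = (\<Sum>j<n. \<Sum>r<n. \<Sum>l<n. ?H j l r)"
      by (intro sum.cong refl sum.swap)
    also have "\<dots> = (\<Sum>r<n. \<Sum>j<n. \<Sum>l<n. ?H j l r)"
      by (rule sum.swap)
    also have "\<dots> = (\<Sum>r<n. \<Sum>l<n. \<Sum>j<n. ?H j l r)"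
      by (intro sum.cong refl sum.swap)
    also have "\<dots> = bordered_sum n b (\<lambda>l r. \<Sum>j<n. c l j * b j r) (k - Suc t)"
      unfolding bordered_sum_def by (simp add: sum_distrib_right)
    finally show "(\<Sum>j<n. \<Sum>l<n. \<Sum>r<n. pairing_sum n b t * ?H j l r) = pairing_sum n b t *
        bordered_sum n b (\<lambda>l r. \<Sum>j<n. c l j * b j r) (k - Suc t)"
      by (simp add: sum_distrib_left[symmetric])
  qed
  finally show ?thesis .
qed

text \<open>Here the letters after the partner of \<open>i\<close> split off, and
  \<open>b l i * b i j\<close> sums to an entry of the square of \<open>b\<close>, which ties the
  two ends of the enclosed word.\<close>

lemma pairing_sum_Suc:
  "pairing_sum n b (Suc k) = (\<Sum>i<n. b i i) * pairing_sum n b k +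
    (\<Sum>t<k. bordered_sum n b (\<lambda>l r. \<Sum>j<n. b l j * b j r) t * pairing_sum n b (k - Suc t))"
proof -
  have inner: "psum n b k (\<lambda>p. ncp (i # j # word p)) =
      (if j = i then pairing_sum n b k else 0) + (\<Sum>t<k.
        (\<Sum>l<n. b l i * psum n b t (\<lambda>p. ncp (j # word p @ [l]))) * pairing_sum n b (k - Suc t))"
    if i: "i < n" for i j
  proof -
    define G where "G t p = (if snd (p ! t) = i
      then ncp (j # word (take t p) @ [fst (p ! t)]) * ncp (word (drop (Suc t) p)) else 0)"
      for t and p :: "(nat \<times> nat) list"
    have "psum n b k (\<lambda>p. ncp (i # j # word p)) =
        psum n b k (\<lambda>p. (if j = i then ncp (word p) else 0) + (\<Sum>t<k. G t p))"
      by (rule psum_cong) (simp only: ncp_word_Cons G_def)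
    also have "\<dots> = psum n b k (\<lambda>p. if j = i then ncp (word p) else 0) + (\<Sum>t<k. psum n b k (G t))"
      by (simp add: psum_add psum_sum)
    also have "psum n b k (\<lambda>p. if j = i then ncp (word p) else 0) =
        (if j = i then pairing_sum n b k else 0)"
      by (simp add: pairing_sum_def psum_zero)
    also have "(\<Sum>t<k. psum n b k (G t)) = (\<Sum>t<k.
        (\<Sum>l<n. b l i * psum n b t (\<lambda>p. ncp (j # word p @ [l]))) * pairing_sum n b (k - Suc t))"
    proof (rule sum.cong[OF refl])
      fix t assume t: "t \<in> {..<k}"
      have "psum n b k (G t) = psum n b t (\<lambda>p. \<Sum>l<n. \<Sum>r<n. b l r *
          psum n b (k - Suc t) (\<lambda>q. G t (p @ (l, r) # q)))"
        using t by (intro psum_split) simp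
      also have "\<dots> = psum n b t (\<lambda>p. \<Sum>l<n. (b l i * ncp (j # word p @ [l])) *
          pairing_sum n b (k - Suc t))"
      proof (rule psum_cong, rule sum.cong[OF refl])
        fix p :: "(nat \<times> nat) list" and l assume p: "length p = t"
        have *: "b l r * psum n b (k - Suc t) (\<lambda>q. G t (p @ (l, r) # q)) =
            b l r * (if r = i then ncp (j # word p @ [l]) * pairing_sum n b (k - Suc t) else 0)" for r
          using p by (simp add: G_def nth_append psum_mult psum_zero pairing_sum_def)
        show "(\<Sum>r<n. b l r * psum n b (k - Suc t) (\<lambda>q. G t (p @ (l, r) # q))) =
            (b l i * ncp (j # word p @ [l])) * pairing_sum n b (k - Suc t)"
          unfolding * sum_delta_Kronecker[OF i] by (simp add: mult.assoc)
      qed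
      also have "\<dots> = (\<Sum>l<n. b l i * psum n b t (\<lambda>p. ncp (j # word p @ [l]))) *
          pairing_sum n b (k - Suc t)"
        by (simp add: psum_sum psum_mult psum_mult_right sum_distrib_right)
      finally show "psum n b k (G t) =
        (\<Sum>l<n. b l i * psum n b t (\<lambda>p. ncp (j # word p @ [l]))) * pairing_sum n b (k - Suc t)" .
    qed
    finally show ?thesis .
  qed
  let ?P = "\<lambda>t j l. psum n b t (\<lambda>p. ncp (j # word p @ [l]))"
  have "pairing_sum n b (Suc k) = (\<Sum>i<n. \<Sum>j<n. b i j * psum n b k (\<lambda>p. ncp (i # j # word p)))"
    by (simp add: pairing_sum_def)
  also have "\<dots> = (\<Sum>i<n. \<Sum>j<n. b i j * (if j = i then pairing_sum n b k else 0)) +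
    (\<Sum>i<n. \<Sum>j<n. b i j * (\<Sum>t<k. (\<Sum>l<n. b l i * ?P t j l) * pairing_sum n b (k - Suc t)))"
    unfolding sum.distrib[symmetric]
    by (intro sum.cong refl) (simp add: inner distrib_left)
  also have "(\<Sum>i<n. \<Sum>j<n. b i j * (if j = i then pairing_sum n b k else 0)) =
      (\<Sum>i<n. b i i) * pairing_sum n b k"
    unfolding sum_distrib_right by (intro sum.cong refl sum_delta_Kronecker) simp
  also have "(\<Sum>i<n. \<Sum>j<n. b i j * (\<Sum>t<k. (\<Sum>l<n. b l i * ?P t j l) * pairing_sum n b (k - Suc t)))
    = (\<Sum>i<n. \<Sum>j<n. \<Sum>t<k. b i j * (\<Sum>l<n. b l i * ?P t j l) * pairing_sum n b (k - Suc t))"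
    by (simp only: sum_distrib_left[where A="{..<k}"] mult.assoc)
  also have "\<dots> = (\<Sum>i<n. \<Sum>t<k. \<Sum>j<n. b i j * (\<Sum>l<n. b l i * ?P t j l) * pairing_sum n b (k - Suc t))"
    by (intro sum.cong refl sum.swap)
  also have "\<dots> = (\<Sum>t<k. \<Sum>i<n. \<Sum>j<n. b i j * (\<Sum>l<n. b l i * ?P t j l) * pairing_sum n b (k - Suc t))"
    by (rule sum.swap)
  also have "\<dots> = (\<Sum>t<k. bordered_sum n b (\<lambda>l r. \<Sum>j<n. b l j * b j r) t * pairing_sum n b (k - Suc t))"
  proof (rule sum.cong[OF refl])
    fix t
    have "(\<Sum>i<n. \<Sum>j<n. b i j * (\<Sum>l<n. b l i * ?P t j l)) =
        (\<Sum>j<n. \<Sum>i<n. b i j * (\<Sum>l<n. b l i * ?P t j l))"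
      by (rule sum.swap)
    also have "\<dots> = (\<Sum>j<n. \<Sum>i<n. \<Sum>l<n. (b l i * b i j) * ?P t j l)"
      by (simp add: sum_distrib_left mult_ac)
    also have "\<dots> = (\<Sum>j<n. \<Sum>l<n. \<Sum>i<n. (b l i * b i j) * ?P t j l)"
      by (intro sum.cong refl sum.swap)
    also have "\<dots> = bordered_sum n b (\<lambda>l r. \<Sum>j<n. b l j * b j r) t"
      unfolding bordered_sum_def by (simp add: sum_distrib_right)
    finally show "(\<Sum>i<n. \<Sum>j<n. b i j * (\<Sum>l<n. b l i * ?P t j l) * pairing_sum n b (k - Suc t)) =
        bordered_sum n b (\<lambda>l r. \<Sum>j<n. b l j * b j r) t * pairing_sum n b (k - Suc t)"
      by (simp add: sum_distrib_right[symmetric])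
  qed
  finally show ?thesis .
qed

section \<open>Words with few distinct letters\<close>

abbreviation words :: "nat \<Rightarrow> nat \<Rightarrow> nat list set" where
  "words n L \<equiv> {w. set w \<subseteq> {..<n} \<and> length w = L}"

lemma finite_words: "finite (words n L)"
  by (simp add: finite_lists_length_eq)

lemma sum_words_Suc:
  fixes F :: "nat list \<Rightarrow> 'a::comm_monoid_add"
  shows "(\<Sum>w\<in>words n (Suc L). F w) = (\<Sum>i<n. \<Sum>w\<in>words n L. F (i # w))"
proof -
  have "words n (Suc L) = (\<lambda>(i, w). i # w) ` ({..<n} \<times> words n L)"
    by (auto simp: length_Suc_conv image_iff)
  moreover have "inj_on (\<lambda>(i, w). i # w) ({..<n} \<times> words n L)" by (auto simp: inj_on_def)
  ultimately show ?thesis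
    by (simp add: sum.reindex sum.cartesian_product case_prod_unfold)
qed

lemma norm_psum_le:
  assumes b: "\<And>l r. l < n \<Longrightarrow> r < n \<Longrightarrow> cmod (b l r) \<le> \<beta>" and \<beta>: "\<beta> \<ge> 0"
  shows "cmod (psum n b k (\<lambda>p. F (word p))) \<le> \<beta> ^ k * (\<Sum>w\<in>words n (2 * k). cmod (F w))"
proof (induction k arbitrary: F)
  case 0
  have "words n 0 = {[]}" by auto
  then show ?case by simp
next
  case (Suc k)
  have "cmod (psum n b (Suc k) (\<lambda>p. F (word p))) \<le>
      (\<Sum>l<n. \<Sum>r<n. cmod (b l r * psum n b k (\<lambda>p. F (l # r # word p))))"
    by (auto intro!: order_trans[OF norm_sum] sum_mono)
  also have "\<dots> \<le> (\<Sum>l<n. \<Sum>r<n. \<beta> * (\<beta> ^ k * (\<Sum>w\<in>words n (2 * k). cmod (F (l # r # w)))))"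
    unfolding norm_mult
    by (intro sum_mono mult_mono Suc.IH) (auto simp: b \<beta>)
  also have "\<dots> = \<beta> ^ Suc k * (\<Sum>l<n. \<Sum>r<n. \<Sum>w\<in>words n (2 * k). cmod (F (l # r # w)))"
    by (simp add: sum_distrib_left mult.assoc)
  also have "(\<Sum>l<n. \<Sum>r<n. \<Sum>w\<in>words n (2 * k). cmod (F (l # r # w))) =
      (\<Sum>w\<in>words n (2 * Suc k). cmod (F w))"
    by (simp add: sum_words_Suc del: word_def)
  finally show ?case .
qed

text \<open>A word with at most \<open>d\<close> distinct letters is read off from a list of
  \<open>d\<close> letters by a list of \<open>L\<close> positions in it.\<close>

lemma card_words_few_letters:
  assumes "n \<ge> 1"
  shows "card {w\<in>words n L. card (set w) \<le> d} \<le> n ^ d * d ^ L"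
proof -
  have "{w\<in>words n L. card (set w) \<le> d} \<subseteq>
      (\<lambda>(f, ks). map ((!) f) ks) ` (words n d \<times> words d L)"
  proof
    fix w assume "w \<in> {w\<in>words n L. card (set w) \<le> d}"
    then have w: "set w \<subseteq> {..<n}" "length w = L" "card (set w) \<le> d" by auto
    \<comment> \<open>The list of letters is padded to length exactly \<open>d\<close>; 0 is an
      admissible letter because \<open>n \<ge> 1\<close>.\<close>
    define f where "f = remdups w @ replicate (d - card (set w)) 0"
    have lf: "length f = d" using w by (simp add: f_def length_remdups_card_conv)
    have sf: "set f \<subseteq> {..<n}" using w assms by (auto simp: f_def)
    have "\<exists>k<d. f ! k = x" if "x \<in> set w" for x
    proof -
      have "x \<in> set f" using that by (simp add: f_def)
      then show ?thesis using lf by (auto simp: in_set_conv_nth)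
    qed
    then obtain h where h: "h x < d" "f ! h x = x" if "x \<in> set w" for x by metis
    have "map ((!) f) (map h w) = w" using h by (simp add: map_idI)
    moreover have "set (map h w) \<subseteq> {..<d}" "length (map h w) = L" using h w by auto
    ultimately show "w \<in> (\<lambda>(f, ks). map ((!) f) ks) ` (words n d \<times> words d L)"
      using lf sf by (intro image_eqI[of _ _ "(f, map h w)"]) auto
  qed
  then have "card {w\<in>words n L. card (set w) \<le> d} \<le> card (words n d \<times> words d L)"
    by (rule surj_card_le[rotated]) (simp add: finite_words)
  then show ?thesis by (simp add: card_cartesian_product card_lists_length_eq)
qed

text \<open>The words on which \<open>F\<close> can be nonzero use at most \<open>m - 1\<close>
  letters. There are at most a constant times \<open>n ^ (m - 1)\<close> of them, each with weight
  at most \<open>(C / n) ^ m\<close>, which leaves one factor \<open>1 / n\<close>.\<close>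

lemma norm_psum_few_letters_le:
  assumes n: "n \<ge> 1" and m: "m \<ge> 1" and C: "C \<ge> 0"
    and b: "\<And>l r. l < n \<Longrightarrow> r < n \<Longrightarrow> cmod (b l r) \<le> C / real n"
    and K: "K \<ge> 0" "\<And>w. w \<in> words n (2 * m) \<Longrightarrow> cmod (F w) \<le> K"
    and F0: "\<And>w. w \<in> words n (2 * m) \<Longrightarrow> m \<le> card (set w) \<Longrightarrow> F w = 0"
  shows "cmod (psum n b m (\<lambda>p. F (word p))) \<le> C ^ m * K * real m ^ (2 * m) / real n"
proof -
  let ?bad = "{w\<in>words n (2 * m). card (set w) \<le> m - 1}"
  have "(\<Sum>w\<in>words n (2 * m). cmod (F w)) = (\<Sum>w\<in>?bad. cmod (F w))"
  proof (rule sum.mono_neutral_right)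
    show "\<forall>w\<in>words n (2 * m) - ?bad. cmod (F w) = 0"
    proof
      fix w assume "w \<in> words n (2 * m) - ?bad"
      then have w: "w \<in> words n (2 * m)" "\<not> card (set w) \<le> m - 1" by auto
      then have "m \<le> card (set w)" by linarith
      then show "cmod (F w) = 0" using F0[OF w(1)] by simp
    qed
  qed (auto simp: finite_words)
  also have "\<dots> \<le> real (card ?bad) * K"
    using K by (intro sum_bounded_above) auto
  also have "real (card ?bad) \<le> real (n ^ (m - 1) * (m - 1) ^ (2 * m))"
    using card_words_few_letters[OF n, of "2 * m" "m - 1"] by (simp only: of_nat_le_iff)
  also have "real (n ^ (m - 1) * (m - 1) ^ (2 * m)) \<le> real n ^ (m - 1) * real m ^ (2 * m)"
    unfolding of_nat_mult of_nat_power by (intro mult_left_mono power_mono) auto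
  finally have S: "(\<Sum>w\<in>words n (2 * m). cmod (F w)) \<le> real n ^ (m - 1) * real m ^ (2 * m) * K"
    using K(1) by (simp add: mult_right_mono)
  have "cmod (psum n b m (\<lambda>p. F (word p))) \<le> (C / real n) ^ m * (\<Sum>w\<in>words n (2 * m). cmod (F w))"
    by (rule norm_psum_le) (use b C in auto)
  also have "\<dots> \<le> (C / real n) ^ m * (real n ^ (m - 1) * real m ^ (2 * m) * K)"
    using S C by (intro mult_left_mono) auto
  also have "\<dots> = C ^ m * K * real m ^ (2 * m) * (real n ^ (m - 1) / real n ^ m)"
    by (simp add: power_divide)
  also have "real n ^ (m - 1) / real n ^ m = 1 / real n"
    using n m by (cases m) auto
  finally show ?thesis by simp
qed

section \<open>Limits of the pairing sums and bounds for traces of powers\<close>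

lemma bordered_sum_cong:
  "(\<And>l j. l < n \<Longrightarrow> j < n \<Longrightarrow> c l j = c' l j) \<Longrightarrow> bordered_sum n b c k = bordered_sum n b c' k"
  by (simp add: bordered_sum_def)

lemma pow_mat_Suc_index:
  assumes "B \<in> carrier_mat n n" "l < n" "r < n"
  shows "(B ^\<^sub>m Suc s) $$ (l, r) = (\<Sum>j<n. (B ^\<^sub>m s) $$ (l, j) * B $$ (j, r))"
  using assms pow_carrier_mat[OF assms(1), of s]
  by (auto simp: scalar_prod_def lessThan_atLeast0 intro!: sum.cong)

lemma pow_mat_1:
  assumes "(B :: complex mat) \<in> carrier_mat n n"
  shows "B ^\<^sub>m 1 = B"
  using assms by (simp add: left_mult_one_mat)

text \<open>Both the sums over noncrossing pairings and the sums over noncrossing partitions obey the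
  same recursion, obtained by splitting at the second element of the block of 0.\<close>

lemma pairing_sum_limit:
  assumes B: "\<And>n. n \<ge> 1 \<Longrightarrow> B n \<in> carrier_mat n n"
    and tr: "\<And>r. r \<ge> 1 \<Longrightarrow> (\<lambda>n. mat_trace (B n ^\<^sub>m r)) \<longlonglongrightarrow> complex_of_real (c r)"
  defines "b \<equiv> \<lambda>n l r. B n $$ (l, r)"
  shows "(\<lambda>n. pairing_sum n (b n) k) \<longlonglongrightarrow> complex_of_real (nc_sum c c {..<k}) \<and>
    (\<forall>s\<ge>1. (\<lambda>n. bordered_sum n (b n) (\<lambda>l j. (B n ^\<^sub>m s) $$ (l, j)) k) \<longlonglongrightarrow>
      complex_of_real (nc_sum (\<lambda>j. c (j + s - 1)) c {..<Suc k}))"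
proof (induction k rule: less_induct)
  case (less k)
  define M where "M n k = pairing_sum n (b n) k" for n k
  define D where "D n s k = bordered_sum n (b n) (\<lambda>l j. (B n ^\<^sub>m s) $$ (l, j)) k" for n s k
  define N where "N k = nc_sum c c {..<k}" for k
  \<comment> \<open>The first element of the root block stands for \<open>s\<close> merged factors,
    so a root block with \<open>j\<close> elements counts as \<open>j + s - 1\<close>. In particular
    \<open>E 1\<close> is the ordinary sum.\<close>
  define E where "E s k = nc_sum (\<lambda>j. c (j + s - 1)) c {..<Suc k}" for s k
  have trace: "(\<Sum>i<n. (B n ^\<^sub>m s) $$ (i, i)) = mat_trace (B n ^\<^sub>m s)" if "n \<ge> 1" for n s
    using B[OF that] by (simp add: mat_trace_def carrier_matD)
  have D_rec: "D n s k = mat_trace (B n ^\<^sub>m s) * M n k + (\<Sum>t<k. M n t * D n (Suc s) (k - Suc t))"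
    if n: "n \<ge> 1" for n s k
  proof -
    have "bordered_sum n (b n) (\<lambda>l r. \<Sum>j<n. (B n ^\<^sub>m s) $$ (l, j) * b n j r) i = D n (Suc s) i" for i
      unfolding D_def
      by (rule bordered_sum_cong) (simp only: pow_mat_Suc_index[OF B[OF n]] b_def)
    then show ?thesis
      using trace[OF n, of s] bordered_sum_rec[of n "b n" "\<lambda>l j. (B n ^\<^sub>m s) $$ (l, j)" k]
      by (simp add: D_def M_def)
  qed
  have M_rec: "M n (Suc k) = mat_trace (B n ^\<^sub>m 1) * M n k + (\<Sum>t<k. M n t * D n 2 (k - Suc t))"
    if n: "n \<ge> 1" for n k
  proof -
    have B1: "B n ^\<^sub>m 1 = B n" by (rule pow_mat_1[OF B[OF n]])
    have "bordered_sum n (b n) (\<lambda>l r. \<Sum>j<n. b n l j * b n j r) i = D n 2 i" for i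
      unfolding D_def
    proof (rule bordered_sum_cong)
      fix l j assume "l < n" "j < n"
      then have "(B n ^\<^sub>m Suc 1) $$ (l, j) = (\<Sum>i<n. (B n ^\<^sub>m 1) $$ (l, i) * B n $$ (i, j))"
        by (rule pow_mat_Suc_index[OF B[OF n]])
      then show "(\<Sum>i<n. b n l i * b n i j) = (B n ^\<^sub>m 2) $$ (l, j)"
        unfolding B1 by (simp add: b_def numeral_2_eq_2)
    qed
    then have "M n (Suc k) = mat_trace (B n) * M n k + (\<Sum>t<k. D n 2 t * M n (k - Suc t))"
      using trace[OF n, of 1] pairing_sum_Suc[of n "b n" k] unfolding B1
      by (simp add: M_def b_def)
    \<comment> \<open>\<open>pairing_sum_Suc\<close> counts the pairs inside the bordered factor;
      reversing the summation gives the arrangement of the partition recursion.\<close>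
    also have "(\<Sum>t<k. D n 2 t * M n (k - Suc t)) =
        (\<Sum>t<k. D n 2 (k - Suc t) * M n (k - Suc (k - Suc t)))"
      by (rule sum.nat_diff_reindex[symmetric])
    also have "\<dots> = (\<Sum>t<k. M n t * D n 2 (k - Suc t))"
      by (intro sum.cong refl) (simp add: mult.commute)
    finally show ?thesis unfolding B1 .
  qed
  have E_rec: "E s k = c s * N k + (\<Sum>t<k. N t * E (Suc s) (k - Suc t))" if "s \<ge> 1" for s k
  proof -
    have "E s k = c s * N k + (\<Sum>t<k. N t * nc_sum (\<lambda>j. c (Suc j + s - 1)) c {..<k - t})"
      unfolding E_def N_def by (subst nc_sum_recursion) simp
    also have "(\<Sum>t<k. N t * nc_sum (\<lambda>j. c (Suc j + s - 1)) c {..<k - t}) =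
        (\<Sum>t<k. N t * E (Suc s) (k - Suc t))"
      using that by (intro sum.cong refl) (simp add: E_def Suc_diff_Suc)
    finally show ?thesis .
  qed
  have IH_M: "(\<lambda>n. M n t) \<longlonglongrightarrow> complex_of_real (N t)" if "t < k" for t
    using less.IH[OF that] by (simp add: M_def N_def)
  have IH_D: "(\<lambda>n. D n s t) \<longlonglongrightarrow> complex_of_real (E s t)" if "t < k" "s \<ge> 1" for s t
    using less.IH[OF that(1)] that(2) by (simp add: D_def E_def)
  \<comment> \<open>The shape of \<open>B n\<close> is only known for \<open>n \<ge> 1\<close>, so
    the recursions hold eventually.\<close>
  have ev: "\<forall>\<^sub>F n in sequentially. (n::nat) \<ge> 1" by (rule eventually_ge_at_top)
  have M_lim: "(\<lambda>n. M n k) \<longlonglongrightarrow> complex_of_real (N k)"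
  proof (cases k)
    case 0
    then show ?thesis by (simp add: M_def N_def)
  next
    case (Suc k')
    have "N k = E 1 k'" by (simp add: Suc N_def E_def)
    then have N: "N k = c 1 * N k' + (\<Sum>t<k'. N t * E 2 (k' - Suc t))"
      using E_rec[of 1 k'] by (simp add: numeral_2_eq_2)
    have "(\<lambda>n. mat_trace (B n ^\<^sub>m 1) * M n k' + (\<Sum>t<k'. M n t * D n 2 (k' - Suc t)))
        \<longlonglongrightarrow> complex_of_real (c 1) * complex_of_real (N k') +
          (\<Sum>t<k'. complex_of_real (N t) * complex_of_real (E 2 (k' - Suc t)))"
      using Suc by (intro tendsto_intros tr IH_M IH_D) auto
    also have "complex_of_real (c 1) * complex_of_real (N k') +
          (\<Sum>t<k'. complex_of_real (N t) * complex_of_real (E 2 (k' - Suc t))) = complex_of_real (N k)"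
      unfolding N by simp
    finally show ?thesis
      by (rule Lim_transform_eventually) (use ev in eventually_elim, simp only: M_rec Suc)
  qed
  \<comment> \<open>The limit of the bordered sums at \<open>k\<close> relies on the limit of the
    pairing sums at the same \<open>k\<close>, whereas \<open>M_lim\<close> only uses smaller
    indices; this fixes the order of the two claims.\<close>
  have D_lim: "(\<lambda>n. D n s k) \<longlonglongrightarrow> complex_of_real (E s k)" if s: "s \<ge> 1" for s
  proof -
    have "(\<lambda>n. mat_trace (B n ^\<^sub>m s) * M n k + (\<Sum>t<k. M n t * D n (Suc s) (k - Suc t)))
        \<longlonglongrightarrow> complex_of_real (c s) * complex_of_real (N k) +
          (\<Sum>t<k. complex_of_real (N t) * complex_of_real (E (Suc s) (k - Suc t)))"
      using s by (intro tendsto_intros tr M_lim IH_M IH_D) auto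
    also have "complex_of_real (c s) * complex_of_real (N k) +
          (\<Sum>t<k. complex_of_real (N t) * complex_of_real (E (Suc s) (k - Suc t))) =
        complex_of_real (E s k)"
      unfolding E_rec[OF s] by simp
    finally show ?thesis
      by (rule Lim_transform_eventually) (use ev in eventually_elim, simp only: D_rec[symmetric])
  qed
  show ?case using M_lim D_lim by (simp add: M_def D_def N_def E_def)
qed

text \<open>A further factor sums \<open>n\<close> products and brings one more
  \<open>1 / n\<close>, so the entries of all powers remain of order \<open>1 / n\<close>, and the
  traces of order 1.\<close>

lemma norm_pow_mat_index_le:
  assumes B: "B \<in> carrier_mat n n" and C: "C \<ge> 0"
    and bound: "\<And>l r. l < n \<Longrightarrow> r < n \<Longrightarrow> cmod (B $$ (l, r)) \<le> C / real n"
  shows "s \<ge> 1 \<Longrightarrow> l < n \<Longrightarrow> r < n \<Longrightarrow> cmod ((B ^\<^sub>m s) $$ (l, r)) \<le> C ^ s / real n"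
proof (induction s arbitrary: r rule: nat_induct_at_least)
  case base
  then show ?case using bound by (simp only: pow_mat_1[OF B] power_one_right)
next
  case (Suc s)
  have "cmod ((B ^\<^sub>m Suc s) $$ (l, r)) \<le> (\<Sum>j<n. cmod ((B ^\<^sub>m s) $$ (l, j)) * cmod (B $$ (j, r)))"
    unfolding pow_mat_Suc_index[OF B Suc.prems] norm_mult[symmetric] by (rule norm_sum)
  also have "\<dots> \<le> (\<Sum>j<n. (C ^ s / real n) * (C / real n))"
    using Suc C by (intro sum_mono mult_mono bound) auto
  also have "\<dots> = C ^ Suc s / real n"
    using Suc.prems by simp
  finally show ?case .
qed

lemma norm_mat_trace_pow_le:
  assumes B: "B \<in> carrier_mat n n" and n: "n \<ge> 1" and C: "C \<ge> 0" and s: "s \<ge> 1"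
    and bound: "\<And>l r. l < n \<Longrightarrow> r < n \<Longrightarrow> cmod (B $$ (l, r)) \<le> C / real n"
  shows "cmod (mat_trace (B ^\<^sub>m s)) \<le> C ^ s"
proof -
  have dim: "dim_row (B ^\<^sub>m s) = n" using pow_carrier_mat[OF B] by blast
  have "cmod (mat_trace (B ^\<^sub>m s)) \<le> (\<Sum>i<n. C ^ s / real n)"
    unfolding mat_trace_def dim
    by (intro sum_norm_le norm_pow_mat_index_le[OF B C bound s]) auto
  also have "\<dots> = C ^ s" using n by simp
  finally show ?thesis .
qed

section \<open>Operators and their commutants\<close>

lemma scaleC_op_apply [simp]: "blinfun_apply (scaleC_op c T) x = scaleC c (blinfun_apply T x)"
  by transfer simp

lemma scaleC_one [simp]: "scaleC 1 x = (x::'h::complex_hilbert)"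
  using scaleC_of_real[of 1 x] by simp

lemma scaleC_zero_left [simp]: "scaleC 0 x = (0::'h::complex_hilbert)"
  using scaleC_of_real[of 0 x] by simp

lemma scaleC_minus_one: "scaleC (-1) x = - (x::'h::complex_hilbert)"
  using scaleC_of_real[of "-1" x] by simp

lemma scaleC_zero_right [simp]: "scaleC c (0::'h::complex_hilbert) = 0"
  using scaleC_add_right[of c 0 0] by simp

lemma scaleC_op_minus_one: "scaleC_op (-1) T = - T"
  by (rule blinfun_eqI) (simp add: scaleC_minus_one blinfun.minus_left)

lemma scaleC_op_zero_right [simp]: "scaleC_op c 0 = 0"
  by (rule blinfun_eqI) simp

lemma scaleC_op_scaleC_op [simp]: "scaleC_op c (scaleC_op d T) = scaleC_op (c * d) T"
  by (rule blinfun_eqI) (simp add: scaleC_scaleC)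

lemma scaleC_op_add_right: "scaleC_op c (S + T) = scaleC_op c S + scaleC_op c T"
  by (rule blinfun_eqI) (simp add: blinfun.add_left scaleC_add_right)

lemma scaleC_op_sum_right: "scaleC_op c (\<Sum>i\<in>I. F i) = (\<Sum>i\<in>I. scaleC_op c (F i))"
  by (induction I rule: infinite_finite_induct) (simp_all add: scaleC_op_add_right)

lemma comp_assoc_op: "(R o\<^sub>L S) o\<^sub>L T = R o\<^sub>L (S o\<^sub>L T)"
  by (rule blinfun_eqI) simp

lemma comp_add_left_op: "(R + S) o\<^sub>L T = (R o\<^sub>L T) + (S o\<^sub>L T)"
  by (rule blinfun_eqI) (simp add: blinfun.add_left)

lemma comp_add_right_op: "T o\<^sub>L (R + S) = (T o\<^sub>L R) + (T o\<^sub>L S)"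
  by (rule blinfun_eqI) (simp add: blinfun.add_left blinfun.add_right)

lemma comp_scaleC_left: "scaleC_op c S o\<^sub>L T = scaleC_op c (S o\<^sub>L T)"
  by (rule blinfun_eqI) simp

lemma comp_scaleC_right: "clinear_op S \<Longrightarrow> S o\<^sub>L scaleC_op c T = scaleC_op c (S o\<^sub>L T)"
  by (rule blinfun_eqI) (simp add: clinear_op_def)

lemma comp_id_op [simp]: "id_blinfun o\<^sub>L T = T" "T o\<^sub>L id_blinfun = T"
  by (auto intro: blinfun_eqI)

lemma clinear_op_id [simp]: "clinear_op id_blinfun"
  by (simp add: clinear_op_def)

lemma clinear_op_add: "clinear_op S \<Longrightarrow> clinear_op T \<Longrightarrow> clinear_op (S + T)"
  by (simp add: clinear_op_def blinfun.add_left scaleC_add_right)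

lemma clinear_op_scaleC: "clinear_op T \<Longrightarrow> clinear_op (scaleC_op c T)"
  by (simp add: clinear_op_def scaleC_scaleC mult.commute)

lemma clinear_op_comp: "clinear_op S \<Longrightarrow> clinear_op T \<Longrightarrow> clinear_op (S o\<^sub>L T)"
  by (simp add: clinear_op_def)

lemma op_prod_Nil [simp]: "op_prod [] = id_blinfun"
  by (simp add: op_prod_def)

lemma op_prod_Cons [simp]: "op_prod (T # Ts) = T o\<^sub>L op_prod Ts"
  by (simp add: op_prod_def)

lemma op_prod_append: "op_prod (xs @ ys) = op_prod xs o\<^sub>L op_prod ys"
  by (induction xs) (simp_all add: comp_assoc_op comp_id_op)

lemma commutant_clinear: "S \<in> commutant M \<Longrightarrow> clinear_op S"
  by (simp add: commutant_def)

lemma commutant_commute: "S \<in> commutant M \<Longrightarrow> T \<in> M \<Longrightarrow> S o\<^sub>L T = T o\<^sub>L S"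
  by (simp add: commutant_def)

lemma commutantI: "clinear_op S \<Longrightarrow> (\<And>T. T \<in> M \<Longrightarrow> S o\<^sub>L T = T o\<^sub>L S) \<Longrightarrow> S \<in> commutant M"
  by (simp add: commutant_def)

lemma commutant_id: "id_blinfun \<in> commutant M"
  by (rule commutantI) simp_all

lemma commutant_add: "S \<in> commutant M \<Longrightarrow> T \<in> commutant M \<Longrightarrow> S + T \<in> commutant M"
  by (simp add: commutant_def clinear_op_add comp_add_left_op comp_add_right_op)

text \<open>To pull the scalar through an element of \<open>M\<close>, that element must be complex
  linear, which its type does not guarantee.\<close>

lemma commutant_scaleC:
  assumes "T \<in> commutant M" "\<And>S. S \<in> M \<Longrightarrow> clinear_op S"
  shows "scaleC_op c T \<in> commutant M"
  using assms
  by (simp add: commutant_def clinear_op_scaleC comp_scaleC_left comp_scaleC_right)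

lemma commutant_comp:
  assumes S: "S \<in> commutant M" and T: "T \<in> commutant M"
  shows "S o\<^sub>L T \<in> commutant M"
proof (rule commutantI)
  fix R assume R: "R \<in> M"
  show "S o\<^sub>L T o\<^sub>L R = R o\<^sub>L (S o\<^sub>L T)"
    using commutant_commute[OF S R] commutant_commute[OF T R] by (metis comp_assoc_op)
qed (use S T in \<open>simp add: commutant_def clinear_op_comp\<close>)

lemma von_neumann_algebra_closed:
  assumes M: "von_neumann_algebra M"
  shows "id_blinfun \<in> M" "S \<in> M \<Longrightarrow> T \<in> M \<Longrightarrow> S + T \<in> M" "T \<in> M \<Longrightarrow> scaleC_op c T \<in> M"
    "S \<in> M \<Longrightarrow> T \<in> M \<Longrightarrow> S o\<^sub>L T \<in> M"
proof -
  have eq: "M = commutant (commutant M)" using M by (simp add: von_neumann_algebra_def)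
  show "id_blinfun \<in> M" by (subst eq) (rule commutant_id)
  show "S + T \<in> M" if "S \<in> M" "T \<in> M" using that eq commutant_add by metis
  have "scaleC_op c T \<in> commutant (commutant M)" if "T \<in> commutant (commutant M)"
    by (rule commutant_scaleC[OF that commutant_clinear])
  then show "scaleC_op c T \<in> M" if "T \<in> M" using that eq[symmetric] by simp
  show "S o\<^sub>L T \<in> M" if "S \<in> M" "T \<in> M" using that eq commutant_comp by metis
qed

lemma not_distinct_adj_split:
  "\<not> distinct_adj (map f xs) \<Longrightarrow> \<exists>u a b v. xs = u @ a # b # v \<and> f a = f b"
proof (induction xs)
  case (Cons x xs)
  show ?case
  proof (cases "distinct_adj (map f xs)")
    case True
    then obtain y ys where "xs = y # ys" "f x = f y" using Cons.prems by (cases xs) auto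
    then show ?thesis by (intro exI[of _ "[]"]) simp
  next
    case False
    then obtain u a b v where "xs = u @ a # b # v" "f a = f b" using Cons.IH by blast
    then show ?thesis by (intro exI[of _ "x # u"]) simp
  qed
qed simp

section \<open>Mixed moments of free copies\<close>

context tracial_ncps
begin

lemmas closed = von_neumann_algebra_closed[OF von_neumann]

lemma clinear: "T \<in> M \<Longrightarrow> clinear_op T"
  using von_neumann by (simp add: von_neumann_algebra_def)

lemma zero_closed: "0 \<in> M"
proof -
  have "scaleC_op 0 id_blinfun \<in> M" using closed by blast
  moreover have "scaleC_op 0 id_blinfun = (0 :: 'h \<Rightarrow>\<^sub>L 'h)" by (rule blinfun_eqI) simp
  ultimately show ?thesis by simp
qed

lemma sum_closed: "(\<And>i. i \<in> I \<Longrightarrow> F i \<in> M) \<Longrightarrow> (\<Sum>i\<in>I. F i) \<in> M"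
  by (induction I rule: infinite_finite_induct) (simp_all add: zero_closed closed)

lemma op_prod_closed: "set Ts \<subseteq> M \<Longrightarrow> op_prod Ts \<in> M"
  by (induction Ts) (simp_all add: closed)

lemma generated_closed: "T \<in> generated_algebra X \<Longrightarrow> X \<in> M \<Longrightarrow> T \<in> M"
  by (induction rule: generated_algebra.induct) (simp_all add: closed)

lemma trace_zero: "\<tau> 0 = 0"
  using trace_add[OF zero_closed zero_closed] by simp

lemma trace_sum: "(\<And>i. i \<in> I \<Longrightarrow> F i \<in> M) \<Longrightarrow> \<tau> (\<Sum>i\<in>I. F i) = (\<Sum>i\<in>I. \<tau> (F i))"
  by (induction I rule: infinite_finite_induct) (simp_all add: trace_zero trace_add sum_closed)

lemma trace_prod_add:
  assumes "set u \<subseteq> M" "set v \<subseteq> M" "S \<in> M" "T \<in> M"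
  shows "\<tau> (op_prod (u @ (S + T) # v)) = \<tau> (op_prod (u @ S # v)) + \<tau> (op_prod (u @ T # v))"
  using assms
  by (simp add: op_prod_append comp_add_left_op comp_add_right_op trace_add closed op_prod_closed)

lemma trace_prod_scaleC:
  assumes "set u \<subseteq> M" "set v \<subseteq> M" "S \<in> M"
  shows "\<tau> (op_prod (u @ scaleC_op c S # v)) = c * \<tau> (op_prod (u @ S # v))"
  using assms
  by (simp add: op_prod_append comp_scaleC_left comp_scaleC_right[OF clinear] trace_scaleC closed
      op_prod_closed)

lemma op_prod_merge: "op_prod (u @ S # T # v) = op_prod (u @ (S o\<^sub>L T) # v)"
  by (simp add: op_prod_append comp_assoc_op)

lemma op_prod_id: "op_prod (u @ id_blinfun # v) = op_prod (u @ v)"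
  by (simp add: op_prod_append)

end

locale free_copies = tracial_ncps M \<tau>
  for M :: "('h::complex_hilbert \<Rightarrow>\<^sub>L 'h) set" and \<tau> +
  fixes X :: "nat \<Rightarrow> 'h \<Rightarrow>\<^sub>L 'h" and mo :: "nat \<Rightarrow> complex"
  assumes X_M: "X i \<in> M"
    and free: "free_family \<tau> X"
    and moment_X: "moment \<tau> k (X i) = mo k"
    and mo_1: "mo 1 = 0" and mo_2: "mo 2 = 1"
begin

abbreviation "alg i \<equiv> generated_algebra (X i)"

lemma alg_M: "T \<in> alg i \<Longrightarrow> T \<in> M"
  using generated_closed[OF _ X_M] .

lemma trace_X: "\<tau> (X i) = 0"
  using moment_X[of 1 i] mo_1 by (simp add: moment_def)

lemma trace_X_sq: "\<tau> (X i o\<^sub>L X i) = 1"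
  using moment_X[of 2 i] mo_2 by (simp add: moment_def numeral_2_eq_2)

lemma trace_alternating:
  assumes "ws \<noteq> []" "distinct_adj (map fst ws)"
    "\<And>i T. (i, T) \<in> set ws \<Longrightarrow> T \<in> alg i \<and> \<tau> T = 0"
  shows "\<tau> (op_prod (map snd ws)) = 0"
proof -
  have "map snd ws ! k \<in> alg (map fst ws ! k) \<and> \<tau> (map snd ws ! k) = 0"
    if "k < length (map snd ws)" for k
    using that assms(3)[of "fst (ws ! k)" "snd (ws ! k)"] by simp
  then show ?thesis using free assms(1,2) unfolding free_family_def
    by (metis length_map map_is_Nil_conv)
qed

text \<open>Freeness speaks of alternating words only. Equal neighbours are merged and recentered as
  \<open>R + c * 1\<close>. Their index differs from \<open>j\<close>, so both resulting words are
  shorter and still contain \<open>j\<close> once; the reduction ends in alternating words of trace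
  0.\<close>

lemma trace_unique_index:
  assumes "\<And>i T. (i, T) \<in> set ws \<Longrightarrow> T \<in> alg i \<and> \<tau> T = 0" "count_list (map fst ws) j = 1"
  shows "\<tau> (op_prod (map snd ws)) = 0"
  using assms
proof (induction "length ws" arbitrary: ws rule: less_induct)
  case less
  have ne: "ws \<noteq> []" using less.prems(2) by auto
  show ?case
  proof (cases "distinct_adj (map fst ws)")
    case True
    then show ?thesis using trace_alternating ne less.prems(1) by blast
  next
    case False
    then obtain u a b v where ws: "ws = u @ a # b # v" "fst a = fst b"
      using not_distinct_adj_split by blast
    define i where "i = fst a"
    define S where "S = snd a"
    define T where "T = snd b"
    have ab: "a = (i, S)" "b = (i, T)" using ws by (auto simp: i_def S_def T_def prod_eq_iff)
    have ST: "S \<in> alg i" "T \<in> alg i" using less.prems(1) ws ab by auto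
    define c where "c = \<tau> (S o\<^sub>L T)"
    define R where "R = (S o\<^sub>L T) + scaleC_op (- c) id_blinfun"
    have R: "R \<in> alg i" unfolding R_def using ST
      by (intro generated_algebra.intros)
    have trR: "\<tau> R = 0" unfolding R_def c_def using ST
      by (simp add: trace_add trace_scaleC closed alg_M trace_unit)
    have ST_eq: "S o\<^sub>L T = R + scaleC_op c id_blinfun"
      unfolding R_def by (intro blinfun_eqI)
        (simp add: blinfun.add_left scaleC_add_left[symmetric] add.assoc)
    have uv: "set (map snd u) \<subseteq> M" "set (map snd v) \<subseteq> M"
      using less.prems(1) ws alg_M by fastforce+
    then have "\<tau> (op_prod (map snd ws)) = \<tau> (op_prod (map snd (u @ (i, R) # v))) +
        c * \<tau> (op_prod (map snd (u @ v)))"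
      using ws ab R by (simp add: op_prod_merge ST_eq trace_prod_add trace_prod_scaleC op_prod_id closed alg_M
          del: op_prod_Cons)
    moreover have "i \<noteq> j" using less.prems(2) ws ab by auto
    then have count: "count_list (map fst (u @ (i, R) # v)) j = 1" "count_list (map fst (u @ v)) j = 1"
      using less.prems(2) ws ab by auto
    have "\<tau> (op_prod (map snd (u @ (i, R) # v))) = 0"
      by (rule less.hyps[OF _ _ count(1)]) (use less.prems(1) ws ab R trR in auto)
    moreover have "\<tau> (op_prod (map snd (u @ v))) = 0"
      by (rule less.hyps[OF _ _ count(2)]) (use less.prems(1) ws ab in auto)
    ultimately show ?thesis by simp
  qed
qed

lemma trace_word_unique:
  assumes "count_list w j = 1"
  shows "\<tau> (op_prod (map X w)) = 0"
proof -
  have "\<tau> (op_prod (map snd (map (\<lambda>i. (i, X i)) w))) = 0"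
    by (rule trace_unique_index[of _ j])
      (use assms in \<open>auto simp: trace_X o_def intro: generated_algebra.gen\<close>)
  then show ?thesis by (simp add: o_def)
qed

text \<open>Without equal neighbours both sides vanish on a nonempty word. Otherwise
  \<open>X i o\<^sub>L X i\<close> is a centered \<open>R\<close> plus the identity: in the first
  term \<open>i\<close> occurs once, so its trace is 0, and the second is the reduction of
  \<open>ncp_cancel\<close>.\<close>

lemma trace_word_pairs:
  "(\<And>i. i \<in> set w \<Longrightarrow> count_list w i = 2) \<Longrightarrow> \<tau> (op_prod (map X w)) = ncp w"
proof (induction "length w" arbitrary: w rule: less_induct)
  case less
  show ?case
  proof (cases "w = [] \<or> distinct_adj w")
    case True
    show ?thesis
    proof (cases "w = []")
      case False
      let ?ws = "map (\<lambda>i. (i, X i)) w"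
      have "\<tau> (op_prod (map snd ?ws)) = 0"
        by (rule trace_alternating)
          (use True False in \<open>auto simp: o_def trace_X intro: generated_algebra.gen\<close>)
      then show ?thesis using True False by (simp add: o_def ncp_distinct_adj)
    qed (simp add: trace_unit)
  next
    case False
    then obtain u i v where w: "w = u @ i # i # v"
      using not_distinct_adj_split[of "\<lambda>x. x" w] by auto
    have c: "count_list u i + count_list v i = 0" using less.prems[of i] w by simp
    then have i: "i \<notin> set u" "i \<notin> set v" by (simp_all add: count_list_0_iff)
    define R where "R = (X i o\<^sub>L X i) + scaleC_op (-1) id_blinfun"
    have R: "R \<in> alg i" unfolding R_def by (intro generated_algebra.intros)
    have trR: "\<tau> R = 0" unfolding R_def
      by (simp add: trace_add trace_scaleC closed X_M trace_unit trace_X_sq)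
    have "X i o\<^sub>L X i = R + id_blinfun" unfolding R_def by (simp add: scaleC_op_minus_one)
    moreover have uv: "set (map X u) \<subseteq> M" "set (map X v) \<subseteq> M" using X_M by auto
    ultimately have "\<tau> (op_prod (map X w)) = \<tau> (op_prod (map X u @ R # map X v)) +
        \<tau> (op_prod (map X (u @ v)))"
      using w R by (simp add: op_prod_merge trace_prod_add op_prod_id closed alg_M del: op_prod_Cons)
    moreover have "\<tau> (op_prod (map X u @ R # map X v)) = 0"
    proof -
      let ?f = "map (\<lambda>i. (i, X i))"
      have "\<tau> (op_prod (map snd (?f u @ (i, R) # ?f v))) = 0"
        by (rule trace_unique_index[of _ i])
          (use i R trR in \<open>auto simp: o_def trace_X intro: generated_algebra.gen\<close>)
      then show ?thesis by (simp add: o_def)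
    qed
    moreover have "\<tau> (op_prod (map X (u @ v))) = ncp (u @ v)"
    proof (rule less.hyps)
      fix j assume j: "j \<in> set (u @ v)"
      then have "j \<noteq> i" using i by auto
      then show "count_list (u @ v) j = 2" using less.prems[of j] w j by auto
    qed (simp add: w)
    ultimately show ?thesis using ncp_cancel[OF i] w by simp
  qed
qed

text \<open>Either some index occurs once and both sides vanish, or every index occurs at least
  twice; then \<open>2 * m\<close> letters on at least \<open>m\<close> indices leave exactly two
  for each.\<close>

lemma trace_word_eq_ncp:
  assumes w: "length w = 2 * m" "m \<le> card (set w)"
  shows "\<tau> (op_prod (map X w)) = ncp w"
proof (cases "\<exists>j. count_list w j = 1")
  case True
  then show ?thesis using trace_word_unique ncp_count_1 by metis
next
  case False
  have ge: "count_list w i \<ge> 2" if "i \<in> set w" for i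
  proof -
    have "count_list w i \<noteq> 0" using that by (simp add: count_list_0_iff)
    moreover have "count_list w i \<noteq> 1" using False by blast
    ultimately show ?thesis by linarith
  qed
  have total: "(\<Sum>i\<in>set w. count_list w i) = 2 * m"
    using sum_count_set[of w "set w"] w by simp
  have "count_list w i = 2" if i: "i \<in> set w" for i
  proof (rule ccontr)
    assume "count_list w i \<noteq> 2"
    then have "(\<Sum>i\<in>set w. 2) < (\<Sum>i\<in>set w. count_list w i)"
      using ge i by (intro sum_strict_mono_ex1) (auto intro!: bexI[of _ i] simp: le_neq_implies_less)
    then show False using total w by simp
  qed
  then show ?thesis by (rule trace_word_pairs)
qed

section \<open>Centered powers and bounds uniform in the index word\<close>

definition pow :: "nat \<Rightarrow> nat \<Rightarrow> 'h \<Rightarrow>\<^sub>L 'h" where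
  "pow k i = op_prod (replicate k (X i))"

definition cpow :: "nat \<Rightarrow> nat \<Rightarrow> 'h \<Rightarrow>\<^sub>L 'h" where
  "cpow k i = pow k i + scaleC_op (- mo k) id_blinfun"

lemma pow_alg: "pow k i \<in> alg i"
  unfolding pow_def by (induction k) (auto intro: generated_algebra.intros)

lemma cpow_alg: "cpow k i \<in> alg i"
  unfolding cpow_def by (intro generated_algebra.intros pow_alg)

lemma cpow_M: "cpow k i \<in> M"
  using alg_M[OF cpow_alg] .

lemma trace_cpow: "\<tau> (cpow k i) = 0"
proof -
  have "\<tau> (pow k i) = mo k" using moment_X[of k i] by (simp add: moment_def pow_def)
  then show ?thesis
    by (simp add: cpow_def trace_add trace_scaleC closed alg_M[OF pow_alg] trace_unit)
qed

lemma cpow_1: "cpow 1 i = X i"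
  by (simp add: cpow_def pow_def mo_1[simplified] blinfun_eqI blinfun.add_left)

text \<open>The coefficients depend on the common moments and not on \<open>i\<close>. This is the
  point at which identical distribution makes the bounds uniform.\<close>

lemma cpow_mult:
  "cpow a i o\<^sub>L cpow b i = cpow (a + b) i + (scaleC_op (- mo b) (cpow a i) +
    (scaleC_op (- mo a) (cpow b i) + scaleC_op (mo (a + b) - mo a * mo b) id_blinfun))"
proof -
  have add: "pow (a + b) i = pow a i o\<^sub>L pow b i"
    by (simp add: pow_def replicate_add op_prod_append)
  have lin: "clinear_op (pow k i)" for k using clinear[OF alg_M[OF pow_alg]] .
  show ?thesis
  proof (rule blinfun_eqI)
    fix x :: 'h
    define P where "P k = blinfun_apply (pow k i)" for k
    have lin': "P k (scaleC c y) = scaleC c (P k y)" for k c y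
      using lin[of k] by (simp add: P_def clinear_op_def)
    have "scaleC (mo (a + b)) x + scaleC (- mo (a + b)) x = 0"
      by (simp add: scaleC_add_left[symmetric])
    moreover have "scaleC (mo a * mo b) x + scaleC (- (mo a * mo b)) x = 0"
      by (simp add: scaleC_add_left[symmetric])
    moreover have "scaleC (mo (a + b) - mo a * mo b) x =
        scaleC (mo (a + b)) x + scaleC (- (mo a * mo b)) x"
      by (simp add: scaleC_add_left[symmetric])
    ultimately show "blinfun_apply (cpow a i o\<^sub>L cpow b i) x =
      blinfun_apply (cpow (a + b) i + (scaleC_op (- mo b) (cpow a i) +
        (scaleC_op (- mo a) (cpow b i) + scaleC_op (mo (a + b) - mo a * mo b) id_blinfun))) x"
      unfolding cpow_def add
      by (simp add: blinfun.add_left blinfun.add_right P_def[symmetric] lin' scaleC_add_right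
          scaleC_scaleC mult.commute add_ac)
  qed
qed

text \<open>The mixed moments of words with a fixed exponent pattern take only finitely many values,
  whatever the indices are. This replaces an operator norm bound uniform in the index.\<close>

lemma finite_trace_cpow:
  "finite {\<tau> (op_prod (map2 cpow ks w)) | w. length w = length ks}"
proof (induction "length ks" arbitrary: ks rule: less_induct)
  case less
  define V where "V ks = {\<tau> (op_prod (map2 cpow ks w)) | w. length w = length ks}" for ks
  have VI: "\<tau> (op_prod (map2 cpow ks w)) \<in> V ks" if "length w = length ks" for ks w
    using that unfolding V_def by blast
  have fin: "finite (V ks')" if "length ks' < length ks" for ks'
    using less.hyps[OF that] unfolding V_def .
  \<comment> \<open>\<open>f j\<close> is the combination from \<open>cpow_mult\<close> after taking
    traces, and \<open>B j\<close> contains the finitely many arguments that the shorter exponent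
    patterns supply.\<close>
  define f where "f j = (\<lambda>(p, q, r, s). p + (- mo (ks ! Suc j) * q + (- mo (ks ! j) * r +
      (mo (ks ! j + ks ! Suc j) - mo (ks ! j) * mo (ks ! Suc j)) * s)))" for j
  define t where "t j = take j ks" for j
  define d where "d j = drop (Suc (Suc j)) ks" for j
  define B where "B j = V (t j @ (ks ! j + ks ! Suc j) # d j) \<times> V (t j @ (ks ! j) # d j) \<times>
      V (t j @ (ks ! Suc j) # d j) \<times> V (t j @ d j)" for j
  have finB: "finite (B j)" if "Suc j < length ks" for j
    unfolding B_def using that by (intro finite_cartesian_product fin) (simp_all add: t_def d_def)
  \<comment> \<open>The empty word has trace 1, a nonempty alternating word 0, and any other word is
    contracted at a pair of equal neighbours.\<close>
  have "V ks \<subseteq> {0, 1} \<union> (\<Union>j\<in>{j. Suc j < length ks}. f j ` B j)"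
  proof
    fix z assume "z \<in> V ks"
    then obtain w where w: "length w = length ks" and z: "z = \<tau> (op_prod (map2 cpow ks w))"
      unfolding V_def by blast
    let ?ws = "zip w (map2 cpow ks w)"
    have fst: "map fst ?ws = w" and snd: "map snd ?ws = map2 cpow ks w" using w by simp_all
    show "z \<in> {0, 1} \<union> (\<Union>j\<in>{j. Suc j < length ks}. f j ` B j)"
    proof (cases "distinct_adj w")
      case True
      show ?thesis
      proof (cases "w = []")
        case True
        then show ?thesis using z by (simp add: trace_unit)
      next
        case False
        have "\<tau> (op_prod (map snd ?ws)) = 0"
        proof (rule trace_alternating)
          show "?ws \<noteq> []" using False w by (cases w; cases ks) auto
          show "distinct_adj (map fst ?ws)" unfolding fst by (rule True)
          show "T \<in> alg i \<and> \<tau> T = 0" if "(i, T) \<in> set ?ws" for i T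
            using that by (auto simp: set_zip cpow_alg trace_cpow)
        qed
        then show ?thesis using z snd by simp
      qed
    next
      case False
      then obtain u i v where wi: "w = u @ i # i # v"
        using not_distinct_adj_split[of "\<lambda>x. x" w] by auto
      define j where "j = length u"
      have j: "Suc j < length ks" using w wi by (simp add: j_def)
      then have ks: "ks = t j @ ks ! j # ks ! Suc j # d j"
        unfolding t_def d_def by (metis Cons_nth_drop_Suc Suc_lessD append_take_drop_id)
      have lt: "length (t j) = length u" using j by (simp add: t_def j_def)
      have ld: "length (d j) = length v" using w wi by (simp add: d_def j_def)
      let ?u = "map2 cpow (t j) u" and ?v = "map2 cpow (d j) v"
      have uM: "set ?u \<subseteq> M" and vM: "set ?v \<subseteq> M" by (auto simp: cpow_M)
      have "z = \<tau> (op_prod (?u @ cpow (ks ! j) i # cpow (ks ! Suc j) i # ?v))"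
        unfolding z by (subst ks) (simp add: wi lt)
      also have "\<dots> = \<tau> (op_prod (?u @ (cpow (ks ! j) i o\<^sub>L cpow (ks ! Suc j) i) # ?v))"
        by (simp only: op_prod_merge)
      also have "\<dots> = f j (\<tau> (op_prod (?u @ cpow (ks ! j + ks ! Suc j) i # ?v)),
          \<tau> (op_prod (?u @ cpow (ks ! j) i # ?v)), \<tau> (op_prod (?u @ cpow (ks ! Suc j) i # ?v)),
          \<tau> (op_prod (?u @ ?v)))"
        unfolding cpow_mult f_def using uM vM
        by (simp add: trace_prod_add trace_prod_scaleC closed cpow_M op_prod_id del: op_prod_Cons)
      also have "\<dots> \<in> f j ` B j"
        unfolding B_def
        using VI[of "u @ i # v" "t j @ (ks ! j + ks ! Suc j) # d j"]
          VI[of "u @ i # v" "t j @ (ks ! j) # d j"]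
          VI[of "u @ i # v" "t j @ (ks ! Suc j) # d j"]
          VI[of "u @ v" "t j @ d j"] lt ld
        by (intro imageI) simp
      finally show ?thesis using j by blast
    qed
  qed
  moreover have "finite {j. Suc j < length ks}"
    by (rule finite_subset[of _ "{..<length ks}"]) auto
  ultimately have "finite (V ks)"
    using finB by (elim finite_subset) (intro finite_UnI finite_UN_I finite_imageI, auto)
  then show ?case unfolding V_def .
qed

lemma trace_word_bounded:
  "\<exists>K\<ge>0. \<forall>w. length w = L \<longrightarrow> cmod (\<tau> (op_prod (map X w))) \<le> K"
proof -
  let ?V = "{\<tau> (op_prod (map2 cpow (replicate L 1) w)) | w. length w = length (replicate L (1::nat))}"
  have fin: "finite (insert 0 (cmod ` ?V))" using finite_trace_cpow[of "replicate L 1"] by blast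
  have "map2 cpow (replicate L 1) w = map X w" if "length w = L" for w
    using that
  proof (induction L arbitrary: w)
    case (Suc L)
    then show ?case by (cases w) (auto simp: cpow_1[simplified])
  qed simp
  then have V: "cmod (\<tau> (op_prod (map X w))) \<in> insert 0 (cmod ` ?V)" if "length w = L" for w
    using that by (metis (mono_tags, lifting) image_eqI insertCI length_replicate mem_Collect_eq)
  show ?thesis
  proof (intro exI[of _ "Max (insert 0 (cmod ` ?V))"] conjI allI impI)
    show "0 \<le> Max (insert 0 (cmod ` ?V))" using fin by (intro Max_ge) auto
    show "cmod (\<tau> (op_prod (map X w))) \<le> Max (insert 0 (cmod ` ?V))" if "length w = L" for w
      using fin V[OF that] by (intro Max_ge)
  qed
qed

section \<open>Moments of the quadratic form\<close>

definition qform :: "nat \<Rightarrow> (nat \<Rightarrow> nat \<Rightarrow> complex) \<Rightarrow> 'h \<Rightarrow>\<^sub>L 'h" where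
  "qform n b = (\<Sum>l<n. \<Sum>r<n. scaleC_op (b l r) (X l o\<^sub>L X r))"

lemma qform_M: "qform n b \<in> M"
  unfolding qform_def by (intro sum_closed closed X_M)

lemma trace_comp_qform:
  assumes "S \<in> M" "T \<in> M"
  shows "\<tau> (S o\<^sub>L (qform n b o\<^sub>L T)) =
    (\<Sum>l<n. \<Sum>r<n. b l r * \<tau> ((S o\<^sub>L (X l o\<^sub>L X r)) o\<^sub>L T))"
proof -
  have left: "S o\<^sub>L ((\<Sum>i\<in>I. F i) o\<^sub>L T) = (\<Sum>i\<in>I. S o\<^sub>L (F i o\<^sub>L T))"
    for I :: "nat set" and F
    by (rule blinfun_eqI) (simp add: blinfun.sum_left blinfun.sum_right)
  have "\<tau> (S o\<^sub>L (qform n b o\<^sub>L T)) =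
    (\<Sum>l<n. \<Sum>r<n. \<tau> (S o\<^sub>L (scaleC_op (b l r) (X l o\<^sub>L X r) o\<^sub>L T)))"
    unfolding qform_def left
    by (subst trace_sum, intro sum_closed closed assms X_M, intro sum.cong refl trace_sum closed assms X_M)
  then show ?thesis
    using assms by (simp add: comp_scaleC_left comp_scaleC_right[OF clinear] trace_scaleC closed X_M
        comp_assoc_op)
qed

text \<open>The prefix \<open>S\<close> collects the factors already expanded; the trace is not
  multiplicative, so the induction has to carry them along.\<close>

lemma trace_comp_qform_power:
  "S \<in> M \<Longrightarrow> \<tau> (S o\<^sub>L op_prod (replicate m (qform n b))) =
    psum n b m (\<lambda>p. \<tau> (S o\<^sub>L op_prod (map X (word p))))"
proof (induction m arbitrary: S)
  case (Suc m)
  have R: "op_prod (replicate m (qform n b)) \<in> M"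
    by (rule op_prod_closed) (auto simp: qform_M)
  have "\<tau> (S o\<^sub>L op_prod (replicate (Suc m) (qform n b))) =
      (\<Sum>l<n. \<Sum>r<n. b l r * \<tau> ((S o\<^sub>L (X l o\<^sub>L X r)) o\<^sub>L op_prod (replicate m (qform n b))))"
    by (simp add: trace_comp_qform[OF Suc.prems R])
  also have "\<dots> = (\<Sum>l<n. \<Sum>r<n. b l r *
      psum n b m (\<lambda>p. \<tau> ((S o\<^sub>L (X l o\<^sub>L X r)) o\<^sub>L op_prod (map X (word p)))))"
    using Suc.prems by (simp add: Suc.IH closed X_M)
  finally show ?case by (simp add: comp_assoc_op)
qed simp

lemma moment_qform: "moment \<tau> m (qform n b) = psum n b m (\<lambda>p. \<tau> (op_prod (map X (word p))))"
  using trace_comp_qform_power[of id_blinfun m n b] closed by (simp add: moment_def)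

lemma moment_qform_asymptotics:
  assumes C: "C \<ge> 0" and b: "\<And>n l r. n \<ge> 1 \<Longrightarrow> l < n \<Longrightarrow> r < n \<Longrightarrow> cmod (b n l r) \<le> C / real n"
  shows "(\<lambda>n. moment \<tau> m (qform n (b n)) - pairing_sum n (b n) m) \<longlonglongrightarrow> 0"
proof (cases "m = 0")
  case True
  then show ?thesis by (simp add: moment_def trace_unit)
next
  case False
  then have m: "m \<ge> 1" by simp
  obtain K where K: "K \<ge> 0" "\<And>w. length w = 2 * m \<Longrightarrow> cmod (\<tau> (op_prod (map X w))) \<le> K"
    using trace_word_bounded[of "2 * m"] by blast
  let ?F = "\<lambda>w. \<tau> (op_prod (map X w)) - ncp w"
  let ?K = "K + fact (2 * m)"
  have eq: "moment \<tau> m (qform n (b n)) - pairing_sum n (b n) m = psum n (b n) m (\<lambda>p. ?F (word p))" for n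
    by (simp add: moment_qform pairing_sum_def psum_diff)
  have bound: "cmod (psum n (b n) m (\<lambda>p. ?F (word p))) \<le> C ^ m * ?K * real m ^ (2 * m) / real n"
    if n: "n \<ge> 1" for n
  proof (rule norm_psum_few_letters_le[OF n m C])
    show "cmod (b n l r) \<le> C / real n" if "l < n" "r < n" for l r using b n that by blast
    show "?K \<ge> 0" using K by simp
    show "cmod (?F w) \<le> ?K" if "w \<in> words n (2 * m)" for w
      using K(2)[of w] norm_ncp_le[of w] that
      by (intro order_trans[OF norm_triangle_ineq4] add_mono) auto
    show "?F w = 0" if "w \<in> words n (2 * m)" "m \<le> card (set w)" for w
      using trace_word_eq_ncp[of w m] that by simp
  qed
  show ?thesis
    unfolding eq
  proof (rule Lim_null_comparison)
    show "\<forall>\<^sub>F n in sequentially. cmod (psum n (b n) m (\<lambda>p. ?F (word p))) \<le>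
        C ^ m * ?K * real m ^ (2 * m) / real n"
      using bound by (intro eventually_sequentiallyI[of 1])
    show "(\<lambda>n. C ^ m * ?K * real m ^ (2 * m) / real n) \<longlonglongrightarrow> 0"
      by (rule lim_const_over_n)
  qed
qed

end

section \<open>Operators on square-summable sequences\<close>

text \<open>\<open>F\<close> is defined on all sequences, so that linearity can be stated free of
  summability conditions.\<close>

lemma ell2_op_exists:
  fixes F :: "(nat \<Rightarrow> complex) \<Rightarrow> nat \<Rightarrow> complex"
  assumes add: "\<And>f g. F (\<lambda>k. f k + g k) = (\<lambda>k. F f k + F g k)"
    and scale: "\<And>c f. F (\<lambda>k. c * f k) = (\<lambda>k. c * F f k)"
    and summ: "\<And>f. summable (\<lambda>k. (cmod (f k))\<^sup>2) \<Longrightarrow> summable (\<lambda>k. (cmod (F f k))\<^sup>2)"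
    and bound: "\<And>f. summable (\<lambda>k. (cmod (f k))\<^sup>2) \<Longrightarrow>
      (\<Sum>k. (cmod (F f k))\<^sup>2) \<le> K\<^sup>2 * (\<Sum>k. (cmod (f k))\<^sup>2)"
    and K: "K \<ge> 0"
  shows "\<exists>T :: ell2 \<Rightarrow>\<^sub>L ell2. clinear_op T \<and>
    (\<forall>x k. ell2_nth (blinfun_apply T x) k = F (ell2_nth x) k)"
proof -
  define t where "t x = Abs_ell2 (F (ell2_nth x))" for x
  have nth: "ell2_nth (t x) = F (ell2_nth x)" for x
    unfolding t_def by (rule ell2_nth_Abs[OF summ[OF ell2_summable]])
  have bl: "bounded_linear t"
  proof (rule bounded_linear_intro)
    have "ell2_nth (x + y) = (\<lambda>k. ell2_nth x k + ell2_nth y k)" for x y by (rule ext) simp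
    then show "t (x + y) = t x + t y" for x y
      by (intro ell2_eqI) (simp add: nth add)
    have "ell2_nth (scaleR r x) = (\<lambda>k. complex_of_real r * ell2_nth x k)" for r x by (rule ext) simp
    then show "t (scaleR r x) = scaleR r (t x)" for r x
      by (intro ell2_eqI) (simp add: nth scale)
    show "norm (t x) \<le> norm x * K" for x
    proof (rule power2_le_imp_le)
      show "(norm (t x))\<^sup>2 \<le> (norm x * K)\<^sup>2"
        using bound[OF ell2_summable[of x]]
        by (simp add: ell2_norm_sq nth power_mult_distrib mult.commute)
    qed (use K in simp)
  qed
  have "ell2_nth (scaleC c x) = (\<lambda>k. c * ell2_nth x k)" for c x by (rule ext) simp
  then have "t (scaleC c x) = scaleC c (t x)" for c x
    by (intro ell2_eqI) (simp add: nth scale)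
  then show ?thesis
    using bl nth by (intro exI[of _ "Blinfun t"]) (simp add: clinear_op_def bounded_linear_Blinfun_apply)
qed

lemma ell2_diag_exists:
  assumes "\<And>k. \<bar>a k\<bar> \<le> (K::real)"
  shows "\<exists>T :: ell2 \<Rightarrow>\<^sub>L ell2. clinear_op T \<and>
    (\<forall>x k. ell2_nth (blinfun_apply T x) k = complex_of_real (a k) * ell2_nth x k)"
proof (rule ell2_op_exists[where F="\<lambda>f k. complex_of_real (a k) * f k" and K=K])
  have le: "(cmod (complex_of_real (a k) * f k))\<^sup>2 \<le> K\<^sup>2 * (cmod (f k))\<^sup>2" for f k
    using assms[of k] power_mono[OF assms[of k] abs_ge_zero, of 2]
    by (simp add: norm_mult power_mult_distrib mult_right_mono)
  show s: "summable (\<lambda>k. (cmod (complex_of_real (a k) * f k))\<^sup>2)"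
    if "summable (\<lambda>k. (cmod (f k))\<^sup>2)" for f
    by (rule summable_comparison_test'[OF summable_mult[OF that, of "K\<^sup>2"]]) (use le in simp)
  show "(\<Sum>k. (cmod (complex_of_real (a k) * f k))\<^sup>2) \<le> K\<^sup>2 * (\<Sum>k. (cmod (f k))\<^sup>2)"
    if "summable (\<lambda>k. (cmod (f k))\<^sup>2)" for f
  proof -
    have "(\<Sum>k. (cmod (complex_of_real (a k) * f k))\<^sup>2) \<le> (\<Sum>k. K\<^sup>2 * (cmod (f k))\<^sup>2)"
      by (rule suminf_le[OF _ s[OF that] summable_mult[OF that]]) (rule le)
    then show ?thesis using suminf_mult[OF that] by simp
  qed
  show "K \<ge> 0" using assms[of 0] by linarith
qed (auto simp: algebra_simps)

lemma ell2_shift_exists: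
  "\<exists>T :: ell2 \<Rightarrow>\<^sub>L ell2. clinear_op T \<and>
    (\<forall>x k. ell2_nth (blinfun_apply T x) k = (if k < d then 0 else ell2_nth x (k - d)))"
proof (rule ell2_op_exists[where F="\<lambda>f k. if k < d then 0 else f (k - d)" and K=1])
  let ?G = "\<lambda>f k. (cmod (if k < d then 0 else f (k - d)))\<^sup>2"
  show s: "summable (?G f)" if "summable (\<lambda>k. (cmod (f k))\<^sup>2)" for f
    using that summable_iff_shift[of "?G f" d] by simp
  show "suminf (?G f) \<le> 1\<^sup>2 * (\<Sum>k. (cmod (f k))\<^sup>2)" if "summable (\<lambda>k. (cmod (f k))\<^sup>2)" for f
    using suminf_split_initial_segment[OF s[OF that], of d] by simp
qed auto

lemma ell2_backward_shift_exists:
  "\<exists>T :: ell2 \<Rightarrow>\<^sub>L ell2. clinear_op T \<and>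
    (\<forall>x k. ell2_nth (blinfun_apply T x) k = ell2_nth x (Suc k))"
proof (rule ell2_op_exists[where F="\<lambda>f k. f (Suc k)" and K=1])
  show "summable (\<lambda>k. (cmod (f (Suc k)))\<^sup>2)" if "summable (\<lambda>k. (cmod (f k))\<^sup>2)" for f
    using that by (subst summable_Suc_iff)
  show "(\<Sum>k. (cmod (f (Suc k)))\<^sup>2) \<le> 1\<^sup>2 * (\<Sum>k. (cmod (f k))\<^sup>2)"
    if "summable (\<lambda>k. (cmod (f k))\<^sup>2)" for f
    using suminf_split_head[OF that] by simp
qed auto

section \<open>Coordinate vectors, continuity of the inner product, adjoints\<close>

definition ebasis :: "nat \<Rightarrow> ell2" where
  "ebasis k = Abs_ell2 (\<lambda>j. if j = k then 1 else 0)"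

lemma ell2_nth_ebasis [simp]: "ell2_nth (ebasis k) j = (if j = k then 1 else 0)"
proof -
  have "summable (\<lambda>j. (cmod (if j = k then 1 else 0))\<^sup>2)"
    by (rule summable_finite[of "{k}"]) auto
  then show ?thesis unfolding ebasis_def by (simp add: ell2_nth_Abs)
qed

lemma cinner_ebasis_right: "cinner x (ebasis k) = ell2_nth x k"
proof -
  have "cinner x (ebasis k) = (\<Sum>j\<in>{k}. ell2_nth x j * cnj (ell2_nth (ebasis k) j))"
    unfolding cinner_ell2_def by (rule suminf_finite) auto
  then show ?thesis by simp
qed

lemma ell2_nth_sum: "ell2_nth (\<Sum>k\<in>I. f k) j = (\<Sum>k\<in>I. ell2_nth (f k) j)"
  by (induction I rule: infinite_finite_induct) simp_all

lemma ell2_truncation_tendsto: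
  "(\<lambda>N. \<Sum>k<N. scaleC (ell2_nth x k) (ebasis k)) \<longlonglongrightarrow> x"
proof -
  define y where "y N = (\<Sum>k<N. scaleC (ell2_nth x k) (ebasis k))" for N
  have y: "ell2_nth (y N) j = (if j < N then ell2_nth x j else 0)" for N j
    by (simp add: y_def ell2_nth_sum sum.delta' if_distrib[of "\<lambda>z. _ * z"] cong: if_cong)
  have norm_eq: "(norm (x - y N))\<^sup>2 = (norm x)\<^sup>2 - (\<Sum>k<N. (cmod (ell2_nth x k))\<^sup>2)" for N
  proof -
    have "(norm (x - y N))\<^sup>2 = (\<Sum>k. (cmod (ell2_nth (x - y N) (k + N)))\<^sup>2)"
      unfolding ell2_norm_sq
      by (subst suminf_split_initial_segment[OF ell2_summable[of "x - y N"], of N]) (simp add: y)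
    also have "\<dots> = (\<Sum>k. (cmod (ell2_nth x (k + N)))\<^sup>2)" by (simp add: y)
    also have "\<dots> = (norm x)\<^sup>2 - (\<Sum>k<N. (cmod (ell2_nth x k))\<^sup>2)"
      unfolding ell2_norm_sq using suminf_split_initial_segment[OF ell2_summable[of x], of N] by simp
    finally show ?thesis .
  qed
  have "(\<lambda>N. (norm (x - y N))\<^sup>2) \<longlonglongrightarrow> (norm x)\<^sup>2 - (norm x)\<^sup>2"
    unfolding norm_eq
    by (intro tendsto_intros) (simp add: ell2_norm_sq summable_LIMSEQ[OF ell2_summable])
  then have "(\<lambda>N. sqrt ((norm (x - y N))\<^sup>2)) \<longlonglongrightarrow> sqrt 0"
    by (intro tendsto_real_sqrt) simp
  then have "(\<lambda>N. norm (y N - x)) \<longlonglongrightarrow> 0"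
    by (simp add: norm_minus_commute)
  then show ?thesis
    unfolding y_def[symmetric] by (simp add: LIM_zero_iff tendsto_norm_zero_iff)
qed

lemma cinner_zero_left [simp]: "cinner (0::'h::complex_hilbert) y = 0"
  using cinner_scaleC_left[of 0 0 y] by simp

lemma cinner_sum_left: "cinner (\<Sum>i\<in>I. f i) y = (\<Sum>i\<in>I. cinner (f i :: 'h::complex_hilbert) y)"
  by (induction I rule: infinite_finite_induct) (simp_all add: cinner_add_left)

lemma cinner_add_right: "cinner x (y + z) = cinner x y + cinner (x::'h::complex_hilbert) z"
  by (metis cinner_add_left cinner_commute complex_cnj_add)

lemma cinner_minus_left: "cinner (- x) y = - cinner (x::'h::complex_hilbert) y"
  using cinner_scaleC_left[of "-1" x y] by (simp add: scaleC_minus_one)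

lemma cinner_diff_left: "cinner (x - z) y = cinner x y - cinner (z::'h::complex_hilbert) y"
  using cinner_add_left[of x "- z" y] by (simp add: cinner_minus_left)

text \<open>The factor 2 comes from bounding real and imaginary part separately by the real
  Cauchy-Schwarz inequality; this is enough for continuity.\<close>

lemma cmod_cinner_le: "cmod (cinner x y) \<le> 2 * (norm (x::'h::complex_hilbert) * norm y)"
proof -
  have re: "\<bar>Re (cinner z y)\<bar> \<le> norm z * norm y" for z
    using Cauchy_Schwarz_ineq2[of z y] by (simp add: inner_eq_Re_cinner)
  have "\<bar>Im (cinner x y)\<bar> \<le> norm x * norm y"
    using re[of "scaleC \<i> x"] by (simp add: cinner_scaleC_left norm_scaleC)
  then show ?thesis using re[of x] cmod_le[of "cinner x y"] by linarith
qed

lemma cinner_tendsto_left: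
  assumes "f \<longlonglongrightarrow> (x::'h::complex_hilbert)"
  shows "(\<lambda>n. cinner (f n) y) \<longlonglongrightarrow> cinner x y"
proof -
  have "(\<lambda>n. norm (f n - x)) \<longlonglongrightarrow> 0" using assms by (simp add: LIM_zero tendsto_norm_zero)
  then have "(\<lambda>n. 2 * (norm (f n - x) * norm y)) \<longlonglongrightarrow> 2 * (0 * norm y)"
    by (intro tendsto_intros)
  then have lim: "(\<lambda>n. 2 * (norm (f n - x) * norm y)) \<longlonglongrightarrow> 0" by simp
  have "(\<lambda>n. cinner (f n) y - cinner x y) \<longlonglongrightarrow> 0"
  proof (rule Lim_null_comparison[OF _ lim])
    show "\<forall>\<^sub>F n in sequentially. cmod (cinner (f n) y - cinner x y) \<le> 2 * (norm (f n - x) * norm y)"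
      unfolding cinner_diff_left[symmetric] by (intro always_eventually allI cmod_cinner_le)
  qed
  then show ?thesis by (rule LIM_zero_cancel)
qed

lemma blinfun_sum_scaleC:
  assumes "clinear_op T"
  shows "blinfun_apply T (\<Sum>i\<in>I. scaleC (c i) (f i)) = (\<Sum>i\<in>I. scaleC (c i) (blinfun_apply T (f i)))"
  using assms by (simp add: blinfun.sum_right clinear_op_def)

lemma ell2_op_eq_0I:
  assumes T: "clinear_op T" and z: "\<And>k. blinfun_apply T (ebasis k) = 0"
  shows "T = (0 :: ell2 \<Rightarrow>\<^sub>L ell2)"
proof (rule blinfun_eqI)
  fix x
  have "(\<lambda>N. blinfun_apply T (\<Sum>k<N. scaleC (ell2_nth x k) (ebasis k))) \<longlonglongrightarrow> blinfun_apply T x"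
    by (intro blinfun.tendsto tendsto_const ell2_truncation_tendsto)
  then have "(\<lambda>N::nat. 0) \<longlonglongrightarrow> blinfun_apply T x"
    by (simp add: blinfun_sum_scaleC[OF T] z)
  then show "blinfun_apply T x = blinfun_apply 0 x"
    by (simp add: LIMSEQ_const_iff)
qed

text \<open>The adjoint is given by its coordinates \<open>s y k\<close>. They are square-summable
  by duality: testing \<open>T\<close> on their truncation \<open>z\<close> bounds the partial sum
  \<open>?\<Sigma>\<close> by \<open>norm T * norm y * sqrt ?\<Sigma>\<close>.\<close>

lemma ell2_adjoint_exists:
  fixes T :: "ell2 \<Rightarrow>\<^sub>L ell2"
  assumes T: "clinear_op T"
  shows "\<exists>S. clinear_op S \<and> is_adjoint T S"
proof -
  define s where "s y k = cinner y (blinfun_apply T (ebasis k))" for y k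
  have partial: "(\<Sum>k<N. (cmod (s y k))\<^sup>2) \<le> (norm T * norm y)\<^sup>2" for y N
  proof -
    let ?\<Sigma> = "\<Sum>k<N. (cmod (s y k))\<^sup>2"
    define z where "z = (\<Sum>k<N. scaleC (s y k) (ebasis k))"
    have nz: "ell2_nth z j = (if j < N then s y j else 0)" for j
      by (simp add: z_def ell2_nth_sum sum.delta' if_distrib[of "\<lambda>z. _ * z"] cong: if_cong)
    have "(norm z)\<^sup>2 = ?\<Sigma>"
      unfolding ell2_norm_sq by (subst suminf_finite[of "{..<N}"]) (auto simp: nz)
    then have nz': "norm z = sqrt ?\<Sigma>" by (metis norm_ge_zero real_sqrt_pow2_iff real_sqrt_unique)
    have "inner (blinfun_apply T z) y = ?\<Sigma>"
    proof -
      have "cinner (blinfun_apply T z) y = (\<Sum>k<N. s y k * cnj (s y k))"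
        unfolding z_def blinfun_sum_scaleC[OF T] cinner_sum_left cinner_scaleC_left s_def
        by (intro sum.cong refl) (metis cinner_commute)
      also have "\<dots> = complex_of_real ?\<Sigma>" by (simp add: complex_norm_square[symmetric])
      finally show ?thesis by (simp add: inner_eq_Re_cinner)
    qed
    then have "?\<Sigma> \<le> norm (blinfun_apply T z) * norm y"
      using norm_cauchy_schwarz[of "blinfun_apply T z" y] by simp
    also have "\<dots> \<le> norm T * sqrt ?\<Sigma> * norm y"
      using norm_blinfun[of T z] nz' by (intro mult_right_mono) auto
    finally have le: "?\<Sigma> \<le> (norm T * norm y) * sqrt ?\<Sigma>" by (simp add: mult_ac)
    have pos: "?\<Sigma> \<ge> 0" by (intro sum_nonneg) simp
    have "sqrt ?\<Sigma> \<le> norm T * norm y"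
    proof (cases "?\<Sigma> = 0")
      case False
      then have "sqrt ?\<Sigma> > 0" using pos by simp
      moreover have "sqrt ?\<Sigma> * sqrt ?\<Sigma> \<le> (norm T * norm y) * sqrt ?\<Sigma>" using le pos by simp
      ultimately show ?thesis by (rule mult_right_le_imp_le[rotated])
    qed simp
    then have "(sqrt ?\<Sigma>)\<^sup>2 \<le> (norm T * norm y)\<^sup>2" using pos by (intro power_mono) auto
    then show ?thesis using pos by simp
  qed
  have summ: "summable (\<lambda>k. (cmod (s y k))\<^sup>2)" for y
    using partial by (intro summableI_nonneg_bounded[where x="(norm T * norm y)\<^sup>2"]) auto
  define S where "S y = Abs_ell2 (s y)" for y
  have nth: "ell2_nth (S y) = s y" for y unfolding S_def by (rule ell2_nth_Abs[OF summ])
  have bl: "bounded_linear S"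
  proof (rule bounded_linear_intro)
    show "S (x + y) = S x + S y" for x y
      by (intro ell2_eqI) (simp add: nth s_def cinner_add_left)
    show "S (scaleR r x) = scaleR r (S x)" for r x
      by (intro ell2_eqI) (simp add: nth s_def scaleC_of_real[symmetric] cinner_scaleC_left)
    show "norm (S y) \<le> norm y * norm T" for y
    proof (rule power2_le_imp_le)
      show "(norm (S y))\<^sup>2 \<le> (norm y * norm T)\<^sup>2"
        unfolding ell2_norm_sq nth
        using suminf_le_const[OF summ partial] by (simp add: mult.commute)
    qed simp
  qed
  have lin: "clinear_op (Blinfun S)"
    unfolding clinear_op_def bounded_linear_Blinfun_apply[OF bl]
    by (auto intro!: ell2_eqI simp: nth s_def cinner_scaleC_left)
  have "is_adjoint T (Blinfun S)"
    unfolding is_adjoint_def bounded_linear_Blinfun_apply[OF bl]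
  proof (intro allI)
    fix x y
    have "(\<lambda>N. cinner (blinfun_apply T (\<Sum>k<N. scaleC (ell2_nth x k) (ebasis k))) y)
        \<longlonglongrightarrow> cinner (blinfun_apply T x) y"
      by (intro cinner_tendsto_left blinfun.tendsto tendsto_const ell2_truncation_tendsto)
    moreover have "cinner (blinfun_apply T (\<Sum>k<N. scaleC (ell2_nth x k) (ebasis k))) y =
        (\<Sum>k<N. ell2_nth x k * cnj (ell2_nth (S y) k))" for N
      unfolding blinfun_sum_scaleC[OF T] cinner_sum_left cinner_scaleC_left nth s_def
      by (intro sum.cong refl) (metis cinner_commute)
    ultimately have "(\<lambda>k. ell2_nth x k * cnj (ell2_nth (S y) k)) sums cinner (blinfun_apply T x) y"
      by (simp add: sums_def)
    then show "cinner (blinfun_apply T x) y = cinner x (S y)"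
      unfolding cinner_ell2_def by (rule sums_unique)
  qed
  then show ?thesis using lin by blast
qed

lemma is_adjoint_sym: "is_adjoint T S \<Longrightarrow> is_adjoint S T"
  unfolding is_adjoint_def by (metis cinner_commute)

lemma is_adjoint_comp: "is_adjoint S S' \<Longrightarrow> is_adjoint T T' \<Longrightarrow> is_adjoint (S o\<^sub>L T) (T' o\<^sub>L S')"
  by (simp add: is_adjoint_def)

lemma is_adjoint_unique:
  assumes "is_adjoint T S" "is_adjoint T S'"
  shows "S = S'"
proof (rule blinfun_eqI)
  fix y
  let ?d = "blinfun_apply S y - blinfun_apply S' y"
  have "cinner x (blinfun_apply S y) = cinner x (blinfun_apply S' y)" for x
    using assms by (simp add: is_adjoint_def)
  then have "cinner ?d (blinfun_apply S y) = cinner ?d (blinfun_apply S' y)" by blast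
  then have "cinner (blinfun_apply S y) ?d = cinner (blinfun_apply S' y) ?d"
    by (metis cinner_commute)
  then have "cinner ?d ?d = 0" by (simp add: cinner_diff_left)
  then show "blinfun_apply S y = blinfun_apply S' y" by (simp add: cinner_self)
qed

section \<open>The von Neumann algebra generated by a selfadjoint operator\<close>

text \<open>The vector state at \<open>\<xi>\<close> is automatically normal on the abelian algebra \<open>{Y}''\<close>; it is faithful
  because \<open>\<xi>\<close> is cyclic for the commutant of \<open>Y\<close>.\<close>

lemma tracial_ncps_double_commutant:
  fixes Y :: "ell2 \<Rightarrow>\<^sub>L ell2"
  assumes lin: "clinear_op Y" and sa: "selfadjoint Y" and \<xi>: "norm \<xi> = 1"
    and cyclic: "\<And>k. \<exists>S\<in>commutant {Y}. blinfun_apply S \<xi> = ebasis k"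
  shows "tracial_ncps (commutant (commutant {Y})) (\<lambda>T. cinner (blinfun_apply T \<xi>) \<xi>)"
proof -
  let ?C = "commutant {Y}"
  let ?N = "commutant ?C"
  have YC: "Y \<in> ?C" using lin by (simp add: commutant_def)
  \<comment> \<open>\<open>Y\<close> lies in its own commutant, so the double commutant is contained
    in the commutant and is therefore abelian.\<close>
  have NC: "T \<in> ?C" if "T \<in> ?N" for T
    using that YC by (auto simp: commutant_def)
  have adj_commutant: "\<exists>S'\<in>commutant P. is_adjoint S S'"
    if S: "S \<in> commutant P" and P: "\<And>R. R \<in> P \<Longrightarrow> \<exists>R'\<in>P. is_adjoint R R'"
    for S :: "ell2 \<Rightarrow>\<^sub>L ell2" and P
  proof -
    obtain S' where S': "clinear_op S'" "is_adjoint S S'"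
      using ell2_adjoint_exists[OF commutant_clinear[OF S]] by blast
    have "S' o\<^sub>L R = R o\<^sub>L S'" if R: "R \<in> P" for R
    proof -
      obtain R' where R': "R' \<in> P" "is_adjoint R R'" using P[OF R] by blast
      have "is_adjoint (S o\<^sub>L R') (R o\<^sub>L S')" "is_adjoint (R' o\<^sub>L S) (S' o\<^sub>L R)"
        using is_adjoint_comp S'(2) is_adjoint_sym[OF R'(2)] by blast+
      moreover have "S o\<^sub>L R' = R' o\<^sub>L S" by (rule commutant_commute[OF S R'(1)])
      ultimately show ?thesis using is_adjoint_unique by metis
    qed
    then show ?thesis using S' commutantI by blast
  qed
  have adjC: "\<exists>R'\<in>?C. is_adjoint R R'" if "R \<in> ?C" for R
    by (rule adj_commutant[OF that]) (use sa in \<open>simp add: selfadjoint_def\<close>)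
  have adjN: "\<exists>R'\<in>?N. is_adjoint R R'" if "R \<in> ?N" for R
    by (rule adj_commutant[OF that adjC])
  have triple: "commutant ?N = ?C"
  proof
    show "?C \<subseteq> commutant ?N" by (auto simp: commutant_def)
    have "Y \<in> ?N" using lin by (auto simp: commutant_def)
    then show "commutant ?N \<subseteq> ?C" by (auto simp: commutant_def)
  qed
  have vna: "von_neumann_algebra ?N"
    unfolding von_neumann_algebra_def triple using adjN commutant_clinear by blast
  have pos: "cinner (blinfun_apply (S o\<^sub>L T) \<xi>) \<xi> =
      complex_of_real ((norm (blinfun_apply T \<xi>))\<^sup>2)" if "is_adjoint T S" for S T
    using is_adjoint_sym[OF that] by (simp add: is_adjoint_def cinner_self)
  show ?thesis
  proof
    show "von_neumann_algebra ?N" by (rule vna)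
    show "cinner (blinfun_apply id_blinfun \<xi>) \<xi> = 1" using \<xi> by (simp add: cinner_self)
    show "cinner (blinfun_apply (S o\<^sub>L T) \<xi>) \<xi> = cinner (blinfun_apply (T o\<^sub>L S) \<xi>) \<xi>"
      if "S \<in> ?N" "T \<in> ?N" for S T
      using commutant_commute[OF that(1) NC[OF that(2)]] by simp
    \<comment> \<open>The hypothesis says that \<open>T\<close> kills \<open>\<xi>\<close>. As
      \<open>T\<close> commutes with operators moving \<open>\<xi>\<close> to each basis vector, it
      kills these as well.\<close>
    show "T = 0" if T: "T \<in> ?N" and "is_adjoint T S" "cinner (blinfun_apply (S o\<^sub>L T) \<xi>) \<xi> = 0" for S T
    proof (rule ell2_op_eq_0I)
      show "clinear_op T" using T by (rule commutant_clinear)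
      fix k
      obtain R where R: "R \<in> ?C" "blinfun_apply R \<xi> = ebasis k" using cyclic by blast
      have "blinfun_apply T \<xi> = 0" using that pos[OF that(2)] by simp
      then have "blinfun_apply (R o\<^sub>L T) \<xi> = 0" by (simp add: blinfun.zero_right)
      then show "blinfun_apply T (ebasis k) = 0"
        using commutant_commute[OF T R(1)] R(2) by (metis blinfun_apply_blinfun_compose)
    qed
    \<comment> \<open>A directed supremum is pointwise on quadratic forms; normality of the vector
      state is the instance at \<open>\<xi>\<close>.\<close>
    show "normal_on ?N (\<lambda>T. cinner (blinfun_apply T \<xi>) \<xi>)"
      unfolding normal_on_def is_directed_sup_def by simp
    show "cinner (blinfun_apply (S o\<^sub>L T) \<xi>) \<xi> \<in> \<real>\<^sub>\<ge>\<^sub>0" if "is_adjoint T S" for S T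
      unfolding pos[OF that] by (simp only: nonneg_Reals_of_real_iff zero_le_power2)
  qed (simp_all add: blinfun.add_left cinner_add_left cinner_scaleC_left)
qed

section \<open>Jacobi operators\<close>

lemma commutant_minus: "T \<in> commutant {Y} \<Longrightarrow> clinear_op Y \<Longrightarrow> - T \<in> commutant {Y}"
  using commutant_scaleC[of T "{Y}" "-1"] by (simp add: scaleC_op_minus_one)

lemma jacobi_operator_exists:
  fixes a \<beta> :: "nat \<Rightarrow> real"
  assumes a: "\<And>k. \<bar>a k\<bar> \<le> K" and \<beta>: "\<And>k. \<bar>\<beta> k\<bar> \<le> K"
  shows "\<exists>Y :: ell2 \<Rightarrow>\<^sub>L ell2. clinear_op Y \<and> selfadjoint Y \<and>
    (\<forall>f k. ell2_nth (blinfun_apply Y f) k =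
      (if k = 0 then 0 else complex_of_real (\<beta> (k - 1)) * ell2_nth f (k - 1)) +
      complex_of_real (a k) * ell2_nth f k + complex_of_real (\<beta> k) * ell2_nth f (Suc k))"
proof -
  obtain A :: "ell2 \<Rightarrow>\<^sub>L ell2" where A: "clinear_op A"
    "\<And>f k. ell2_nth (blinfun_apply A f) k = complex_of_real (a k) * ell2_nth f k"
    using ell2_diag_exists[of a K] a by blast
  obtain B :: "ell2 \<Rightarrow>\<^sub>L ell2" where B: "clinear_op B"
    "\<And>f k. ell2_nth (blinfun_apply B f) k = complex_of_real (\<beta> k) * ell2_nth f k"
    using ell2_diag_exists[of \<beta> K] \<beta> by blast
  obtain S :: "ell2 \<Rightarrow>\<^sub>L ell2" where S: "clinear_op S"
    "\<And>f k. ell2_nth (blinfun_apply S f) k = (if k < 1 then 0 else ell2_nth f (k - 1))"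
    using ell2_shift_exists[of 1] by blast
  obtain T :: "ell2 \<Rightarrow>\<^sub>L ell2" where T: "clinear_op T"
    "\<And>f k. ell2_nth (blinfun_apply T f) k = ell2_nth f (Suc k)"
    using ell2_backward_shift_exists by blast
  \<comment> \<open>The outer summands are the lower and upper diagonals, adjoint to each other
    because the shift \<open>S\<close> has adjoint \<open>T\<close>.\<close>
  define Y where "Y = (S o\<^sub>L B) + A + (B o\<^sub>L T)"
  have AA: "is_adjoint A A" and BB: "is_adjoint B B"
    unfolding is_adjoint_def cinner_ell2_def by (simp_all add: A B mult_ac)
  have ST: "is_adjoint S T"
    unfolding is_adjoint_def cinner_ell2_def
  proof (intro allI)
    fix f g
    let ?h = "\<lambda>k. ell2_nth (blinfun_apply S f) k * cnj (ell2_nth g k)"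
    have "suminf ?h = (\<Sum>k. ?h (Suc k)) + ?h 0"
      using suminf_split_head[OF ell2_inner_summable[of "blinfun_apply S f" g]] by simp
    then show "suminf ?h = (\<Sum>k. ell2_nth f k * cnj (ell2_nth (blinfun_apply T g) k))"
      by (simp add: S T)
  qed
  have "is_adjoint (S o\<^sub>L B) (B o\<^sub>L T)" "is_adjoint (B o\<^sub>L T) (S o\<^sub>L B)"
    using is_adjoint_comp[OF ST BB] is_adjoint_sym by blast+
  then have "is_adjoint Y Y"
    using AA unfolding Y_def is_adjoint_def
    by (simp add: blinfun.add_left cinner_add_left cinner_add_right)
  moreover have "clinear_op Y"
    unfolding Y_def by (intro clinear_op_add clinear_op_comp A B S T)
  ultimately show ?thesis
    by (intro exI[of _ Y]) (auto simp: selfadjoint_def Y_def blinfun.add_left A B S T)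
qed

section \<open>Orthogonal polynomials of a moment functional\<close>

definition polyX :: "real poly" where "polyX = [:0, 1:]"

text \<open>This stands in for integration against a compactly supported probability measure:
  positivity on squares replaces the measure, and exponential growth of the moments its compact
  support.\<close>

locale moment_functional =
  fixes L :: "real poly \<Rightarrow> real" and K R :: real
  assumes L_add: "L (p + q) = L p + L q"
    and L_smult: "L (Polynomial.smult c p) = c * L p"
    and L_pos: "L (p * p) \<ge> 0"
    and L_one: "L 1 = 1"
    and L_bound: "\<bar>L (polyX ^ k)\<bar> \<le> K * R ^ k"
    and R_pos: "R > 0"
begin

lemma L_minus: "L (- p) = - L p"
  using L_smult[of "-1" p] by simp

lemma L_diff: "L (p - q) = L p - L q"
  using L_add[of p "- q"] by (simp add: L_minus)

lemma L_zero: "L 0 = 0"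
  using L_smult[of 0 0] by simp

lemma L_Cauchy_Schwarz: "(L (p * q))\<^sup>2 \<le> L (p * p) * L (q * q)"
proof (cases "L (q * q) = 0")
  case True
  have "L (p * q) = 0"
  proof (rule ccontr)
    assume nz: "L (p * q) \<noteq> 0"
    \<comment> \<open>For this \<open>t\<close> the value of \<open>L\<close> on the square of
      \<open>p - t q\<close> would be -1.\<close>
    define t where "t = (L (p * p) + 1) / (2 * L (p * q))"
    have "(p - Polynomial.smult t q) * (p - Polynomial.smult t q) =
        p * p - Polynomial.smult (2 * t) (p * q) + Polynomial.smult (t * t) (q * q)"
      by (simp add: algebra_simps smult_add_left[of t t, symmetric])
    then have "0 \<le> L (p * p) - 2 * t * L (p * q)"
      using L_pos[of "p - Polynomial.smult t q"] True by (simp add: L_add L_diff L_smult)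
    also have "2 * t * L (p * q) = L (p * p) + 1" using nz by (simp add: t_def)
    finally show False by simp
  qed
  then show ?thesis using True by simp
next
  case False
  define u where "u = L (q * q)"
  define v where "v = L (p * q)"
  have u: "u > 0" using False L_pos[of q] by (simp add: u_def)
  have "(Polynomial.smult u p - Polynomial.smult v q) * (Polynomial.smult u p - Polynomial.smult v q) =
      Polynomial.smult (u * u) (p * p) - Polynomial.smult (2 * u * v) (p * q) + Polynomial.smult (v * v) (q * q)"
    by (simp add: algebra_simps smult_add_left[of "u * v" "u * v", symmetric])
  then have "0 \<le> u * u * L (p * p) - 2 * u * v * v + v * v * u"
    using L_pos[of "Polynomial.smult u p - Polynomial.smult v q"] by (simp add: L_add L_diff L_smult u_def v_def)
  also have "\<dots> = u * (L (p * p) * u - v\<^sup>2)" by (simp add: algebra_simps power2_eq_square)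
  finally show ?thesis using u by (simp add: u_def v_def zero_le_mult_iff)
qed

lemma L_null: "L (p * p) = 0 \<Longrightarrow> L (p * q) = 0"
  using L_Cauchy_Schwarz[of p q] by simp

text \<open>A fixed polynomial factor changes the constant but not the rate \<open>R\<close>, so
  every unit vector meets the same rate.\<close>

lemma L_poly_growth: "\<exists>K'. \<forall>j. \<bar>L (polyX ^ j * p)\<bar> \<le> K' * R ^ j"
proof (induction p)
  case 0
  then show ?case by (intro exI[of _ 0]) (simp add: L_zero)
next
  case (pCons c p)
  then obtain K' where K': "\<And>j. \<bar>L (polyX ^ j * p)\<bar> \<le> K' * R ^ j" by blast
  have "pCons c p = Polynomial.smult c 1 + polyX * p" by (simp add: polyX_def one_pCons)
  then have "polyX ^ j * pCons c p = Polynomial.smult c (polyX ^ j) + polyX ^ Suc j * p" for j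
    by (simp add: algebra_simps)
  then have "L (polyX ^ j * pCons c p) = c * L (polyX ^ j) + L (polyX ^ Suc j * p)" for j
    by (simp add: L_add L_smult)
  then have s1: "\<bar>L (polyX ^ j * pCons c p)\<bar> \<le> \<bar>c\<bar> * \<bar>L (polyX ^ j)\<bar> + \<bar>L (polyX ^ Suc j * p)\<bar>" for j
    by (metis abs_mult abs_triangle_ineq)
  have s2: "\<bar>c\<bar> * \<bar>L (polyX ^ j)\<bar> + \<bar>L (polyX ^ Suc j * p)\<bar> \<le>
      \<bar>c\<bar> * (K * R ^ j) + K' * R ^ Suc j" for j
    by (intro add_mono mult_left_mono L_bound K') simp
  have s3: "\<bar>c\<bar> * (K * R ^ j) + K' * R ^ Suc j = (\<bar>c\<bar> * K + K' * R) * R ^ j" for j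
    by (simp add: algebra_simps)
  have "\<bar>L (polyX ^ j * pCons c p)\<bar> \<le> (\<bar>c\<bar> * K + K' * R) * R ^ j" for j
    using order_trans[OF s1 s2] unfolding s3 .
  then show ?case by blast
qed

text \<open>Multiplication by the variable is bounded: by Cauchy-Schwarz the even moments \<open>t j\<close> of a
  unit vector satisfy \<open>(t j)\<^sup>2 \<le> t (2 * j)\<close>, and they grow at most like \<open>R ^ (2 * j)\<close>.\<close>

lemma L_mult_var_le:
  assumes q: "L (q * q) = 1"
  shows "L (polyX * q * (polyX * q)) \<le> R\<^sup>2"
proof (rule ccontr)
  define t where "t j = L (polyX ^ (2 * j) * (q * q))" for j
  assume "\<not> ?thesis"
  then have t1: "t 1 > R\<^sup>2" by (simp add: t_def power2_eq_square mult_ac)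
  have sq: "(t j)\<^sup>2 \<le> t (2 * j)" for j
  proof -
    have c: "(L ((polyX ^ (2 * j) * q) * q))\<^sup>2 \<le> L ((polyX ^ (2 * j) * q) * (polyX ^ (2 * j) * q)) * 1"
      using L_Cauchy_Schwarz[of "polyX ^ (2 * j) * q" q] q by simp
    have e1: "(polyX ^ (2 * j) * q) * q = polyX ^ (2 * j) * (q * q)" by (rule mult.assoc)
    have e2: "(polyX ^ (2 * j) * q) * (polyX ^ (2 * j) * q) = polyX ^ (2 * (2 * j)) * (q * q)"
    proof -
      have "polyX ^ (2 * (2 * j)) = polyX ^ (2 * j) * polyX ^ (2 * j)"
        by (metis mult_2 power_add)
      then show ?thesis by (simp only: mult_ac)
    qed
    show ?thesis using c unfolding e1 e2 t_def by simp
  qed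
  have t1pos: "t 1 \<ge> 0" using t1 by (meson less_eq_real_def order_trans zero_le_power2)
  have pow: "t 1 ^ (2 ^ i) \<le> t (2 ^ i)" for i
  proof (induction i)
    case (Suc i)
    have "t 1 ^ (2 ^ Suc i) = (t 1 ^ (2 ^ i))\<^sup>2" by (simp add: power_mult[symmetric] mult.commute)
    also have "\<dots> \<le> (t (2 ^ i))\<^sup>2" using Suc t1pos by (intro power_mono) auto
    also have "\<dots> \<le> t (2 ^ Suc i)" using sq[of "2 ^ i"] by simp
    finally show ?case .
  qed simp
  obtain K' where K': "\<And>j. \<bar>L (polyX ^ j * (q * q))\<bar> \<le> K' * R ^ j" using L_poly_growth by blast
  \<comment> \<open>Iterated doubling from \<open>t 1\<close> gives
    \<open>y ^ (2 ^ i) \<le> K'\<close> for all \<open>i\<close>, which is impossible for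
    \<open>y > 1\<close>.\<close>
  define y where "y = t 1 / R\<^sup>2"
  have y: "y > 1" using t1 R_pos by (simp add: y_def)
  have "y ^ (2 ^ i) \<le> K'" for i
  proof -
    have "t 1 ^ (2 ^ i) \<le> K' * R ^ (2 * 2 ^ i)"
      using pow[of i] K'[of "2 * 2 ^ i"] by (simp add: t_def)
    then show ?thesis using R_pos by (simp add: y_def power_divide power_mult divide_le_eq)
  qed
  moreover have "y ^ i \<le> y ^ (2 ^ i)" for i
    using y by (intro power_increasing) (auto simp: less_imp_le)
  ultimately have "y ^ i \<le> K'" for i by (meson order_trans)
  then show False using real_arch_pow[OF y, of K'] by (meson not_le)
qed

text \<open>Orthonormalisation restarts at the constant polynomial 1 when it meets a null vector. The
  functional then has finite support, and the coefficients become periodic.\<close>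

definition rem :: "real poly \<times> real poly \<Rightarrow> real poly" where
  "rem z = polyX * fst z - Polynomial.smult (L (polyX * fst z * fst z)) (fst z) - snd z"

text \<open>The second component is the previous polynomial times its coefficient. A restart sets it
  to 0, which is also the value for a vanishing coefficient, so \<open>r_Suc\<close> has no
  exception.\<close>

definition step :: "real poly \<times> real poly \<Rightarrow> real poly \<times> real poly" where
  "step z = (let \<beta> = sqrt (L (rem z * rem z)) in
    if \<beta> = 0 then (1, 0) else (Polynomial.smult (1 / \<beta>) (rem z), Polynomial.smult \<beta> (fst z)))"

primrec st :: "nat \<Rightarrow> real poly \<times> real poly" where
  "st 0 = (1, 0)"
| "st (Suc k) = step (st k)"

definition "q k = fst (st k)"
definition "r k = snd (st k)"
definition "a k = L (polyX * q k * q k)"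
definition "\<beta> k = sqrt (L (rem (st k) * rem (st k)))"

lemma q_0 [simp]: "q 0 = 1" and r_0 [simp]: "r 0 = 0"
  by (simp_all add: q_def r_def)

lemma rem_st: "rem (st k) = polyX * q k - Polynomial.smult (a k) (q k) - r k"
  by (simp add: rem_def q_def r_def a_def)

lemma q_Suc: "q (Suc k) = (if \<beta> k = 0 then 1 else Polynomial.smult (1 / \<beta> k) (rem (st k)))"
  by (simp add: q_def \<beta>_def step_def Let_def)

lemma r_Suc: "r (Suc k) = Polynomial.smult (\<beta> k) (q k)"
  by (simp add: q_def r_def \<beta>_def step_def Let_def)

lemma \<beta>_sq: "L (rem (st k) * rem (st k)) = \<beta> k * \<beta> k"
  by (simp add: \<beta>_def L_pos)

lemma L_rem: "L (rem (st k) * f) = L (polyX * q k * f) - a k * L (q k * f) - L (r k * f)"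
  by (simp add: rem_st left_diff_distrib L_diff L_smult)

text \<open>At a restart the remainder is a null vector, which \<open>L\<close> annihilates against
  every \<open>f\<close>. The identity thus survives although \<open>q (Suc k)\<close> is then
  unrelated to the remainder.\<close>

lemma L_rem_eq: "L (rem (st k) * f) = \<beta> k * L (q (Suc k) * f)"
proof (cases "\<beta> k = 0")
  case True
  then show ?thesis using \<beta>_sq[of k] by (simp add: L_null)
next
  case False
  then show ?thesis by (simp add: q_Suc L_smult)
qed

text \<open>As an identity of polynomials the recurrence can fail at a restart; paired with an
  arbitrary \<open>f\<close> under \<open>L\<close> it holds for every \<open>k\<close>.\<close>

lemma three_term:
  "L (polyX * q k * f) = \<beta> k * L (q (Suc k) * f) + a k * L (q k * f) +
    (if k = 0 then 0 else \<beta> (k - 1) * L (q (k - 1) * f))"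
proof -
  have "L (r k * f) = (if k = 0 then 0 else \<beta> (k - 1) * L (q (k - 1) * f))"
    by (cases k) (simp_all add: L_zero r_Suc L_smult)
  then show ?thesis using L_rem[of k f] L_rem_eq[of k f] by simp
qed

lemma L_q_q: "L (q k * q k) = 1"
proof (cases k)
  case 0
  then show ?thesis by (simp add: L_one)
next
  case (Suc j)
  then show ?thesis using \<beta>_sq[of j] by (simp add: q_Suc L_smult L_one)
qed

lemma L_r_q: "L (r k * q k) = 0"
proof (induction k)
  case 0
  then show ?case by (simp add: L_zero)
next
  case (Suc k)
  have "L (rem (st k) * q k) = 0" using Suc by (simp add: L_rem a_def L_q_q)
  then show ?case using L_rem_eq[of k "q k"] by (simp add: r_Suc L_smult mult.commute)
qed

lemma L_rem_q: "L (rem (st k) * q k) = 0"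
  by (simp add: L_rem a_def L_q_q L_r_q)

text \<open>This makes the remainder orthogonal to \<open>r k\<close>. Its square norm then equals
  its pairing with \<open>polyX * q k\<close>, and Cauchy-Schwarz yields
  \<open>\<beta>_bound\<close>.\<close>

lemma L_Xq_r: "L (polyX * q k * r k) = L (r k * r k)"
proof (induction k)
  case 0
  then show ?case by (simp add: L_zero)
next
  case (Suc k)
  have "L (rem (st k) * r k) = 0"
    using Suc by (simp add: L_rem L_r_q mult.commute[of "q k"])
  then have "L (rem (st k) * rem (st k)) = L (rem (st k) * (polyX * q k))"
    using L_rem_q[of k]
    by (subst (2) rem_st) (simp add: right_diff_distrib L_diff L_smult)
  also have "\<dots> = \<beta> k * L (q (Suc k) * (polyX * q k))" by (rule L_rem_eq)
  finally have "\<beta> k * \<beta> k = \<beta> k * L (polyX * q (Suc k) * q k)"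
    by (simp add: \<beta>_sq mult_ac)
  then show ?case by (auto simp: r_Suc L_smult L_q_q)
qed

lemma a_bound: "\<bar>a k\<bar> \<le> R"
proof -
  have "(a k)\<^sup>2 \<le> L (polyX * q k * (polyX * q k)) * 1"
    using L_Cauchy_Schwarz[of "polyX * q k" "q k"] by (simp add: a_def L_q_q)
  also have "\<dots> \<le> R\<^sup>2" using L_mult_var_le[OF L_q_q] by simp
  finally show ?thesis using R_pos by (simp add: abs_le_square_iff[symmetric])
qed

lemma \<beta>_bound: "\<bar>\<beta> k\<bar> \<le> R"
proof -
  let ?P = "rem (st k)"
  have Pr: "L (?P * r k) = 0"
    by (simp add: L_rem L_r_q L_Xq_r mult.commute[of "q k"])
  have "L (?P * ?P) = L (?P * (polyX * q k))"
    using L_rem_q[of k] Pr by (subst (2) rem_st) (simp add: right_diff_distrib L_diff L_smult)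
  then have "(L (?P * ?P))\<^sup>2 \<le> L (?P * ?P) * L (polyX * q k * (polyX * q k))"
    using L_Cauchy_Schwarz[of ?P "polyX * q k"] by simp
  also have "\<dots> \<le> L (?P * ?P) * R\<^sup>2"
    using L_mult_var_le[OF L_q_q] L_pos by (intro mult_left_mono) auto
  finally have le: "(\<beta> k)\<^sup>2 * (\<beta> k)\<^sup>2 \<le> (\<beta> k)\<^sup>2 * R\<^sup>2" by (simp add: \<beta>_sq power2_eq_square)
  have "(\<beta> k)\<^sup>2 \<le> R\<^sup>2"
  proof (cases "\<beta> k = 0")
    case False
    then have "(\<beta> k)\<^sup>2 > 0" by simp
    show ?thesis by (rule mult_left_le_imp_le[OF le \<open>(\<beta> k)\<^sup>2 > 0\<close>])
  qed simp
  then show ?thesis using R_pos by (simp add: abs_le_square_iff[symmetric])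
qed

section \<open>Orthonormality up to the first vanishing coefficient, periodicity, and
  realisation\<close>

definition regular :: "nat \<Rightarrow> bool" where
  "regular k \<longleftrightarrow> (\<forall>j<k. \<beta> j \<noteq> 0)"

lemma regular_0 [simp]: "regular 0"
  by (simp add: regular_def)

lemma regular_Suc: "regular (Suc k) \<longleftrightarrow> regular k \<and> \<beta> k \<noteq> 0"
  by (auto simp: regular_def less_Suc_eq)

text \<open>Multiplication by the variable is symmetric for \<open>L\<close>. Pairing
  \<open>polyX * q k\<close> with an earlier \<open>q j\<close> can therefore be evaluated by the
  recurrence at \<open>j\<close>, where only the neighbour \<open>j = k - 1\<close>
  survives.\<close>

lemma orthonormal:
  "regular k \<Longrightarrow> i \<le> k \<Longrightarrow> j \<le> k \<Longrightarrow> L (q i * q j) = (if i = j then 1 else 0)"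
proof (induction k arbitrary: i j)
  case 0
  then show ?case by (simp add: L_one)
next
  case (Suc k)
  have reg: "regular k" and nz: "\<beta> k \<noteq> 0" using Suc.prems(1) by (simp_all add: regular_Suc)
  note IH = Suc.IH[OF reg]
  have new: "L (q (Suc k) * q j) = 0" if j: "j \<le> k" for j
  proof -
    have "L (polyX * q k * q j) = a k * L (q k * q j) +
        (if k = 0 then 0 else \<beta> (k - 1) * L (q (k - 1) * q j))"
    proof (cases "j = k")
      case True
      then show ?thesis using IH[of "k - 1" k] by (cases k) (simp_all add: a_def L_q_q)
    next
      case False
      then have jk: "j < k" using j by simp
      have "L (polyX * q k * q j) = L (polyX * q j * q k)" by (simp add: mult_ac)
      also have "\<dots> = \<beta> j * L (q (Suc j) * q k) + a j * L (q j * q k) +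
          (if j = 0 then 0 else \<beta> (j - 1) * L (q (j - 1) * q k))"
        by (rule three_term)
      also have "\<dots> = (if Suc j = k then \<beta> j else 0)"
        using jk IH[of "Suc j" k] IH[of j k] IH[of "j - 1" k] by auto
      also have "\<dots> = a k * L (q k * q j) + (if k = 0 then 0 else \<beta> (k - 1) * L (q (k - 1) * q j))"
        using jk IH[of k j] IH[of "k - 1" j] by auto
      finally show ?thesis .
    qed
    then have "\<beta> k * L (q (Suc k) * q j) = 0" using three_term[of k "q j"] by simp
    then show ?thesis using nz by simp
  qed
  show ?case
  proof (cases "i = Suc k")
    case True
    then show ?thesis using new[of j] L_q_q[of "Suc k"] Suc.prems(3) by (cases "j = Suc k") auto
  next
    case False
    then have i: "i \<le> k" using Suc.prems by simp
    show ?thesis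
    proof (cases "j = Suc k")
      case True
      then show ?thesis using new[OF i] i by (simp add: mult.commute)
    next
      case False
      then show ?thesis using IH[OF i] Suc.prems by simp
    qed
  qed
qed

lemma periodic:
  assumes "st d = (1, 0)"
  shows "st (k + d) = st k"
  using assms by (induction k) simp_all

lemma realisation:
  "\<exists>(N :: (ell2 \<Rightarrow>\<^sub>L ell2) set) \<sigma> Y. tracial_ncps N \<sigma> \<and> Y \<in> N \<and> selfadjoint Y \<and>
    (\<forall>m. moment \<sigma> m Y = complex_of_real (L (polyX ^ m)))"
proof -
  obtain Y :: "ell2 \<Rightarrow>\<^sub>L ell2" where lin: "clinear_op Y" and sa: "selfadjoint Y" and
    Y: "\<And>f k. ell2_nth (blinfun_apply Y f) k =
      (if k = 0 then 0 else complex_of_real (\<beta> (k - 1)) * ell2_nth f (k - 1)) +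
      complex_of_real (a k) * ell2_nth f k + complex_of_real (\<beta> k) * ell2_nth f (Suc k)"
    using jacobi_operator_exists[of a R \<beta>] a_bound \<beta>_bound by blast
  let ?C = "commutant {Y}"
  have YC: "Y \<in> ?C" using lin by (simp add: commutant_def)
  have comm_scaleC: "scaleC_op c S \<in> ?C" if "S \<in> ?C" for S c
    by (rule commutant_scaleC[OF that]) (use lin in simp)
  have comm_minus: "- S \<in> ?C" if "S \<in> ?C" for S
    by (rule commutant_minus[OF that lin])
  have Y_basis: "blinfun_apply Y (ebasis k) =
      (if k = 0 then 0 else scaleR (\<beta> (k - 1)) (ebasis (k - 1))) +
      scaleR (a k) (ebasis k) + scaleR (\<beta> k) (ebasis (Suc k))" for k
  proof (rule ell2_eqI)
    fix j
    show "ell2_nth (blinfun_apply Y (ebasis k)) j = ell2_nth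
      ((if k = 0 then 0 else scaleR (\<beta> (k - 1)) (ebasis (k - 1))) +
      scaleR (a k) (ebasis k) + scaleR (\<beta> k) (ebasis (Suc k))) j"
      by (cases k; cases j) (auto simp: Y)
  qed
  have regular_cyclic: "regular k \<Longrightarrow> \<exists>S\<in>?C. blinfun_apply S (ebasis 0) = ebasis k" for k
  proof (induction k rule: less_induct)
    case (less k)
    show ?case
    proof (cases k)
      case 0
      then show ?thesis by (intro bexI[of _ id_blinfun]) (simp_all add: commutant_id)
    next
      case (Suc j)
      have reg: "regular j" "\<beta> j \<noteq> 0" using less.prems Suc by (simp_all add: regular_Suc)
      obtain S where S: "S \<in> ?C" "blinfun_apply S (ebasis 0) = ebasis j"
        using less.IH[of j] Suc reg by auto
      have "\<exists>T\<in>?C. blinfun_apply T (ebasis 0) =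
          (if j = 0 then 0 else scaleR (\<beta> (j - 1)) (ebasis (j - 1)))"
      proof (cases j)
        case 0
        have "scaleC_op 0 id_blinfun \<in> ?C" by (intro comm_scaleC commutant_id)
        then show ?thesis using 0 by (intro bexI[of _ "scaleC_op 0 id_blinfun"]) simp_all
      next
        case (Suc i)
        have "regular i" using reg Suc by (simp add: regular_Suc)
        then obtain T where T: "T \<in> ?C" "blinfun_apply T (ebasis 0) = ebasis i"
          using less.IH[of i] Suc \<open>k = Suc j\<close> by auto
        have "scaleC_op (complex_of_real (\<beta> i)) T \<in> ?C" by (intro comm_scaleC T)
        then show ?thesis
          using Suc T by (intro bexI[of _ "scaleC_op (complex_of_real (\<beta> i)) T"]) (simp_all add: scaleC_of_real)
      qed
      then obtain T where T: "T \<in> ?C" "blinfun_apply T (ebasis 0) =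
          (if j = 0 then 0 else scaleR (\<beta> (j - 1)) (ebasis (j - 1)))" by blast
      \<comment> \<open>The recurrence for \<open>Y\<close> on basis vectors, solved for the vector
        of index \<open>Suc j\<close>.\<close>
      define U where "U = scaleC_op (complex_of_real (1 / \<beta> j))
        ((Y o\<^sub>L S) + (- T + scaleC_op (complex_of_real (- a j)) S))"
      have "U \<in> ?C" unfolding U_def by (intro comm_scaleC comm_minus commutant_add commutant_comp YC S T)
      moreover have "blinfun_apply U (ebasis 0) = scaleR (1 / \<beta> j) (blinfun_apply Y (ebasis j) +
          (- (if j = 0 then 0 else scaleR (\<beta> (j - 1)) (ebasis (j - 1))) + scaleR (- a j) (ebasis j)))"
        unfolding U_def by (simp only: scaleC_op_apply blinfun.add_left blinfun.minus_left
            blinfun_apply_blinfun_compose S T scaleC_of_real)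
      then have "blinfun_apply U (ebasis 0) = ebasis k"
        unfolding Y_basis using reg(2) Suc by simp
      ultimately show ?thesis by blast
    qed
  qed
  have cyclic: "\<exists>S\<in>?C. blinfun_apply S (ebasis 0) = ebasis k" for k
  proof (cases "\<forall>j. \<beta> j \<noteq> 0")
    case True
    then show ?thesis by (intro regular_cyclic) (simp add: regular_def)
  next
    case False
    define e where "e = (LEAST j. \<beta> j = 0)"
    \<comment> \<open>\<open>\<beta> e\<close> couples the coordinates \<open>e\<close> and
      \<open>Suc e\<close>, so its vanishing ends a block of length \<open>Suc e\<close>.\<close>
    define d where "d = Suc e"
    have \<beta>e: "\<beta> e = 0" unfolding e_def by (rule LeastI_ex[of "\<lambda>j. \<beta> j = 0"]) (use False in simp)
    have reg: "regular k" if "k < d" for k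
      unfolding regular_def
    proof (intro allI impI)
      fix j assume "j < k"
      then have "j < (LEAST j. \<beta> j = 0)" using that by (simp add: d_def e_def)
      then show "\<beta> j \<noteq> 0" by (rule not_less_Least)
    qed
    have std: "st d = (1, 0)"
    proof -
      have "st d = (q d, r d)" unfolding q_def r_def by (rule prod.collapse[symmetric])
      also have "\<dots> = (1, 0)" unfolding d_def by (simp add: q_Suc r_Suc \<beta>e)
      finally show ?thesis .
    qed
    have per: "a (k + d) = a k" "\<beta> (k + d) = \<beta> k" for k
      unfolding a_def \<beta>_def q_def periodic[OF std] by (rule refl)+
    obtain S :: "ell2 \<Rightarrow>\<^sub>L ell2" where S: "clinear_op S"
      "\<And>f k. ell2_nth (blinfun_apply S f) k = (if k < d then 0 else ell2_nth f (k - d))"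
      using ell2_shift_exists[of d] by blast
    have "S o\<^sub>L Y = Y o\<^sub>L S"
    proof (intro blinfun_eqI ell2_eqI)
      fix f k
      \<comment> \<open>The seam is at \<open>k = e\<close>, where \<open>Y\<close> would bring in
        the first entry of the shifted sequence were it not for \<open>\<beta> e = 0\<close>; from
        \<open>d\<close> on the coefficients repeat.\<close>
      consider "k < e" | "k = e" | "k = d" | "Suc d \<le> k" unfolding d_def by linarith
      then show "ell2_nth (blinfun_apply (S o\<^sub>L Y) f) k = ell2_nth (blinfun_apply (Y o\<^sub>L S) f) k"
      proof cases
        case 1
        then have "k < d" "Suc k < d" "k - 1 < d" by (simp_all add: d_def)
        then show ?thesis by (simp add: S Y)
      next
        case 2
        then have "k < d" "k - 1 < d" by (simp_all add: d_def)
        then show ?thesis using 2 \<beta>e by (simp add: S Y)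
      next
        case 3 then show ?thesis using per[of 0] \<beta>e by (simp add: S Y d_def)
      next
        case 4
        define i where "i = k - Suc d"
        have "k = Suc i + d" using 4 by (simp add: i_def)
        moreover have "a (Suc (i + d)) = a (Suc i)" "\<beta> (Suc (i + d)) = \<beta> (Suc i)" "\<beta> (i + d) = \<beta> i"
          using per[of "Suc i"] per[of i] by simp_all
        ultimately show ?thesis by (simp add: S Y)
      qed
    qed
    then have SC: "S \<in> ?C" by (intro commutantI S(1)) blast
    show ?thesis
    proof (induction k rule: less_induct)
      case (less k)
      show ?case
      proof (cases "k < d")
        case True
        then show ?thesis using regular_cyclic reg by blast
      next
        case False
        then obtain T where T: "T \<in> ?C" "blinfun_apply T (ebasis 0) = ebasis (k - d)"
          using less.IH[of "k - d"] by (auto simp: d_def)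
        have "blinfun_apply S (ebasis (k - d)) = ebasis k"
          using False by (intro ell2_eqI) (auto simp: S)
        then show ?thesis
          using T commutant_comp[OF SC T(1)] by (intro bexI[of _ "S o\<^sub>L T"]) simp_all
      qed
    qed
  qed
  have norm_e0: "norm (ebasis 0) = 1"
  proof -
    have "complex_of_real ((norm (ebasis 0))\<^sup>2) = 1"
      unfolding cinner_self[symmetric] cinner_ebasis_right by simp
    then have "(norm (ebasis 0))\<^sup>2 = 1" using of_real_eq_1_iff by blast
    then show ?thesis by (simp add: power2_eq_1_iff) (smt (verit) norm_ge_zero)
  qed
  let ?N = "commutant ?C"
  let ?\<sigma> = "\<lambda>T. cinner (blinfun_apply T (ebasis 0)) (ebasis 0)"
  have "tracial_ncps ?N ?\<sigma>"
    by (rule tracial_ncps_double_commutant[OF lin sa norm_e0 cyclic])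
  moreover have "Y \<in> ?N" using lin by (auto simp: commutant_def)
  moreover have "moment ?\<sigma> m Y = complex_of_real (L (polyX ^ m))" for m
  proof -
    \<comment> \<open>Applied to the first basis vector, powers of \<open>Y\<close> stay in the
      first block, with coordinates given by pairing \<open>polyX ^ m\<close> with the orthonormal
      polynomials. Coordinate 0 is the moment, as \<open>q 0 = 1\<close>.\<close>
    have "ell2_nth (blinfun_apply (op_prod (replicate m Y)) (ebasis 0)) k =
        (if regular k then complex_of_real (L (polyX ^ m * q k)) else 0)" for k
    proof (induction m arbitrary: k)
      case 0
      then show ?case using orthonormal[of k k 0] by (cases "k = 0") (auto simp: L_one)
    next
      case (Suc m)
      let ?v = "\<lambda>k. if regular k then complex_of_real (L (polyX ^ m * q k)) else 0"
      have "ell2_nth (blinfun_apply (op_prod (replicate (Suc m) Y)) (ebasis 0)) k =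
          (if k = 0 then 0 else complex_of_real (\<beta> (k - 1)) * ?v (k - 1)) +
          complex_of_real (a k) * ?v k + complex_of_real (\<beta> k) * ?v (Suc k)"
        by (simp add: Y Suc.IH)
      also have "\<dots> = (if regular k then complex_of_real (L (polyX ^ Suc m * q k)) else 0)"
      proof (cases "regular k")
        case True
        have v_Suc: "complex_of_real (\<beta> k) * ?v (Suc k) =
            complex_of_real (\<beta> k * L (q (Suc k) * polyX ^ m))"
          using True by (simp add: regular_Suc mult.commute)
        have v_pred: "(if k = 0 then 0 else complex_of_real (\<beta> (k - 1)) * ?v (k - 1)) =
            complex_of_real (if k = 0 then 0 else \<beta> (k - 1) * L (q (k - 1) * polyX ^ m))"
          using True by (cases k) (simp_all add: regular_Suc mult.commute)
        have "polyX ^ Suc m * q k = polyX * q k * polyX ^ m" by (simp add: mult_ac)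
        then have L: "L (polyX ^ Suc m * q k) = \<beta> k * L (q (Suc k) * polyX ^ m) +
            a k * L (q k * polyX ^ m) + (if k = 0 then 0 else \<beta> (k - 1) * L (q (k - 1) * polyX ^ m))"
          by (simp only: three_term[of k "polyX ^ m"])
        have v_k: "complex_of_real (a k) * complex_of_real (L (polyX ^ m * q k)) =
            complex_of_real (a k * L (q k * polyX ^ m))"
          by (simp add: mult.commute)
        show ?thesis
          unfolding v_Suc v_pred v_k L if_P[OF True] of_real_add[symmetric] by (simp only: add_ac)
      next
        case False
        \<comment> \<open>The predecessor of an irregular index is irregular itself or coupled to it
          by a zero coefficient.\<close>
        then show ?thesis by (cases k) (auto simp: regular_Suc)
      qed
      finally show ?case .
    qed
    from this[of 0] show ?thesis by (simp add: moment_def cinner_ebasis_right)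
  qed
  ultimately show ?thesis using sa by blast
qed

end

section \<open>Convergence of quadratic forms\<close>

lemma cinner_sum_right: "cinner x (\<Sum>i\<in>I. f i) = (\<Sum>i\<in>I. cinner (x::'h::complex_hilbert) (f i))"
proof (induction I rule: infinite_finite_induct)
  case empty
  have "cinner x 0 = cnj (cinner 0 x)" by (rule cinner_commute)
  then show ?case by simp
next
  case (infinite I)
  have "cinner x 0 = cnj (cinner 0 x)" by (rule cinner_commute)
  then show ?case using infinite by simp
qed (simp_all add: cinner_add_right)

lemma is_adjoint_sum:
  "(\<And>i. i \<in> I \<Longrightarrow> is_adjoint (F i) (G i)) \<Longrightarrow> is_adjoint (\<Sum>i\<in>I. F i) (\<Sum>i\<in>I. G i)"
  by (simp add: is_adjoint_def blinfun.sum_left cinner_sum_left cinner_sum_right)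

lemma is_adjoint_scaleC: "is_adjoint T S \<Longrightarrow> is_adjoint (scaleC_op c T) (scaleC_op (cnj c) S)"
  by (simp add: is_adjoint_def cinner_scaleC_left cinner_scaleC_right)

lemma is_adjoint_power:
  assumes "selfadjoint Q"
  shows "is_adjoint (op_prod (replicate i Q)) (op_prod (replicate i Q))"
proof (induction i)
  case 0
  then show ?case by (simp add: is_adjoint_def)
next
  case (Suc i)
  have "is_adjoint (Q o\<^sub>L op_prod (replicate i Q)) (op_prod (replicate i Q) o\<^sub>L Q)"
    using assms Suc by (intro is_adjoint_comp) (simp_all add: selfadjoint_def)
  moreover have "op_prod (replicate i Q) o\<^sub>L Q = op_prod (replicate i Q @ [Q])"
    by (simp add: op_prod_append)
  ultimately show ?case by (simp add: replicate_append_same)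
qed

context tracial_ncps
begin

text \<open>The double sum is the trace of the square of a selfadjoint polynomial in
  \<open>Q\<close>.\<close>

lemma moment_positive:
  fixes p :: "nat \<Rightarrow> real"
  assumes Q: "Q \<in> M" "selfadjoint Q"
  shows "(\<Sum>i\<le>d. \<Sum>j\<le>d. complex_of_real (p i * p j) * moment \<tau> (i + j) Q) \<in> \<real>\<^sub>\<ge>\<^sub>0"
proof -
  define P where "P i = op_prod (replicate i Q)" for i
  have PM: "P i \<in> M" for i unfolding P_def using Q by (intro op_prod_closed) auto
  define S where "S i = scaleC_op (complex_of_real (p i)) (P i)" for i
  have SM: "S i \<in> M" for i unfolding S_def by (intro closed PM)
  define T where "T = (\<Sum>i\<le>d. S i)"
  have TM: "T \<in> M" unfolding T_def by (intro sum_closed SM)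
  have prod: "\<tau> (S i o\<^sub>L S j) = complex_of_real (p i * p j) * moment \<tau> (i + j) Q" for i j
  proof -
    have "moment \<tau> (i + j) Q = \<tau> (P i o\<^sub>L P j)"
      by (simp add: moment_def P_def replicate_add op_prod_append)
    then show ?thesis
      by (simp add: S_def comp_scaleC_left comp_scaleC_right[OF clinear[OF PM]] trace_scaleC closed PM)
  qed
  have "is_adjoint (S i) (S i)" for i
    using is_adjoint_scaleC[OF is_adjoint_power[OF Q(2), of i], of "complex_of_real (p i)"]
    by (simp add: S_def P_def)
  then have "is_adjoint T T" unfolding T_def by (intro is_adjoint_sum)
  then have "\<tau> (T o\<^sub>L T) \<in> \<real>\<^sub>\<ge>\<^sub>0" by (intro trace_positive TM)
  also have "T o\<^sub>L T = (\<Sum>i\<le>d. \<Sum>j\<le>d. S i o\<^sub>L S j)"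
    unfolding T_def by (rule blinfun_eqI) (simp add: blinfun.sum_left blinfun.sum_right, rule sum.swap)
  also have "\<tau> \<dots> = (\<Sum>i\<le>d. \<Sum>j\<le>d. \<tau> (S i o\<^sub>L S j))"
    by (simp add: trace_sum sum_closed closed SM)
  finally show ?thesis unfolding prod .
qed

end

section \<open>The functional of a moment sequence and the conclusion\<close>

definition moment_extension :: "(nat \<Rightarrow> real) \<Rightarrow> real poly \<Rightarrow> real" where
  "moment_extension N p = (\<Sum>i\<le>degree p. coeff p i * N i)"

lemma moment_extension_alt:
  "degree p \<le> n \<Longrightarrow> moment_extension N p = (\<Sum>i\<le>n. coeff p i * N i)"
  unfolding moment_extension_def by (intro sum.mono_neutral_left) (auto simp: coeff_eq_0)

lemma moment_extension_add:
  "moment_extension N (p + q) = moment_extension N p + moment_extension N q"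
proof -
  let ?n = "max (degree p) (degree q)"
  have "moment_extension N (p + q) = (\<Sum>i\<le>?n. coeff (p + q) i * N i)"
    by (rule moment_extension_alt[OF degree_add_le_max])
  then show ?thesis
    unfolding moment_extension_alt[OF max.cobounded1[of "degree p" "degree q"]]
      moment_extension_alt[OF max.cobounded2[of "degree q" "degree p"]]
    by (simp only: coeff_add distrib_right sum.distrib)
qed

lemma moment_extension_sum:
  "moment_extension N (\<Sum>i\<in>I. f i) = (\<Sum>i\<in>I. moment_extension N (f i))"
proof (induction I rule: infinite_finite_induct)
  case (insert x F)
  then show ?case by (simp add: moment_extension_add)
qed (simp_all add: moment_extension_def)

lemma moment_extension_monom: "moment_extension N (monom c k) = c * N k"
proof -
  have "moment_extension N (monom c k) = (\<Sum>i\<le>k. (if k = i then c else 0) * N i)"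
    by (simp add: moment_extension_alt[OF degree_monom_le] coeff_monom)
  also have "\<dots> = (\<Sum>i\<le>k. if k = i then c * N i else 0)"
    by (intro sum.cong refl) simp
  finally show ?thesis by simp
qed

lemma moment_extension_square:
  "moment_extension N (p * p) =
    (\<Sum>i\<le>degree p. \<Sum>j\<le>degree p. coeff p i * coeff p j * N (i + j))"
proof -
  let ?m = "\<lambda>i. monom (coeff p i) i"
  have "p * p = (\<Sum>i\<le>degree p. ?m i) * (\<Sum>j\<le>degree p. ?m j)"
    by (simp add: poly_as_sum_of_monoms)
  also have "\<dots> = (\<Sum>i\<le>degree p. \<Sum>j\<le>degree p. monom (coeff p i * coeff p j) (i + j))"
    by (simp add: sum_product mult_monom)
  finally show ?thesis
    by (simp add: moment_extension_sum moment_extension_monom)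
qed

lemma mat_adjoint_index:
  fixes A :: "complex mat"
  assumes "A \<in> carrier_mat n n" "i < n" "j < n"
  shows "mat_adjoint A $$ (i, j) = cnj (A $$ (j, i))"
  using assms by (auto simp: mat_adjoint_def mat_of_rows_index)

lemma (in free_copies) selfadjoint_qform:
  assumes X: "\<And>i. selfadjoint (X i)" and b: "\<And>l r. l < n \<Longrightarrow> r < n \<Longrightarrow> b r l = cnj (b l r)"
  shows "selfadjoint (qform n b)"
proof -
  have "is_adjoint (qform n b) (\<Sum>l<n. \<Sum>r<n. scaleC_op (cnj (b l r)) (X r o\<^sub>L X l))"
    unfolding qform_def using X
    by (intro is_adjoint_sum is_adjoint_scaleC is_adjoint_comp) (simp_all add: selfadjoint_def)
  also have "(\<Sum>l<n. \<Sum>r<n. scaleC_op (cnj (b l r)) (X r o\<^sub>L X l)) =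
      (\<Sum>r<n. \<Sum>l<n. scaleC_op (cnj (b l r)) (X r o\<^sub>L X l))"
    by (rule sum.swap)
  also have "\<dots> = qform n b"
    unfolding qform_def by (intro sum.cong refl) (simp add: b[symmetric])
  finally show ?thesis by (simp add: selfadjoint_def)
qed

theorem theorem3p1:
  fixes A :: "nat \<Rightarrow> complex mat"
    and \<mu> :: "real measure"
    and M :: "('h::complex_hilbert \<Rightarrow>\<^sub>L 'h) set"
    and \<tau> :: "('h \<Rightarrow>\<^sub>L 'h) \<Rightarrow> complex"
    and X :: "'h \<Rightarrow>\<^sub>L 'h"
    and Xs :: "nat \<Rightarrow> 'h \<Rightarrow>\<^sub>L 'h"
  assumes A_square: "\<And>n. n \<ge> 1 \<Longrightarrow> A n \<in> carrier_mat n n"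
    and A_selfadjoint: "\<And>n. n \<ge> 1 \<Longrightarrow> mat_adjoint (A n) = A n"
    and A_bounded: "bdd_above {cmod (A n $$ (i, j)) | n i j. i < n \<and> j < n}"
    and A_limit: "limit_distribution (\<lambda>n. (1 / of_nat n) \<cdot>\<^sub>m A n) \<mu>"
    and ncps: "tracial_ncps M \<tau>"
    and X: "X \<in> M" "selfadjoint X"
    and X_centered: "\<tau> X = 0"
    and X_variance: "variance \<tau> X = 1"
    and Xs: "\<And>i. Xs i \<in> M" "\<And>i. selfadjoint (Xs i)"
    and Xs_copies: "\<And>i. identically_distributed \<tau> (Xs i) X"
    and Xs_free: "free_family \<tau> Xs"
  shows "\<exists>(N :: (ell2 \<Rightarrow>\<^sub>L ell2) set) \<sigma> Y.
    tracial_ncps N \<sigma> \<and> Y \<in> N \<and> selfadjoint Y \<and>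
    converges_in_distribution \<tau> (\<lambda>n. quadratic_form (A n) Xs n) \<sigma> Y \<and>
    (\<forall>r\<ge>1. free_cumulant \<sigma> (replicate r Y) = complex_of_real (\<integral>t. t ^ r \<partial>\<mu>))"
proof -
  interpret tracial_ncps M \<tau> by (rule ncps)
  interpret free_copies M \<tau> Xs "\<lambda>k. moment \<tau> k X"
  proof
    show "moment \<tau> k (Xs i) = moment \<tau> k X" for k i
      using Xs_copies[of i] by (cases "k = 0") (auto simp: identically_distributed_def moment_def)
    show "moment \<tau> 1 X = 0" using X_centered by (simp add: moment_def)
    show "moment \<tau> 2 X = 1"
      using X_variance X_centered by (simp add: variance_def moment_def numeral_2_eq_2)
  qed (use Xs Xs_free in auto)
  define B where "B n = (1 / of_nat n) \<cdot>\<^sub>m A n" for n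
  define b where "b n l r = B n $$ (l, r)" for n l r
  define c where "c r = (\<integral>t. t ^ r \<partial>\<mu>)" for r :: nat
  have B: "B n \<in> carrier_mat n n" if "n \<ge> 1" for n
    using A_square[OF that] by (simp add: B_def)
  have b_A: "b n l r = A n $$ (l, r) / of_nat n" if "n \<ge> 1" "l < n" "r < n" for n l r
    using A_square[OF that(1)] that by (simp add: b_def B_def)
  obtain C0 where C0: "\<And>x. x \<in> {cmod (A n $$ (i, j)) | n i j. i < n \<and> j < n} \<Longrightarrow> x \<le> C0"
    using A_bounded unfolding bdd_above_def by blast
  define C where "C = max C0 0"
  have C: "C \<ge> 0" by (simp add: C_def)
  have b_bound: "cmod (b n l r) \<le> C / real n" if "n \<ge> 1" "l < n" "r < n" for n l r
  proof -
    have "cmod (A n $$ (l, r)) \<le> C0" by (rule C0) (use that in blast)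
    then have "cmod (A n $$ (l, r)) \<le> C" by (simp add: C_def)
    then show ?thesis using b_A[OF that] by (simp add: norm_divide divide_right_mono)
  qed
  have tr: "(\<lambda>n. mat_trace (B n ^\<^sub>m r)) \<longlonglongrightarrow> complex_of_real (c r)" if "r \<ge> 1" for r
    using A_limit that by (simp add: limit_distribution_def B_def c_def)
  \<comment> \<open>The traces give the bound \<open>C ^ r\<close>. Passing to \<open>C + 1\<close>
    keeps the growth rate positive even for \<open>C = 0\<close>, as \<open>R_pos\<close>
    demands.\<close>
  have c_bound: "\<bar>c r\<bar> \<le> (C + 1) ^ r" if r: "r \<ge> 1" for r
  proof -
    have "(\<lambda>n. cmod (mat_trace (B n ^\<^sub>m r))) \<longlonglongrightarrow> cmod (complex_of_real (c r))"
      by (intro tendsto_norm tr r)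
    moreover have "\<forall>n\<ge>1. cmod (mat_trace (B n ^\<^sub>m r)) \<le> C ^ r"
      using norm_mat_trace_pow_le[OF B _ C r] b_bound unfolding b_def by blast
    ultimately have "cmod (complex_of_real (c r)) \<le> C ^ r"
      by (intro LIMSEQ_le_const2) auto
    also have "\<dots> \<le> (C + 1) ^ r" using C by (intro power_mono) auto
    finally show ?thesis by simp
  qed
  define N where "N k = nc_sum c c {..<k}" for k
  have N_bound: "\<bar>N k\<bar> \<le> 2 * (4 * (C + 1)) ^ k" for k
    unfolding N_def using C by (intro nc_sum_bound c_bound) auto
  have pairing: "(\<lambda>n. pairing_sum n (b n) k) \<longlonglongrightarrow> complex_of_real (N k)" for k
    using pairing_sum_limit[of B c k, OF B tr] unfolding N_def b_def by blast
  have lim: "(\<lambda>n. moment \<tau> m (qform n (b n))) \<longlonglongrightarrow> complex_of_real (N m)" for m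
    using tendsto_add[OF moment_qform_asymptotics[of C b m, OF C b_bound] pairing[of m]] by simp
  have Q_eq: "quadratic_form (A n) Xs n = qform n (b n)" if "n \<ge> 1" for n
    unfolding quadratic_form_def qform_def scaleC_op_sum_right
    by (intro sum.cong refl) (simp add: b_A[OF that])
  have Q_sa: "selfadjoint (qform n (b n))" if n: "n \<ge> 1" for n
  proof (rule selfadjoint_qform[OF Xs(2)])
    fix l r assume lr: "l < n" "r < n"
    show "b n r l = cnj (b n l r)"
      using mat_adjoint_index[OF A_square[OF n] lr(2) lr(1)] A_selfadjoint[OF n] n lr
      by (simp add: b_A)
  qed
  \<comment> \<open>The constants 2 and \<open>4 * (C + 1)\<close> are those of
    \<open>nc_sum_bound\<close> for cumulants of size at most \<open>(C + 1) ^ r\<close>.\<close>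
  interpret L: moment_functional "moment_extension N" 2 "4 * (C + 1)"
  proof
    show "moment_extension N (p + q) = moment_extension N p + moment_extension N q" for p q
      by (rule moment_extension_add)
    show "moment_extension N (Polynomial.smult a p) = a * moment_extension N p" for a p
      by (simp add: moment_extension_alt[OF degree_smult_le] moment_extension_def[of N p]
          sum_distrib_left mult.assoc)
    show "moment_extension N 1 = 1"
      using moment_extension_monom[of N 1 0] by (simp add: N_def)
    show "\<bar>moment_extension N (polyX ^ k)\<bar> \<le> 2 * (4 * (C + 1)) ^ k" for k
      using moment_extension_monom[of N 1 k] N_bound[of k] by (simp add: polyX_def monom_altdef)
    show "4 * (C + 1) > 0" using C by simp
    show "moment_extension N (p * p) \<ge> 0" for p
    proof -
      let ?f = "\<lambda>n. \<Sum>i\<le>degree p. \<Sum>j\<le>degree p.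
        complex_of_real (coeff p i * coeff p j) * moment \<tau> (i + j) (qform n (b n))"
      have "?f \<longlonglongrightarrow> (\<Sum>i\<le>degree p. \<Sum>j\<le>degree p.
          complex_of_real (coeff p i * coeff p j) * complex_of_real (N (i + j)))"
        by (intro tendsto_intros lim)
      also have "(\<Sum>i\<le>degree p. \<Sum>j\<le>degree p.
          complex_of_real (coeff p i * coeff p j) * complex_of_real (N (i + j))) =
          complex_of_real (moment_extension N (p * p))"
        by (simp add: moment_extension_square)
      finally have "(\<lambda>n. Re (?f n)) \<longlonglongrightarrow> Re (complex_of_real (moment_extension N (p * p)))"
        by (rule tendsto_Re)
      moreover have "Re (?f n) \<ge> 0" if "n \<ge> 1" for n
        using moment_positive[OF qform_M Q_sa[OF that], of "coeff p" "degree p"]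
        by (simp add: complex_nonneg_Reals_iff)
      ultimately show ?thesis by (intro LIMSEQ_le_const[of "\<lambda>n. Re (?f n)"]) auto
    qed
  qed
  obtain N' :: "(ell2 \<Rightarrow>\<^sub>L ell2) set" and \<sigma> Y where Y: "tracial_ncps N' \<sigma>" "Y \<in> N'" "selfadjoint Y"
    and mom: "\<And>m. moment \<sigma> m Y = complex_of_real (moment_extension N (polyX ^ m))"
    using L.realisation by blast
  have mom': "moment \<sigma> m Y = complex_of_real (nc_sum c c {..<m})" for m
    unfolding mom using moment_extension_monom[of N 1 m] by (simp add: polyX_def monom_altdef N_def)
  have "(\<lambda>n. moment \<tau> m (quadratic_form (A n) Xs n)) \<longlonglongrightarrow> moment \<sigma> m Y" for m
  proof (rule Lim_transform_eventually[OF lim[of m, unfolded N_def, folded mom']])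
    show "\<forall>\<^sub>F n in sequentially.
        moment \<tau> m (qform n (b n)) = moment \<tau> m (quadratic_form (A n) Xs n)"
      using Q_eq by (intro eventually_sequentiallyI[of 1]) simp
  qed
  moreover have "free_cumulant \<sigma> (replicate r Y) = complex_of_real (\<integral>t. t ^ r \<partial>\<mu>)" if "r \<ge> 1" for r
    using free_cumulant_replicate_unique[of \<sigma> Y c, OF mom' that] by (simp add: c_def)
  ultimately show ?thesis
    using Y unfolding converges_in_distribution_def by blast
qed

end
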